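(* Let $p\in[2,3)$, let $\mathbf X=(X,\mathbb X)$ be a level-2 càdlàg rough path on $[0,T]$ over $\mathbb{R}^d$ with finite $p$-variation, let $F\in C_b^3(\mathbb{R}^e,\mathcal L(\mathbb{R}^d,\mathbb{R}^e))$ and $y_0\in\mathbb{R}^e$. Then there exists a unique càdlàg solution $Y\in V^p([0,T],\mathbb{R}^e)$ of $$Y_t=y_0+\int_0^tF(Y_s)^-\,d\mathbf X_s.$$ Furthermore, suppose $\|\mathbf X\|_{p,[0,T]},\|\tilde{\mathbf X}\|_{p,[0,T]}<L$, and $Y,\tilde Y$ solve the equations driven by $\mathbf X,\tilde{\mathbf X}$ respectively on $[0,T]$ (with initial values $Y_0,\tilde Y_0$). Then $$\|Y-\tilde Y\|_{p,[0,T]}\le M^2\big(C_{p,F}(1\vee L)\big)^{M+1}\big(\|\mathbf X;\tilde{\mathbf X}\|_{p,[0,T]}+|Y_0-\tilde Y_0|\big),$$ where $C_{p,F}$ depends only on $p$ and $F$, and $M$ is a constant bounded by $C_{p,F}L^p+1$.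
   Context: $C_b^3$: three times continuously differentiable, bounded with derivatives up to order $3$. $X_{s,t}=X_t-X_s$; $\|X\|_{p,[0,T]}=(\sup_{\mathcal P}\sum_{[s,t]\in\mathcal P}|X_{s,t}|^p)^{1/p}$ for paths and analogously with $\Xi_{s,t}$ in place of $X_{s,t}$ for functions of $s\le t$; $V^p$ is the space of paths of finite $p$-variation. A level-2 rough path of finite $p$-variation over $\mathbb{R}^d$ is $\mathbf X=(X,\mathbb X)$, $X:[0,T]\to\mathbb{R}^d$, $\mathbb X:\{0\le s\le t\le T\}\to\mathbb{R}^{d\times d}$, with $\mathbb X_{s,t}=\mathbb X_{s,u}+\mathbb X_{u,t}+X_{s,u}\otimes X_{u,t}$ and $\|\mathbf X\|_{p,[0,T]}:=\|X\|_{p,[0,T]}+\|\mathbb X\|_{p/2,[0,T]}<\infty$; it is càdlàg if $t\mapsto(X_t,\mathbb X_{0,t})$ is. $\|\mathbf X;\tilde{\mathbf X}\|_{p,[0,T]}:=\|X-\tilde X\|_{p,[0,T]}+\|\mathbb X-\tilde{\mathbb X}\|_{p/2,[0,T]}$. $Y$ is a solution if $(Y,F(Y))$ is a controlled rough path, i.e. $Y,F(Y)$ have finite $p$-variation and $R_{s,t}=Y_{s,t}-F(Y_s)X_{s,t}$ has finite $p/2$-variation, and for all $t$, $Y_t=y_0+\lim_{|\mathcal P|\to0}\sum_{[u,v]\in\mathcal P}\big(F(Y_u)X_{u,v}+DF(Y_u)F(Y_u)\mathbb X_{u,v}\big)$, limit over partitions of $[0,t]$ as the mesh tends to zero. *)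

theory Defs
  imports "HOL-Analysis.Analysis"
begin

definition is_partition :: "real \<Rightarrow> real \<Rightarrow> nat \<Rightarrow> (nat \<Rightarrow> real) \<Rightarrow> bool" where
  "is_partition a b n u \<longleftrightarrow> u 0 = a \<and> u n = b \<and> (\<forall>i<n. u i < u (Suc i))"

definition has_mesh_limit ::
    "(real \<Rightarrow> real \<Rightarrow> 'a::real_normed_vector) \<Rightarrow> 'a \<Rightarrow> real \<Rightarrow> real \<Rightarrow> bool" where
  "has_mesh_limit \<Xi> l a b \<longleftrightarrow>
     (\<forall>\<epsilon>>0. \<exists>\<delta>>0. \<forall>n u. is_partition a b n u \<and> (\<forall>i<n. u (Suc i) - u i < \<delta>) \<longrightarrow>
        norm ((\<Sum>i<n. \<Xi> (u i) (u (Suc i))) - l) < \<epsilon>)"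

definition incr :: "(real \<Rightarrow> 'a::real_normed_vector) \<Rightarrow> real \<Rightarrow> real \<Rightarrow> 'a" where
  "incr X s t = X t - X s"

definition var_sums ::
    "real \<Rightarrow> real \<Rightarrow> (real \<Rightarrow> real \<Rightarrow> 'a::real_normed_vector) \<Rightarrow> real set" where
  "var_sums q T \<Xi> = {\<Sum>i<n. norm (\<Xi> (u i) (u (Suc i))) powr q | n u. is_partition 0 T n u}"

definition finite_var ::
    "real \<Rightarrow> real \<Rightarrow> (real \<Rightarrow> real \<Rightarrow> 'a::real_normed_vector) \<Rightarrow> bool" where
  "finite_var q T \<Xi> \<longleftrightarrow> bdd_above (var_sums q T \<Xi>)"

text \<open>Being real-valued, this is the variation (semi)norm only under \<^const>\<open>finite_var\<close>:
  the supremum of an unbounded set of reals is an arbitrary value.\<close>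

definition var_norm ::
    "real \<Rightarrow> real \<Rightarrow> (real \<Rightarrow> real \<Rightarrow> 'a::real_normed_vector) \<Rightarrow> real" where
  "var_norm q T \<Xi> = Sup (var_sums q T \<Xi>) powr (1 / q)"

definition Vp :: "real \<Rightarrow> real \<Rightarrow> (real \<Rightarrow> 'a::real_normed_vector) set" where
  "Vp p T = {Y. finite_var p T (incr Y)}"

definition cadlag_on :: "real \<Rightarrow> (real \<Rightarrow> 'a::topological_space) \<Rightarrow> bool" where
  "cadlag_on T f \<longleftrightarrow>
     (\<forall>t. 0 \<le> t \<and> t < T \<longrightarrow> (f \<longlongrightarrow> f t) (at_right t)) \<and>
     (\<forall>t. 0 < t \<and> t \<le> T \<longrightarrow> (\<exists>l. (f \<longlongrightarrow> l) (at_left t)))"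

definition tensor :: "real^'d \<Rightarrow> real^'d \<Rightarrow> real^'d^'d" where
  "tensor x y = (\<chi> i j. x $ i * y $ j)"

text \<open>A path on [0,T] is a total function of which only the values on [0,T] matter; likewise
  the second level matters only at \<open>s \<le> t\<close> in [0,T].\<close>

definition rough_path ::
    "real \<Rightarrow> real \<Rightarrow> (real \<Rightarrow> real^'d) \<Rightarrow> (real \<Rightarrow> real \<Rightarrow> real^'d^'d) \<Rightarrow> bool" where
  "rough_path p T X XX \<longleftrightarrow>
     (\<forall>s u t. 0 \<le> s \<and> s \<le> u \<and> u \<le> t \<and> t \<le> T \<longrightarrow>
        XX s t = XX s u + XX u t + tensor (incr X s u) (incr X u t)) \<and>
     finite_var p T (incr X) \<and> finite_var (p / 2) T XX"

definition cadlag_rough_path ::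
    "real \<Rightarrow> real \<Rightarrow> (real \<Rightarrow> real^'d) \<Rightarrow> (real \<Rightarrow> real \<Rightarrow> real^'d^'d) \<Rightarrow> bool" where
  "cadlag_rough_path p T X XX \<longleftrightarrow>
     rough_path p T X XX \<and> cadlag_on T (\<lambda>t. (X t, XX 0 t))"

definition rough_norm ::
    "real \<Rightarrow> real \<Rightarrow> (real \<Rightarrow> real^'d) \<Rightarrow> (real \<Rightarrow> real \<Rightarrow> real^'d^'d) \<Rightarrow> real" where
  "rough_norm p T X XX = var_norm p T (incr X) + var_norm (p / 2) T XX"

definition rough_dist ::
    "real \<Rightarrow> real \<Rightarrow> (real \<Rightarrow> real^'d) \<Rightarrow> (real \<Rightarrow> real \<Rightarrow> real^'d^'d) \<Rightarrow>
     (real \<Rightarrow> real^'d) \<Rightarrow> (real \<Rightarrow> real \<Rightarrow> real^'d^'d) \<Rightarrow> real" where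
  "rough_dist p T X XX X' XX' =
     var_norm p T (incr (\<lambda>t. X t - X' t)) + var_norm (p / 2) T (\<lambda>s t. XX s t - XX' s t)"

definition Cb3 :: "('a::real_normed_vector \<Rightarrow> 'b::real_normed_vector) \<Rightarrow> bool" where
  "Cb3 f \<longleftrightarrow>
     (\<exists>(f1 :: 'a \<Rightarrow> 'a \<Rightarrow>\<^sub>L 'b)
       (f2 :: 'a \<Rightarrow> 'a \<Rightarrow>\<^sub>L 'a \<Rightarrow>\<^sub>L 'b)
       (f3 :: 'a \<Rightarrow> 'a \<Rightarrow>\<^sub>L 'a \<Rightarrow>\<^sub>L 'a \<Rightarrow>\<^sub>L 'b).
        (\<forall>x. (f has_derivative blinfun_apply (f1 x)) (at x)) \<and>
        (\<forall>x. (f1 has_derivative blinfun_apply (f2 x)) (at x)) \<and>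
        (\<forall>x. (f2 has_derivative blinfun_apply (f3 x)) (at x)) \<and>
        continuous_on UNIV f3 \<and>
        bounded (range f) \<and> bounded (range f1) \<and> bounded (range f2) \<and> bounded (range f3))"

text \<open>The action of \<open>DF(y)F(y)\<close> on a matrix \<open>A\<close> is the linear extension of
  \<open>tensor v w \<mapsto> DF(y)(F(y)v)w\<close>: the first index of \<open>A\<close> is the earlier integrator,
  in agreement with Chen's relation in \<^const>\<open>rough_path\<close>.\<close>

definition DFF ::
    "(real^'e \<Rightarrow> (real^'d) \<Rightarrow>\<^sub>L (real^'e)) \<Rightarrow> real^'e \<Rightarrow> real^'d^'d \<Rightarrow> real^'e" where
  "DFF F y A = (\<Sum>i\<in>UNIV. \<Sum>j\<in>UNIV. A $ i $ j *\<^sub>R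
     blinfun_apply (frechet_derivative F (at y) (blinfun_apply (F y) (axis i 1))) (axis j 1))"

definition rde_solution ::
    "real \<Rightarrow> real \<Rightarrow> (real^'e \<Rightarrow> (real^'d) \<Rightarrow>\<^sub>L (real^'e)) \<Rightarrow>
     (real \<Rightarrow> real^'d) \<Rightarrow> (real \<Rightarrow> real \<Rightarrow> real^'d^'d) \<Rightarrow> real^'e \<Rightarrow> (real \<Rightarrow> real^'e) \<Rightarrow> bool" where
  "rde_solution p T F X XX y0 Y \<longleftrightarrow>
     Y \<in> Vp p T \<and> (\<lambda>t. F (Y t)) \<in> Vp p T \<and>
     finite_var (p / 2) T (\<lambda>s t. incr Y s t - blinfun_apply (F (Y s)) (incr X s t)) \<and>
     (\<forall>t. 0 \<le> t \<and> t \<le> T \<longrightarrow>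
        (\<exists>I. has_mesh_limit
               (\<lambda>u v. blinfun_apply (F (Y u)) (incr X u v) + DFF F (Y u) (XX u v)) I 0 t \<and>
             Y t = y0 + I))"

end

theory Submission
  imports Defs
begin

text \<open>
  Write \<open>\<Xi>(s,t) = F(Y\<^sub>s) X\<^sub>s\<^sub>,\<^sub>t + DF(Y\<^sub>s)F(Y\<^sub>s) XX\<^sub>s\<^sub>,\<^sub>t\<close> for one step of the second-order Euler
  scheme. The whole theory is about the error \<open>Y\<^sub>t - Y\<^sub>s - \<Xi>(s,t)\<close> of such a step. All variations are
  dominated by increments of one increasing function \<open>g\<close>, the control: with
  \<open>\<omega> = (g(t) - g(s))\<^sup>1\<^sup>/\<^sup>p\<close> one has \<open>|X\<^sub>s\<^sub>,\<^sub>t| \<le> \<omega>\<close> and \<open>|XX\<^sub>s\<^sub>,\<^sub>t| \<le> \<omega>\<^sup>2\<close>, and since \<open>p < 3\<close> the cube of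
  \<open>\<omega>\<close> is superadditive with room to spare.

  \<^bold>\<open>Short intervals.\<close> By Chen's relation the defect \<open>\<Xi>(s,t) - \<Xi>(s,u) - \<Xi>(u,t)\<close> is of order \<open>\<omega>\<^sup>3\<close> as
  soon as the remainder \<open>R\<^sub>s\<^sub>,\<^sub>t = Y\<^sub>s\<^sub>,\<^sub>t - F(Y\<^sub>s) X\<^sub>s\<^sub>,\<^sub>t\<close> is of order \<open>\<omega>\<^sup>2\<close> (\<open>Xi_defect\<close>), and sewing
  turns this into an error of order \<open>\<omega>\<^sup>3\<close>. Where \<open>\<omega>\<close> is small, a bound \<open>|R| \<le> D \<omega>\<^sup>2\<close> therefore
  improves to \<open>|R| \<le> (A + D/2) \<omega>\<^sup>2\<close>, which gives the a priori estimate \<open>local_apriori\<close>. The same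
  halving argument applied to two solutions gives \<open>local_difference\<close>.

  \<^bold>\<open>Jumps.\<close> A jump of the driver can make \<open>g\<close> increase by a large amount at a single time, so
  \<open>[0,T]\<close> need not split into intervals on which \<open>\<omega>\<close> is small. It does split into finitely
  many level sets of \<open>g\<close> on which \<open>\<omega>\<close> is small, and one passes from one level set to the next by a single
  step of the scheme: for a solution the error of a step tends to zero with its length
  (\<open>mesh_limit_uniform\<close>), no matter how large the jump inside it. Each passage costs a factor
  \<open>const (1 \<or> L)\<^sup>2\<close>, and there are at most \<open>const (1 \<or> L)\<^sup>p\<close> level sets (\<open>level_growth\<close>, \<open>stability\<close>,
  \<open>global_lipschitz\<close>). Uniqueness is the case of equal drivers and initial values.

  \<^bold>\<open>Existence.\<close> The Euler scheme over a finite set of times satisfies the same a priori estimate,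
  uniformly in the set. The schemes are uniformly bounded, so by Tychonoff's theorem they have a
  cluster point along the directed family of finite subsets of \<open>[0,T]\<close>, and every closed
  condition on finitely many times passes to it (\<open>euler_limit_exists\<close>). The
  step errors of the cluster point are of order \<open>\<omega>\<^sup>3\<close> where \<open>\<omega>\<close> is small, and they tend to zero
  uniformly with the length of the step because a scheme makes no error on the step that
  contains a jump. This makes the Riemann sums converge in mesh (\<open>rde_solution_of_errors\<close>).
\<close>

section \<open>Partitions and controls\<close>

lemma is_partition_append:
  assumes "is_partition a b n u" "b < c"
  shows "is_partition a c (Suc n) (u(Suc n := c))"
  using assms by (auto simp: is_partition_def less_Suc_eq)

lemma sum_append:
  fixes f :: "real \<Rightarrow> real \<Rightarrow> 'a::comm_monoid_add"
  assumes "u n = b"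
  shows "(\<Sum>i<Suc n. f ((u(Suc n := c)) i) ((u(Suc n := c)) (Suc i))) = (\<Sum>i<n. f (u i) (u (Suc i))) + f b c"
  using assms by simp

lemma is_partition_mono:
  assumes "is_partition a b n u" "i \<le> j" "j \<le> n"
  shows "u i \<le> u j"
  using assms(2,3)
proof (induction j rule: dec_induct)
  case (step m)
  then have "u m < u (Suc m)" using assms(1) by (auto simp: is_partition_def)
  with step show ?case by simp
qed auto

lemma is_partition_range:
  assumes "is_partition a b n u" "i \<le> n"
  shows "a \<le> u i" "u i \<le> b"
  using is_partition_mono[OF assms(1), of 0 i] is_partition_mono[OF assms(1), of i n] assms
  by (auto simp: is_partition_def)

lemma partition_concat:
  fixes f :: "real \<Rightarrow> real \<Rightarrow> 'a::comm_monoid_add"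
  assumes "is_partition a b n u" "is_partition b c m v"
    and "\<forall>i<n. u (Suc i) - u i < \<delta>" "\<forall>i<m. v (Suc i) - v i < \<delta>"
  shows "\<exists>w. is_partition a c (n + m) w \<and> (\<forall>i<n+m. w (Suc i) - w i < \<delta>) \<and>
    (\<Sum>i<n+m. f (w i) (w (Suc i))) = (\<Sum>i<n. f (u i) (u (Suc i))) + (\<Sum>i<m. f (v i) (v (Suc i)))"
proof -
  define w where "w i = (if i \<le> n then u i else v (i - n))" for i
  have un: "u n = v 0" using assms by (simp add: is_partition_def)
  have wn: "w (n + i) = v i" for i using un by (cases i) (auto simp: w_def)
  have steps: "w i = u i \<and> w (Suc i) = u (Suc i)" if "i < n" for i using that by (auto simp: w_def)
  have steps': "w i = v (i - n) \<and> w (Suc i) = v (Suc (i - n))" if "\<not> i < n" for i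
    using that wn[of "i - n"] wn[of "Suc (i - n)"] by simp
  have 1: "is_partition a c (n + m) w"
    unfolding is_partition_def
  proof (intro conjI allI impI)
    show "w 0 = a" using assms by (simp add: w_def is_partition_def)
    show "w (n + m) = c" using assms wn[of m] by (simp add: is_partition_def)
    fix i assume "i < n + m"
    then show "w i < w (Suc i)"
      using assms steps[of i] steps'[of i] by (cases "i < n") (auto simp: is_partition_def)
  qed
  have 2: "\<forall>i<n+m. w (Suc i) - w i < \<delta>"
  proof (intro allI impI)
    fix i assume "i < n + m"
    then show "w (Suc i) - w i < \<delta>"
      using assms steps[of i] steps'[of i] by (cases "i < n") auto
  qed
  have 3: "(\<Sum>i<n+m. f (w i) (w (Suc i))) = (\<Sum>i<n. f (u i) (u (Suc i))) + (\<Sum>i<m. f (v i) (v (Suc i)))"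
  proof -
    have "(\<Sum>i<n+m. f (w i) (w (Suc i))) = (\<Sum>i<n. f (w i) (w (Suc i))) + (\<Sum>i<m. f (w (n+i)) (w (Suc (n+i))))"
      by (induction m) (auto simp: add.assoc)
    then show ?thesis using wn steps by (simp flip: add_Suc_right)
  qed
  show ?thesis using 1 2 3 by (intro exI[of _ w] conjI)
qed

lemma fine_partition_exists:
  fixes a b \<delta> :: real
  assumes "a \<le> b" "\<delta> > 0"
  obtains n u where "is_partition a b n u" "\<forall>i<n. u (Suc i) - u i < \<delta>"
proof (cases "a = b")
  case True
  show thesis by (rule that[of 0 "\<lambda>_. a"]) (auto simp: is_partition_def True)
next
  case False
  with assms have ab: "a < b" by simp
  obtain n :: nat where n: "(b - a) / \<delta> < real n" using reals_Archimedean2 by blast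
  have n0: "real n > 0" using n ab assms by (smt (verit) divide_pos_pos)
  have step: "(b - a) / real n > 0" "(b - a) / real n < \<delta>"
    using n n0 ab assms by (auto simp: field_simps)
  define u where "u i = a + real i * ((b - a) / real n)" for i
  have d: "u (Suc i) - u i = (b - a) / real n" for i by (simp only: u_def of_nat_Suc ring_distribs)
  show thesis
  proof (rule that[of n u])
    show "is_partition a b n u"
      unfolding is_partition_def
    proof (intro conjI allI impI)
      show "u 0 = a" "u n = b" using n0 by (auto simp: u_def)
      show "u i < u (Suc i)" for i using d[of i] step by linarith
    qed
    show "\<forall>i<n. u (Suc i) - u i < \<delta>" using d step by simp
  qed
qed

lemma telescope_partition:
  fixes g :: "real \<Rightarrow> 'a::ab_group_add"
  assumes "is_partition a b n u"
  shows "(\<Sum>i<n. g (u (Suc i)) - g (u i)) = g b - g a"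
  using assms sum_lessThan_telescope[of "\<lambda>i. g (u i)" n] by (simp add: is_partition_def)

text \<open>The control at \<open>t\<close> is the variation over \<open>[0,t]\<close>: a partition of \<open>[0,s]\<close> followed by the single
  interval \<open>[s,t]\<close> is a partition of \<open>[0,t]\<close>. Only this increment inequality is asked of a control,
  so that controls can be added and scaled freely.\<close>

lemma finite_var_increasing_control:
  assumes fv: "finite_var q T \<Xi>" and T: "0 \<le> T"
  obtains g where "g 0 = 0" "g T = Sup (var_sums q T \<Xi>)"
    "\<And>s t. 0 \<le> s \<Longrightarrow> s < t \<Longrightarrow> t \<le> T \<Longrightarrow> norm (\<Xi> s t) powr q \<le> g t - g s"
proof -
  define V where "V t = var_sums q t \<Xi>" for t
  define g where "g t = Sup (V t)" for t
  have ext: "x + norm (\<Xi> s t) powr q \<in> V t" if "x \<in> V s" "s < t" for x s t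
  proof -
    obtain n u where u: "is_partition 0 s n u" "x = (\<Sum>i<n. norm (\<Xi> (u i) (u (Suc i))) powr q)"
      using \<open>x \<in> V s\<close> by (auto simp: V_def var_sums_def)
    have us: "u n = s" using u by (simp add: is_partition_def)
    show ?thesis
      unfolding V_def var_sums_def mem_Collect_eq
      apply (rule exI[of _ "Suc n"], rule exI[of _ "u(Suc n := t)"])
      using is_partition_append[OF u(1) \<open>s < t\<close>] sum_append[where u=u and n=n and b=s and c=t and f="\<lambda>s t. norm (\<Xi> s t) powr q", OF us] u(2)
      by simp
  qed
  have V0: "V 0 = {0}"
  proof -
    have "n = 0" if "is_partition 0 0 n u" for n u
      using is_partition_mono[OF that, of 1 n] that by (cases n) (auto simp: is_partition_def)
    moreover have "is_partition 0 0 0 (\<lambda>_. 0)" by (simp add: is_partition_def)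
    ultimately show ?thesis unfolding V_def var_sums_def by fastforce
  qed
  have ne: "V t \<noteq> {}" if "0 \<le> t" for t
    using that ext[of 0 0 t] V0 by (cases "t = 0") auto
  have bdd: "bdd_above (V t)" if "0 \<le> t" "t \<le> T" for t
  proof -
    obtain B where B: "\<And>x. x \<in> V T \<Longrightarrow> x \<le> B"
      using fv by (auto simp: finite_var_def bdd_above_def V_def)
    have "x \<le> B" if "x \<in> V t" for x
    proof (cases "t = T")
      case False
      then have "t < T" using \<open>t \<le> T\<close> by simp
      from B[OF ext[OF that this]] powr_ge_zero[of "norm (\<Xi> t T)" q] show ?thesis by linarith
    qed (use B that in simp)
    then show ?thesis by (auto simp: bdd_above_def)
  qed
  have "norm (\<Xi> s t) powr q \<le> g t - g s" if "0 \<le> s" "s < t" "t \<le> T" for s t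
  proof -
    have "g s \<le> g t - norm (\<Xi> s t) powr q"
      unfolding g_def
    proof (rule cSup_least)
      show "V s \<noteq> {}" using ne that by simp
      fix x assume "x \<in> V s"
      from cSup_upper[OF ext[OF this \<open>s < t\<close>] bdd] that
      show "x \<le> Sup (V t) - norm (\<Xi> s t) powr q" by simp
    qed
    then show ?thesis by simp
  qed
  moreover have "g 0 = 0" using V0 by (simp add: g_def)
  ultimately show thesis using that[of g] by (simp add: g_def V_def)
qed

text \<open>Along a partition the increments of \<open>g\<close> telescope.\<close>

lemma control_imp_finite_var:
  assumes T: "0 < T"
    and b: "\<And>s t. 0 \<le> s \<Longrightarrow> s < t \<Longrightarrow> t \<le> T \<Longrightarrow> norm (\<Xi> s t) powr q \<le> g t - g s"
  shows "finite_var q T \<Xi>" "0 \<le> Sup (var_sums q T \<Xi>)" "Sup (var_sums q T \<Xi>) \<le> g T - g 0"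
proof -
  have ub: "x \<le> g T - g 0" if x: "x \<in> var_sums q T \<Xi>" for x
  proof -
    obtain n u where u: "is_partition 0 T n u" "x = (\<Sum>i<n. norm (\<Xi> (u i) (u (Suc i))) powr q)"
      using x by (auto simp: var_sums_def)
    have "x \<le> (\<Sum>i<n. g (u (Suc i)) - g (u i))"
      unfolding u(2)
    proof (rule sum_mono)
      fix i assume "i \<in> {..<n}"
      then show "norm (\<Xi> (u i) (u (Suc i))) powr q \<le> g (u (Suc i)) - g (u i)"
        using u(1) is_partition_range[OF u(1), of i] is_partition_range[OF u(1), of "Suc i"]
        by (intro b) (auto simp: is_partition_def)
    qed
    then show ?thesis using telescope_partition[OF u(1), where g=g] by simp
  qed
  then show fv: "finite_var q T \<Xi>" by (auto simp: finite_var_def bdd_above_def)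
  have mem: "norm (\<Xi> 0 T) powr q \<in> var_sums q T \<Xi>"
    unfolding var_sums_def mem_Collect_eq
    by (rule exI[of _ 1], rule exI[of _ "\<lambda>i. if i = 0 then 0 else T"]) (use T in \<open>auto simp: is_partition_def\<close>)
  from cSup_upper[OF mem] fv have "norm (\<Xi> 0 T) powr q \<le> Sup (var_sums q T \<Xi>)"
    by (simp add: finite_var_def)
  then show "0 \<le> Sup (var_sums q T \<Xi>)" by (rule order_trans[rotated]) simp
  show "Sup (var_sums q T \<Xi>) \<le> g T - g 0"
    using mem by (intro cSup_least ub) auto
qed

section \<open>The sewing bound\<close>

text \<open>The \<open>p\<close>-th root makes the three homogeneities \<open>1/p\<close>, \<open>2/p\<close> and \<open>3/p\<close> the first, second and third
  power of one quantity, so that the estimates below are polynomial.\<close>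

definition modulus :: "real \<Rightarrow> (real \<Rightarrow> real) \<Rightarrow> real \<Rightarrow> real \<Rightarrow> real" where
  "modulus p g s t = (g t - g s) powr (1 / p)"

lemma modulus_nonneg [simp]: "0 \<le> modulus p g s t"
  by (simp add: modulus_def)

lemma modulus_mono:
  assumes "0 < p" "g s' \<le> g s" "g s \<le> g t" "g t \<le> g t'"
  shows "modulus p g s t \<le> modulus p g s' t'"
  using assms unfolding modulus_def by (intro powr_mono2) auto

lemma modulus_power:
  assumes "0 < p" "0 < k"
  shows "modulus p g s t ^ k = (g t - g s) powr (real k / p)"
  using assms unfolding modulus_def
  by (cases "g t = g s") (simp_all add: powr_power)

lemma modulus_le_of_half:
  assumes "0 < p" "0 < \<epsilon>" "g s \<le> g t" "g t - g s \<le> \<epsilon> powr p / 2"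
  shows "modulus p g s t \<le> \<epsilon>"
proof -
  have "modulus p g s t \<le> (\<epsilon> powr p) powr (1 / p)"
    unfolding modulus_def using assms powr_ge_zero[of \<epsilon> p] by (intro powr_mono2) auto
  then show ?thesis using assms by (simp add: powr_powr)
qed

text \<open>The fixed point of the recursion \<open>c = 2 (1/2)\<^sup>3\<^sup>/\<^sup>p c + 2\<close> that arises in \<open>sewing_chain\<close>; it is finite
  because \<open>3/p > 1\<close>.\<close>

definition sew_const :: "real \<Rightarrow> real" where
  "sew_const p = 2 / (1 - 2 powr (1 - 3 / p))"

lemma sew_const_props:
  assumes "0 < p" "p < 3"
  shows "1 \<le> sew_const p" "2 * sew_const p * (1/2) powr (3 / p) + 2 = sew_const p"
proof -
  let ?\<theta> = "2 powr (1 - 3 / p)"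
  have "1 - 3 / p < 0" using assms by (simp add: field_simps)
  then have \<theta>: "?\<theta> < 1" by (metis powr_less_cancel_iff powr_zero_eq_one one_less_numeral_iff semiring_norm(76) zero_neq_numeral)
  then show "1 \<le> sew_const p" by (simp add: sew_const_def field_simps)
  have "2 * (1/2) powr (3 / p) = ?\<theta>"
    by (simp add: powr_diff powr_divide)
  then have "2 * sew_const p * (1/2) powr (3 / p) + 2 = sew_const p * ?\<theta> + 2" by simp
  also have "\<dots> = sew_const p"
  proof -
    have "2 / x * x = 2" if "x \<noteq> 0" for x :: real using that by simp
    then have "sew_const p * (1 - ?\<theta>) = 2" using \<theta> unfolding sew_const_def by (metis diff_gt_0_iff_gt less_irrefl)
    then show ?thesis by (simp add: algebra_simps)
  qed
  finally show "2 * sew_const p * (1/2) powr (3 / p) + 2 = sew_const p" .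
qed

text \<open>The chain is cut where half of the control has been used up. The two outer parts carry at most
  half of the control each, hence a fraction \<open>(1/2)\<^sup>3\<^sup>/\<^sup>p < 1/2\<close> of the bound each, and joining them
  with the middle step costs two defects. The interval in the middle may carry a large part of
  the control, as it does at a jump.\<close>

lemma sewing_chain:
  fixes \<Xi> :: "real \<Rightarrow> real \<Rightarrow> 'a::real_normed_vector"
  assumes p: "0 < p" "p < 3" and K: "0 \<le> K"
    and g: "\<And>i j. i \<le> j \<Longrightarrow> j \<le> n \<Longrightarrow> g (u i) \<le> g (u j)"
    and diag: "\<And>i. i \<le> n \<Longrightarrow> \<Xi> (u i) (u i) = 0"
    and \<delta>: "\<And>i j k. i \<le> j \<Longrightarrow> j \<le> k \<Longrightarrow> k \<le> n \<Longrightarrow>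
        norm (\<Xi> (u i) (u k) - \<Xi> (u i) (u j) - \<Xi> (u j) (u k)) \<le> K * modulus p g (u i) (u k) ^ 3"
  shows "norm ((\<Sum>i<n. \<Xi> (u i) (u (Suc i))) - \<Xi> (u 0) (u n)) \<le> sew_const p * K * modulus p g (u 0) (u n) ^ 3"
proof -
  define c where "c = sew_const p"
  have c: "1 \<le> c" "2 * c * (1/2) powr (3 / p) + 2 = c" using sew_const_props[OF p] by (simp_all add: c_def)
  let ?m = "\<lambda>i j. modulus p g (u i) (u j)"
  have "norm ((\<Sum>l\<in>{i..<k}. \<Xi> (u l) (u (Suc l))) - \<Xi> (u i) (u k)) \<le> c * K * ?m i k ^ 3"
    if "i \<le> k" "k \<le> n" for i k
    using that
  proof (induction "k - i" arbitrary: i k rule: less_induct)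
    case less
    show ?case
    proof (cases "i = k")
      case True
      then show ?thesis using diag[of i] less.prems K c by simp
    next
      case False
      with less.prems have ik: "i < k" by simp
      \<comment> \<open>The last index whose control from the left end is at most half of the total; the control
        from its successor to the right end is then at most half as well.\<close>
      define w where "w = g (u k) - g (u i)"
      have w: "0 \<le> w" using g[of i k] ik less.prems by (simp add: w_def)
      define A where "A = {m \<in> {i..<k}. g (u m) - g (u i) \<le> w / 2}"
      have A: "finite A" "i \<in> A" using ik w by (auto simp: A_def)
      define m where "m = Max A"
      have "m \<in> A" using A Max_in unfolding m_def by blast
      then have m: "i \<le> m" "m < k" "g (u m) - g (u i) \<le> w / 2" by (auto simp: A_def)
      have right: "g (u k) - g (u (Suc m)) \<le> w / 2"
      proof (cases "Suc m < k")
        case True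
        have "Suc m \<notin> A"
        proof
          assume "Suc m \<in> A"
          from Max_ge[OF A(1) this] show False by (simp add: m_def)
        qed
        then have "g (u (Suc m)) - g (u i) > w / 2" using True m by (auto simp: A_def)
        then show ?thesis by (simp add: w_def field_simps)
      next
        case False
        then have "Suc m = k" using m by simp
        then show ?thesis using w by simp
      qed
      have half: "?m a b ^ 3 \<le> (1/2) powr (3 / p) * ?m i k ^ 3"
        if "g (u b) - g (u a) \<le> w / 2" "a \<le> b" "b \<le> n" for a b
      proof -
        have "?m a b ^ 3 \<le> (w / 2) powr (3 / p)"
          using that g[of a b] p by (simp add: modulus_power powr_mono2)
        also have "\<dots> = (1/2) powr (3 / p) * w powr (3 / p)"
          using w by (simp add: powr_mult[symmetric])
        finally show ?thesis using p by (simp add: modulus_power w_def)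
      qed
      let ?S = "\<lambda>a b. \<Sum>l\<in>{a..<b}. \<Xi> (u l) (u (Suc l))"
      have split: "?S i k = ?S i m + \<Xi> (u m) (u (Suc m)) + ?S (Suc m) k"
      proof -
        have "?S i k = ?S i m + ?S m k" using m by (simp add: sum.atLeastLessThan_concat)
        also have "?S m k = \<Xi> (u m) (u (Suc m)) + ?S (Suc m) k"
          using m(2) by (simp add: sum.atLeast_Suc_lessThan)
        finally show ?thesis by (simp add: add.assoc)
      qed
      let ?D = "\<lambda>a b d. \<Xi> (u a) (u d) - \<Xi> (u a) (u b) - \<Xi> (u b) (u d)"
      have "?S i k - \<Xi> (u i) (u k) =
          (?S i m - \<Xi> (u i) (u m)) + (?S (Suc m) k - \<Xi> (u (Suc m)) (u k)) - ?D i m k - ?D m (Suc m) k"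
        using split by (simp add: algebra_simps)
      also have "norm \<dots> \<le> norm (?S i m - \<Xi> (u i) (u m)) + norm (?S (Suc m) k - \<Xi> (u (Suc m)) (u k))
          + norm (?D i m k) + norm (?D m (Suc m) k)"
        by (intro order_trans[OF norm_triangle_ineq4] add_mono order_trans[OF norm_triangle_ineq] order_refl)
      also have "\<dots> \<le> c * K * ((1/2) powr (3 / p) * ?m i k ^ 3) + c * K * ((1/2) powr (3 / p) * ?m i k ^ 3)
          + K * ?m i k ^ 3 + K * ?m i k ^ 3"
      proof (intro add_mono)
        have cK: "0 \<le> c * K" using c K by simp
        show "norm (?S i m - \<Xi> (u i) (u m)) \<le> c * K * ((1/2) powr (3 / p) * ?m i k ^ 3)"
          using less.hyps[of m i] half[of m i] m less.prems
          by (intro order_trans[OF _ mult_left_mono[OF half[of m i] cK]]) auto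
        show "norm (?S (Suc m) k - \<Xi> (u (Suc m)) (u k)) \<le> c * K * ((1/2) powr (3 / p) * ?m i k ^ 3)"
          using less.hyps[of k "Suc m"] right m less.prems
          by (intro order_trans[OF _ mult_left_mono[OF half[of k "Suc m"] cK]]) auto
        show "norm (?D i m k) \<le> K * ?m i k ^ 3" using \<delta>[of i m k] m less.prems by auto
        have "?m m k \<le> ?m i k" using g[of i m] g[of m k] m less.prems p by (intro modulus_mono) auto
        then have "K * ?m m k ^ 3 \<le> K * ?m i k ^ 3" using K by (intro mult_left_mono power_mono) auto
        then show "norm (?D m (Suc m) k) \<le> K * ?m i k ^ 3"
          using \<delta>[of m "Suc m" k] m less.prems by auto
      qed
      also have "\<dots> = (2 * c * (1/2) powr (3 / p) + 2) * K * ?m i k ^ 3" by (simp add: algebra_simps)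
      finally show ?thesis using c by simp
    qed
  qed
  from this[of 0 n] show ?thesis by (simp add: c_def atLeast0LessThan)
qed

text \<open>The points of the approximating chains are confined to \<open>J\<close>. For an interval \<open>J\<close> this is a
  consequence of a mesh limit; for a finite set \<open>J\<close> it holds for an Euler scheme over \<open>J\<close>, whose sums
  are exact. One a priori estimate thus covers solutions and schemes.\<close>

definition has_chain_limit :: "real set \<Rightarrow> (real \<Rightarrow> real \<Rightarrow> 'a::real_normed_vector) \<Rightarrow> 'a \<Rightarrow> real \<Rightarrow> real \<Rightarrow> bool" where
  "has_chain_limit J \<Xi> l s t \<longleftrightarrow>
     (\<forall>\<epsilon>>0. \<exists>n u. is_partition s t n u \<and> u ` {..n} \<subseteq> J \<and> norm ((\<Sum>i<n. \<Xi> (u i) (u (Suc i))) - l) < \<epsilon>)"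

lemma sewing:
  fixes \<Xi> :: "real \<Rightarrow> real \<Rightarrow> 'a::real_normed_vector"
  assumes p: "0 < p" "p < 3" and K: "0 \<le> K" and mono: "mono_on J g"
    and diag: "\<And>s. s \<in> J \<Longrightarrow> \<Xi> s s = 0"
    and \<delta>: "\<And>s r t. s \<in> J \<Longrightarrow> r \<in> J \<Longrightarrow> t \<in> J \<Longrightarrow> s \<le> r \<Longrightarrow> r \<le> t \<Longrightarrow>
        norm (\<Xi> s t - \<Xi> s r - \<Xi> r t) \<le> K * modulus p g s t ^ 3"
    and lim: "has_chain_limit J \<Xi> l s t"
  shows "norm (l - \<Xi> s t) \<le> sew_const p * K * modulus p g s t ^ 3"
proof (rule field_le_epsilon)
  fix e :: real assume "0 < e"
  then obtain n u where u: "is_partition s t n u" "u ` {..n} \<subseteq> J"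
      "norm ((\<Sum>i<n. \<Xi> (u i) (u (Suc i))) - l) < e"
    using lim unfolding has_chain_limit_def by blast
  have uJ: "u i \<in> J" if "i \<le> n" for i using u(2) that by auto
  have le: "u i \<le> u j" if "i \<le> j" "j \<le> n" for i j using is_partition_mono[OF u(1) that] .
  have "norm ((\<Sum>i<n. \<Xi> (u i) (u (Suc i))) - \<Xi> (u 0) (u n)) \<le> sew_const p * K * modulus p g (u 0) (u n) ^ 3"
  proof (rule sewing_chain[OF p K])
    show "g (u i) \<le> g (u j)" if "i \<le> j" "j \<le> n" for i j
      using that le[of i j] uJ[of i] uJ[of j] mono by (auto simp: mono_on_def)
    show "\<Xi> (u i) (u i) = 0" if "i \<le> n" for i using diag uJ that by simp
    show "norm (\<Xi> (u i) (u k) - \<Xi> (u i) (u j) - \<Xi> (u j) (u k)) \<le> K * modulus p g (u i) (u k) ^ 3"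
      if "i \<le> j" "j \<le> k" "k \<le> n" for i j k
      using that le uJ by (intro \<delta>) auto
  qed
  moreover have "u 0 = s" "u n = t" using u(1) by (auto simp: is_partition_def)
  ultimately show "norm (l - \<Xi> s t) \<le> sew_const p * K * modulus p g s t ^ 3 + e"
    using u(3) norm_triangle_ineq4[of "(\<Sum>i<n. \<Xi> (u i) (u (Suc i))) - \<Xi> s t" "(\<Sum>i<n. \<Xi> (u i) (u (Suc i))) - l"]
    by simp
qed

section \<open>Smooth vector fields\<close>

text \<open>What bounded first and second derivatives give, in a form without derivatives that is easily
  seen to be stable under products.\<close>

definition second_order_lipschitz :: "real \<Rightarrow> ('a::real_normed_vector \<Rightarrow> 'b::real_normed_vector) \<Rightarrow> bool" where
  "second_order_lipschitz K h \<longleftrightarrow>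
     (\<forall>y. norm (h y) \<le> K) \<and> (\<forall>y z. norm (h y - h z) \<le> K * norm (y - z)) \<and>
     (\<forall>y k y' k'. norm ((h (y + k) - h y) - (h (y' + k') - h y')) \<le> K * (norm (k - k') + norm k' * norm (y - y')))"

lemma second_order_lipschitz_weaken:
  assumes "second_order_lipschitz K h" "K \<le> K'"
  shows "second_order_lipschitz K' h"
  unfolding second_order_lipschitz_def
proof (intro conjI allI)
  show "norm (h y) \<le> K'" for y
    using assms unfolding second_order_lipschitz_def by (meson order_trans)
  show "norm (h y - h z) \<le> K' * norm (y - z)" for y z
    using assms mult_right_mono[OF assms(2), of "norm (y - z)"]
    unfolding second_order_lipschitz_def by (meson order_trans norm_ge_zero)
  show "norm ((h (y + k) - h y) - (h (y' + k') - h y')) \<le> K' * (norm (k - k') + norm k' * norm (y - y'))" for y k y' k'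
  proof -
    have "norm ((h (y + k) - h y) - (h (y' + k') - h y')) \<le> K * (norm (k - k') + norm k' * norm (y - y'))"
      using assms by (simp add: second_order_lipschitz_def)
    also have "\<dots> \<le> K' * (norm (k - k') + norm k' * norm (y - y'))"
      by (intro mult_right_mono assms) auto
    finally show ?thesis .
  qed
qed

lemma second_order_lipschitz_const:
  "norm v \<le> K \<Longrightarrow> second_order_lipschitz K (\<lambda>_. v)"
  using order_trans[OF norm_ge_zero[of v]] by (simp add: second_order_lipschitz_def)

lemma second_order_lipschitz_scaleR:
  assumes "second_order_lipschitz K h"
  shows "second_order_lipschitz (\<bar>c\<bar> * K) (\<lambda>y. c *\<^sub>R h y)"
  unfolding second_order_lipschitz_def scaleR_diff_right[symmetric] norm_scaleR mult.assoc
  using assms unfolding second_order_lipschitz_def by (blast intro: mult_left_mono abs_ge_zero)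

lemma second_order_lipschitz_add:
  assumes "second_order_lipschitz K f" "second_order_lipschitz L h"
  shows "second_order_lipschitz (K + L) (\<lambda>y. f y + h y)"
  unfolding second_order_lipschitz_def
proof (intro conjI allI)
  have f: "norm (f y) \<le> K" "norm (f y - f z) \<le> K * norm (y - z)"
      "norm ((f (y + k) - f y) - (f (y' + k') - f y')) \<le> K * (norm (k - k') + norm k' * norm (y - y'))" for y z k y' k'
    using assms(1) unfolding second_order_lipschitz_def by blast+
  have h: "norm (h y) \<le> L" "norm (h y - h z) \<le> L * norm (y - z)"
      "norm ((h (y + k) - h y) - (h (y' + k') - h y')) \<le> L * (norm (k - k') + norm k' * norm (y - y'))" for y z k y' k'
    using assms(2) unfolding second_order_lipschitz_def by blast+
  show "norm (f y + h y) \<le> K + L" for y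
    using f h by (meson norm_triangle_mono)
  show "norm (f y + h y - (f z + h z)) \<le> (K + L) * norm (y - z)" for y z
  proof -
    have "f y + h y - (f z + h z) = (f y - f z) + (h y - h z)" by simp
    also have "norm \<dots> \<le> K * norm (y - z) + L * norm (y - z)"
      by (intro norm_triangle_mono f h)
    finally show ?thesis by (simp add: ring_distribs)
  qed
  show "norm ((f (y + k) + h (y + k) - (f y + h y)) - (f (y' + k') + h (y' + k') - (f y' + h y')))
      \<le> (K + L) * (norm (k - k') + norm k' * norm (y - y'))" for y k y' k'
  proof -
    have "(f (y + k) + h (y + k) - (f y + h y)) - (f (y' + k') + h (y' + k') - (f y' + h y'))
        = ((f (y + k) - f y) - (f (y' + k') - f y')) + ((h (y + k) - h y) - (h (y' + k') - h y'))" by simp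
    also have "norm \<dots> \<le> K * (norm (k - k') + norm k' * norm (y - y')) + L * (norm (k - k') + norm k' * norm (y - y'))"
      by (intro norm_triangle_mono f h)
    finally show ?thesis by (simp add: ring_distribs)
  qed
qed

lemma second_order_lipschitz_sum:
  assumes "finite I" "\<And>i. i \<in> I \<Longrightarrow> second_order_lipschitz (K i) (f i)"
  shows "second_order_lipschitz (\<Sum>i\<in>I. K i) (\<lambda>y. \<Sum>i\<in>I. f i y)"
  using assms
proof (induction I)
  case empty
  then show ?case using second_order_lipschitz_const[of 0 0] by simp
next
  case (insert i I)
  then show ?case using second_order_lipschitz_add[of "K i" "f i" "sum K I"] by simp
qed

text \<open>Leibniz' rule for second differences. The mixed term \<open>|k - k'| |k'|\<close> that would spoil the form
  of the bound is avoided by using that \<open>h\<close> itself is bounded.\<close>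

lemma second_order_lipschitz_apply:
  fixes f :: "'a::real_normed_vector \<Rightarrow> 'b::real_normed_vector \<Rightarrow>\<^sub>L 'c::real_normed_vector"
  assumes "second_order_lipschitz K f" "second_order_lipschitz K h"
  shows "second_order_lipschitz (4 * K\<^sup>2) (\<lambda>y. blinfun_apply (f y) (h y))"
  unfolding second_order_lipschitz_def
proof (intro conjI allI)
  have f: "norm (f y) \<le> K" "norm (f y - f z) \<le> K * norm (y - z)"
      "norm ((f (y + k) - f y) - (f (y' + k') - f y')) \<le> K * (norm (k - k') + norm k' * norm (y - y'))" for y z k y' k'
    using assms(1) unfolding second_order_lipschitz_def by blast+
  have h: "norm (h y) \<le> K" "norm (h y - h z) \<le> K * norm (y - z)"
      "norm ((h (y + k) - h y) - (h (y' + k') - h y')) \<le> K * (norm (k - k') + norm k' * norm (y - y'))" for y z k y' k'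
    using assms(2) unfolding second_order_lipschitz_def by blast+
  have K: "0 \<le> K" using f(1) norm_ge_zero order_trans by blast
  have ap: "norm (blinfun_apply A v) \<le> a * b" if "norm A \<le> a" "norm v \<le> b" for A :: "'b \<Rightarrow>\<^sub>L 'c" and v a b
    using norm_blinfun[of A v] that by (meson mult_mono norm_ge_zero order_trans)
  show "norm (blinfun_apply (f y) (h y)) \<le> 4 * K\<^sup>2" for y
  proof -
    have "norm (blinfun_apply (f y) (h y)) \<le> K * K" by (intro ap f h)
    also have "\<dots> \<le> 4 * K\<^sup>2" by (simp add: power2_eq_square)
    finally show ?thesis .
  qed
  show "norm (blinfun_apply (f y) (h y) - blinfun_apply (f z) (h z)) \<le> 4 * K\<^sup>2 * norm (y - z)" for y z
  proof -
    have "blinfun_apply (f y) (h y) - blinfun_apply (f z) (h z)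
        = blinfun_apply (f y) (h y - h z) + blinfun_apply (f y - f z) (h z)"
      by (simp add: blinfun.diff_left blinfun.diff_right)
    also have "norm \<dots> \<le> K * (K * norm (y - z)) + (K * norm (y - z)) * K"
      by (intro norm_triangle_mono ap f h)
    also have "\<dots> = 2 * K\<^sup>2 * norm (y - z)" by (simp add: power2_eq_square)
    also have "\<dots> \<le> 4 * K\<^sup>2 * norm (y - z)" by (intro mult_right_mono) auto
    finally show ?thesis .
  qed
  show "norm ((blinfun_apply (f (y + k)) (h (y + k)) - blinfun_apply (f y) (h y))
         - (blinfun_apply (f (y' + k')) (h (y' + k')) - blinfun_apply (f y') (h y')))
      \<le> 4 * K\<^sup>2 * (norm (k - k') + norm k' * norm (y - y'))" (is "?L \<le> _") for y k y' k'
  proof -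
    define a where "a = norm (k - k')"
    define b where "b = norm k' * norm (y - y')"
    have ab: "0 \<le> a" "0 \<le> b" by (auto simp: a_def b_def)
    let ?z = "y + k" and ?z' = "y' + k'"
    let ?T1 = "blinfun_apply (f ?z) ((h ?z - h y) - (h ?z' - h y'))"
    let ?T2 = "blinfun_apply (f ?z - f ?z') (h ?z' - h y')"
    let ?T3 = "blinfun_apply ((f ?z - f y) - (f ?z' - f y')) (h y)"
    let ?T4 = "blinfun_apply (f ?z' - f y') (h y - h y')"
    have "norm (?z - ?z') \<le> norm (y - y') + a"
      using norm_triangle_ineq[of "y - y'" "k - k'"] by (simp add: a_def algebra_simps)
    then have "K * norm (?z - ?z') \<le> K * (norm (y - y') + a)" using K by (intro mult_left_mono)
    then have fz: "norm (f ?z - f ?z') \<le> K * norm (y - y') + K * a"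
      using f(2)[of ?z ?z'] by (simp add: ring_distribs)
    have hz1: "norm (h ?z' - h y') \<le> K * norm k'" using h(2)[of ?z' y'] by simp
    have hz2: "norm (h ?z' - h y') \<le> 2 * K"
      using norm_triangle_ineq4[of "h ?z'" "h y'"] h(1)[of ?z'] h(1)[of y'] by simp
    have T1: "norm ?T1 \<le> K * (K * (a + b))" unfolding a_def b_def by (intro ap f h)
    have T2: "norm ?T2 \<le> K * norm (y - y') * (K * norm k') + K * a * (2 * K)"
    proof -
      have "norm ?T2 \<le> (K * norm (y - y') + K * a) * norm (h ?z' - h y')" by (intro ap fz order_refl)
      also have "\<dots> = K * norm (y - y') * norm (h ?z' - h y') + K * a * norm (h ?z' - h y')"
        by (simp add: ring_distribs)
      also have "\<dots> \<le> K * norm (y - y') * (K * norm k') + K * a * (2 * K)"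
        using hz1 hz2 K ab by (intro add_mono mult_left_mono) auto
      finally show ?thesis .
    qed
    have T3: "norm ?T3 \<le> K * (a + b) * K" unfolding a_def b_def by (intro ap f h)
    have T4: "norm ?T4 \<le> (K * norm k') * (K * norm (y - y'))"
      using f(2)[of ?z' y'] by (intro ap h) auto
    have "?L = norm (?T1 + ?T2 + (?T3 + ?T4))"
      unfolding blinfun.diff_left blinfun.diff_right by (rule arg_cong[where f = norm]) simp
    also have "\<dots> \<le> (K * (K * (a + b)) + (K * norm (y - y') * (K * norm k') + K * a * (2 * K)))
        + (K * (a + b) * K + (K * norm k') * (K * norm (y - y')))"
      by (intro norm_triangle_mono T1 T2 T3 T4)
    also have "\<dots> = 4 * K\<^sup>2 * (a + b)" by (simp add: b_def power2_eq_square algebra_simps)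
    finally show ?thesis by (simp add: a_def b_def)
  qed
qed

lemma lipschitz_of_bounded_derivative:
  fixes h1 :: "'a::real_normed_vector \<Rightarrow> 'a \<Rightarrow>\<^sub>L 'b::real_normed_vector"
  assumes "\<And>x. (h has_derivative blinfun_apply (h1 x)) (at x)" "\<And>x. norm (h1 x) \<le> B"
  shows "norm (h x - h y) \<le> B * norm (x - y)"
  using assms by (intro differentiable_bound[OF convex_UNIV, where f' = "\<lambda>x. blinfun_apply (h1 x)"])
    (auto simp flip: norm_blinfun.rep_eq)

text \<open>The difference of the two increments is split into a change of the displacement, handled by the
  Lipschitz bound of \<open>h\<close>, and a change of the base point for a fixed displacement, handled by that
  of \<open>h1\<close>.\<close>

lemma second_order_lipschitz_of_derivative:
  fixes h1 :: "'a::real_normed_vector \<Rightarrow> 'a \<Rightarrow>\<^sub>L 'b::real_normed_vector"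
  assumes d: "\<And>x. (h has_derivative blinfun_apply (h1 x)) (at x)"
    and B: "\<And>x. norm (h x) \<le> B" "\<And>x. norm (h1 x) \<le> B"
    and lip: "\<And>x y. norm (h1 x - h1 y) \<le> B * norm (x - y)"
  shows "second_order_lipschitz B h"
  unfolding second_order_lipschitz_def
proof (intro conjI allI)
  have hl: "norm (h x - h y) \<le> B * norm (x - y)" for x y
    by (rule lipschitz_of_bounded_derivative[OF d B(2)])
  show "norm (h y) \<le> B" for y by (rule B)
  show "norm (h y - h z) \<le> B * norm (y - z)" for y z by (rule hl)
  show "norm ((h (y + k) - h y) - (h (y' + k') - h y')) \<le> B * (norm (k - k') + norm k' * norm (y - y'))" for y k y' k'
  proof -
    have 1: "norm ((h (y + k') - h y) - (h (y' + k') - h y')) \<le> B * norm k' * norm (y - y')"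
    proof (rule lipschitz_of_bounded_derivative[where ?h1.0 = "\<lambda>y. h1 (y + k') - h1 y"])
      fix x
      have "((\<lambda>y. y + k') has_derivative (\<lambda>v. v)) (at x)" by (auto intro!: derivative_eq_intros)
      from has_derivative_diff[OF has_derivative_compose[OF this d] d]
      show "((\<lambda>y. h (y + k') - h y) has_derivative blinfun_apply (h1 (x + k') - h1 x)) (at x)"
        by (simp add: minus_blinfun.rep_eq)
      show "norm (h1 (x + k') - h1 x) \<le> B * norm k'" using lip[of "x + k'" x] by simp
    qed
    have "(h (y + k) - h y) - (h (y' + k') - h y')
        = (h (y + k) - h (y + k')) + ((h (y + k') - h y) - (h (y' + k') - h y'))" by simp
    also have "norm \<dots> \<le> B * norm (k - k') + B * norm k' * norm (y - y')"
      using hl[of "y + k" "y + k'"] 1 by (intro norm_triangle_mono) auto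
    finally show ?thesis by (simp add: algebra_simps)
  qed
qed

text \<open>The base point is moved by differentiating in the parameter \<open>\<theta>\<close> of the segment from \<open>y\<close> to
  \<open>y + v\<close>. Differentiating in \<open>y\<close> would instead require the symmetry of the second derivative.\<close>

lemma taylor_remainder_bounds:
  fixes h1 :: "'a::real_normed_vector \<Rightarrow> 'a \<Rightarrow>\<^sub>L 'b::real_normed_vector"
  assumes d: "\<And>x. (h has_derivative blinfun_apply (h1 x)) (at x)"
    and h1: "second_order_lipschitz B h1"
  defines "G \<equiv> \<lambda>y v. h (y + v) - h y - blinfun_apply (h1 y) v"
  shows "norm (G y v) \<le> B * (norm v)\<^sup>2"
    and "norm (G y v - G y' v') \<le> B * (norm v)\<^sup>2 * norm (y - y') + B * (norm v + norm v') * norm (v - v')"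
proof -
  have lip: "norm (h1 x - h1 y) \<le> B * norm (x - y)" for x y
    using h1 by (simp add: second_order_lipschitz_def)
  have "norm (h1 y) \<le> B" using h1 by (simp add: second_order_lipschitz_def)
  then have B: "0 \<le> B" using norm_ge_zero order_trans by blast
  have dG: "(G y has_derivative blinfun_apply (h1 (y + x) - h1 y)) (at x within A)" for x y A
  proof -
    have "((\<lambda>v. y + v) has_derivative (\<lambda>v. v)) (at x within A)" by (auto intro!: derivative_eq_intros)
    from has_derivative_diff[OF has_derivative_diff[OF has_derivative_compose[OF this d] has_derivative_const]
        bounded_linear_imp_has_derivative[OF blinfun.bounded_linear_right]]
    show ?thesis by (simp add: minus_blinfun.rep_eq G_def)
  qed
  have inc: "norm (G y v - G y v') \<le> B * (norm v + norm v') * norm (v - v')" for y v v'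
  proof (rule differentiable_bound[where S = "cball (0::'a) (norm v + norm v')", OF _ dG])
    show "convex (cball (0::'a) (norm v + norm v'))" by simp
    show "v \<in> cball (0::'a) (norm v + norm v')" "v' \<in> cball (0::'a) (norm v + norm v')" by auto
    fix x assume "x \<in> cball (0::'a) (norm v + norm v')"
    then have "B * norm x \<le> B * (norm v + norm v')" using B by (intro mult_left_mono) auto
    then show "onorm (blinfun_apply (h1 (y + x) - h1 y)) \<le> B * (norm v + norm v')"
      using lip[of "y + x" y] by (simp flip: norm_blinfun.rep_eq)
  qed
  show "norm (G y v) \<le> B * (norm v)\<^sup>2"
    using inc[of y v 0] by (simp add: G_def power2_eq_square)
  have base: "norm (G y v - G y' v) \<le> B * (norm v)\<^sup>2 * norm (y - y')"
  proof -
    define \<phi> where "\<phi> = (\<lambda>\<theta>::real. G y (\<theta> *\<^sub>R v) - G y' (\<theta> *\<^sub>R v))"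
    define \<phi>' where "\<phi>' = (\<lambda>\<theta>. (h1 (y + \<theta> *\<^sub>R v) - h1 y) - (h1 (y' + \<theta> *\<^sub>R v) - h1 y'))"
    have dv: "((\<lambda>\<theta>::real. \<theta> *\<^sub>R v) has_derivative (\<lambda>k. k *\<^sub>R v)) (at x within A)" for x A
      by (rule derivative_eq_intros refl | simp)+
    have d1: "((\<lambda>\<theta>. G y (\<theta> *\<^sub>R v)) has_derivative (\<lambda>k. blinfun_apply (h1 (y + x *\<^sub>R v) - h1 y) (k *\<^sub>R v))) (at x within A)"
      for x :: real and y A
      by (rule has_derivative_compose[OF dv dG])
    have "norm (\<phi> 1 - \<phi> 0) \<le> B * (norm v)\<^sup>2 * norm (y - y') * norm (1 - 0 :: real)"
    proof (rule differentiable_bound[where S = "{0..1}" and f' = "\<lambda>\<theta> k. blinfun_apply (\<phi>' \<theta>) (k *\<^sub>R v)"])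
      show "(\<phi> has_derivative (\<lambda>k. blinfun_apply (\<phi>' x) (k *\<^sub>R v))) (at x within {0..1})" for x
        unfolding \<phi>_def \<phi>'_def
        using has_derivative_diff[OF d1[of y x "{0..1}"] d1[of y' x "{0..1}"]]
        by (simp add: blinfun.diff_left)
      show "onorm (\<lambda>k. blinfun_apply (\<phi>' x) (k *\<^sub>R v)) \<le> B * (norm v)\<^sup>2 * norm (y - y')" if "x \<in> {0..1}" for x
      proof (rule onorm_bound)
        show "0 \<le> B * (norm v)\<^sup>2 * norm (y - y')" using B by simp
        fix k :: real
        have "norm (\<phi>' x) \<le> B * (norm (x *\<^sub>R v) * norm (y - y'))"
          using h1 unfolding second_order_lipschitz_def \<phi>'_def
          by (metis (no_types, lifting) add_0 diff_self norm_zero)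
        also have "\<dots> \<le> B * (norm v * norm (y - y'))"
          using that B by (intro mult_left_mono mult_right_mono) (auto simp: mult_left_le_one_le)
        finally have "norm (\<phi>' x) * norm (k *\<^sub>R v) \<le> B * (norm v * norm (y - y')) * norm (k *\<^sub>R v)"
          by (intro mult_right_mono) auto
        then show "norm (blinfun_apply (\<phi>' x) (k *\<^sub>R v)) \<le> B * (norm v)\<^sup>2 * norm (y - y') * norm k"
          using norm_blinfun[of "\<phi>' x" "k *\<^sub>R v"] by (simp add: power2_eq_square mult_ac)
      qed
    qed auto
    then show ?thesis by (simp add: \<phi>_def G_def)
  qed
  have "G y v - G y' v' = (G y v - G y' v) + (G y' v - G y' v')" by simp
  also have "norm \<dots> \<le> B * (norm v)\<^sup>2 * norm (y - y') + B * (norm v + norm v') * norm (v - v')"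
    by (intro norm_triangle_mono base inc)
  finally show "norm (G y v - G y' v') \<le> B * (norm v)\<^sup>2 * norm (y - y') + B * (norm v + norm v') * norm (v - v')" .
qed


section \<open>Vector fields along a rough path\<close>

lemma norm_blinfun_diff:
  fixes A B :: "'x::real_normed_vector \<Rightarrow>\<^sub>L 'y::real_normed_vector"
  shows "norm (blinfun_apply A v - blinfun_apply B w) \<le> norm (A - B) * norm v + norm B * norm (v - w)"
proof -
  have "blinfun_apply A v - blinfun_apply B w = blinfun_apply (A - B) v + blinfun_apply B (v - w)"
    by (simp add: blinfun.diff_left blinfun.diff_right)
  then show ?thesis using norm_triangle_mono[OF norm_blinfun norm_blinfun] by metis
qed

lemma DFF_add: "DFF F y (A + B) = DFF F y A + DFF F y B"
  by (simp add: DFF_def scaleR_add_left sum.distrib)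

lemma DFF_diff: "DFF F y (A - B) = DFF F y A - DFF F y B"
  by (simp add: DFF_def scaleR_diff_left sum_subtractf)

lemma DFF_zero [simp]: "DFF F y 0 = 0"
  by (simp add: DFF_def)

text \<open>On pure tensors, which is what Chen's relation produces, \<open>DFF\<close> is the expected expression.\<close>

lemma DFF_tensor:
  "DFF F y (tensor v w) = blinfun_apply (frechet_derivative F (at y) (blinfun_apply (F y) v)) w"
  if "(F has_derivative blinfun_apply D) (at y)"
proof -
  have D: "frechet_derivative F (at y) = blinfun_apply D"
    using frechet_derivative_at[OF that] by simp
  have "blinfun_apply (blinfun_apply D (blinfun_apply (F y) v)) w
      = blinfun_apply (blinfun_apply D (blinfun_apply (F y) (\<Sum>i\<in>UNIV. v $ i *\<^sub>R axis i 1))) (\<Sum>j\<in>UNIV. w $ j *\<^sub>R axis j 1)"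
    by (simp add: basis_expansion flip: scalar_mult_eq_scaleR)
  also have "\<dots> = (\<Sum>j\<in>UNIV. \<Sum>i\<in>UNIV. (v $ i * w $ j) *\<^sub>R blinfun_apply (blinfun_apply D (blinfun_apply (F y) (axis i 1))) (axis j 1))"
    by (simp add: blinfun.sum_right blinfun.sum_left blinfun.scaleR_right blinfun.scaleR_left scaleR_sum_right mult.commute)
  also have "\<dots> = DFF F y (tensor v w)"
    unfolding DFF_def tensor_def D by (subst sum.swap) simp
  finally show ?thesis by (simp add: D)
qed

text \<open>\<open>P y v r\<close> stands for \<open>F(y + F(y)v + r) - F(y) - DF(y)(F(y)v)\<close>, the error of the controlled expansion
  of \<open>F\<close> along a path. That its bound is linear in \<open>r\<close>, and not quadratic in the full
  displacement \<open>F(y)v + r\<close>, keeps all later estimates linear in the unknown: no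
  smallness of the solution has to be assumed or bootstrapped. The locale records the inequalities
  that are used, with a single constant.\<close>

locale rough_field =
  fixes F :: "real^'e \<Rightarrow> (real^'d) \<Rightarrow>\<^sub>L (real^'e)"
    and P :: "real^'e \<Rightarrow> real^'d \<Rightarrow> real^'e \<Rightarrow> (real^'d) \<Rightarrow>\<^sub>L (real^'e)"
    and K :: real
  assumes K_ge_1: "1 \<le> K"
    and F_bound: "norm (F y) \<le> K"
    and F_lipschitz: "norm (F y - F z) \<le> K * norm (y - z)"
    and DFF_second_order: "second_order_lipschitz (K * norm A) (\<lambda>y. DFF F y A)"
    and P_expansion: "blinfun_apply (F (y + blinfun_apply (F y) v + r)) w
        = blinfun_apply (F y) w + DFF F y (tensor v w) + blinfun_apply (P y v r) w"
    and P_bound: "norm (P y v r) \<le> K * (norm r + (norm v)\<^sup>2)"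
    and P_lipschitz: "norm (P y v r - P y' v' r') \<le> K * (norm (r - r')
        + norm r' * (norm (y - y') * (1 + norm v) + norm (v - v')) + (norm v)\<^sup>2 * norm (y - y')
        + (norm v + norm v') * (norm (y - y') * norm v + norm (v - v')))"

text \<open>The remainder \<open>P\<close> is an increment of \<open>F\<close> in the direction \<open>r\<close> plus a Taylor remainder at \<open>y\<close> in the
  direction \<open>F(y)v\<close>; the action of \<open>DF F\<close> on matrices is a finite combination of products of
  \<open>DF\<close> and \<open>F\<close>.\<close>

lemma Cb3_imp_rough_field:
  fixes F :: "real^'e \<Rightarrow> (real^'d) \<Rightarrow>\<^sub>L (real^'e)"
  assumes "Cb3 F"
  obtains P K where "rough_field F P K"
proof -
  obtain f1 f2 f3 where
    d: "\<And>x. (F has_derivative blinfun_apply (f1 x)) (at x)"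
       "\<And>x. (f1 has_derivative blinfun_apply (f2 x)) (at x)"
       "\<And>x. (f2 has_derivative blinfun_apply (f3 x)) (at x)"
    and bd: "bounded (range F)" "bounded (range f1)" "bounded (range f2)" "bounded (range f3)"
    using assms unfolding Cb3_def by blast
  obtain B0 B1 B2 B3 where B': "\<And>x. norm (F x) \<le> B0" "\<And>x. norm (f1 x) \<le> B1" "\<And>x. norm (f2 x) \<le> B2" "\<And>x. norm (f3 x) \<le> B3"
    using bd unfolding bounded_iff by (metis rangeI)
  define B where "B = Max {1, B0, B1, B2, B3}"
  have Bge: "1 \<le> B" "B0 \<le> B" "B1 \<le> B" "B2 \<le> B" "B3 \<le> B" by (simp_all add: B_def)
  have B: "norm (F x) \<le> B" "norm (f1 x) \<le> B" "norm (f2 x) \<le> B" "norm (f3 x) \<le> B" for x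
    using B'[of x] Bge by linarith+
  note lip = lipschitz_of_bounded_derivative[OF d(1) B(2)] lipschitz_of_bounded_derivative[OF d(2) B(3)]
    lipschitz_of_bounded_derivative[OF d(3) B(4)]
  have soF: "second_order_lipschitz B F"
    by (rule second_order_lipschitz_of_derivative[OF d(1) B(1,2) lip(2)])
  have so1: "second_order_lipschitz B f1"
    by (rule second_order_lipschitz_of_derivative[OF d(2) B(2,3) lip(3)])
  define q where "q i j y = blinfun_apply (blinfun_apply (f1 y) (blinfun_apply (F y) (axis i 1))) (axis j 1)"
    for i j :: 'd and y
  define b1 where "b1 = 4 * B\<^sup>2"
  define b2 where "b2 = 4 * b1\<^sup>2"
  define b3 where "b3 = 4 * b2\<^sup>2"
  have sq: "x \<le> 4 * x\<^sup>2" if "1 \<le> x" for x :: real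
  proof -
    have "1 * x \<le> x * x" using that by (intro mult_right_mono) auto
    then show ?thesis using that zero_le_power2[of x] by (simp add: power2_eq_square)
  qed
  have b: "B \<le> b1" "1 \<le> b1" "b1 \<le> b2" "1 \<le> b2" "b2 \<le> b3" "1 \<le> b3"
    using sq[of B] sq[of b1] sq[of b2] Bge by (auto simp: b1_def b2_def b3_def)
  have soq: "second_order_lipschitz b3 (q i j)" for i j
  proof -
    have "second_order_lipschitz b1 (\<lambda>y. blinfun_apply (F y) (axis i 1))"
      unfolding b1_def using Bge by (intro second_order_lipschitz_apply soF second_order_lipschitz_const) (simp add: norm_axis_1)
    then have "second_order_lipschitz b2 (\<lambda>y. blinfun_apply (f1 y) (blinfun_apply (F y) (axis i 1)))"
      unfolding b2_def by (intro second_order_lipschitz_apply second_order_lipschitz_weaken[OF so1 b(1)])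
    then show ?thesis
      unfolding b3_def q_def using b by (intro second_order_lipschitz_apply second_order_lipschitz_const) (simp_all add: norm_axis_1)
  qed
  define h where "h = real CARD('d) * real CARD('d) * b3"
  define K where "K = B ^ 3 + h"
  have h0: "0 \<le> h" using b by (simp add: h_def)
  have BB: "B \<le> B^2" "B^2 \<le> B^3" "1 \<le> B^3"
    using Bge by (auto intro: power_increasing[of 1 2 B, simplified] power_increasing one_le_power)
  have DFFq: "DFF F y A = (\<Sum>i\<in>UNIV. \<Sum>j\<in>UNIV. A $ i $ j *\<^sub>R q i j y)" for y A
    unfolding DFF_def q_def using frechet_derivative_at[OF d(1)[of y]] by simp
  have soH: "second_order_lipschitz (K * norm A) (\<lambda>y. DFF F y A)" for A :: "real^'d^'d"
  proof -
    have A: "\<bar>A $ i $ j\<bar> \<le> norm A" for i j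
      using component_le_norm_cart[of "A $ i" j] Finite_Cartesian_Product.norm_nth_le[of A i] by (rule order_trans)
    have "second_order_lipschitz (\<Sum>i\<in>(UNIV::'d set). \<Sum>j\<in>(UNIV::'d set). \<bar>A $ i $ j\<bar> * b3) (\<lambda>y. DFF F y A)"
      unfolding DFFq by (intro second_order_lipschitz_sum second_order_lipschitz_scaleR soq) auto
    moreover have "(\<Sum>i\<in>(UNIV::'d set). \<Sum>j\<in>(UNIV::'d set). \<bar>A $ i $ j\<bar> * b3)
        \<le> (\<Sum>i\<in>(UNIV::'d set). \<Sum>j\<in>(UNIV::'d set). norm A * b3)"
      using A b by (intro sum_mono mult_right_mono) auto
    moreover have "\<dots> = h * norm A" by (simp add: h_def)
    moreover have "h * norm A \<le> K * norm A" using BB Bge by (intro mult_right_mono) (auto simp: K_def)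
    ultimately show ?thesis using second_order_lipschitz_weaken by (metis (no_types, lifting) order_trans)
  qed
  define P where "P y v r = F (y + blinfun_apply (F y) v + r) - F y - blinfun_apply (f1 y) (blinfun_apply (F y) v)"
    for y v r
  define G where "G y v = F (y + v) - F y - blinfun_apply (f1 y) v" for y v
  note G = taylor_remainder_bounds[OF d(1) so1, folded G_def]
  have PG: "P y v r = (F (y + blinfun_apply (F y) v + r) - F (y + blinfun_apply (F y) v)) + G y (blinfun_apply (F y) v)"
    for y v r by (simp add: P_def G_def)
  have Fv: "norm (blinfun_apply (F y) v) \<le> B * norm v" for y v
    using norm_blinfun[of "F y" v] B(1)[of y] by (meson mult_right_mono norm_ge_zero order_trans)
  have Fv': "norm (blinfun_apply (F y) v - blinfun_apply (F y') v') \<le> B * (norm (y - y') * norm v + norm (v - v'))" for y y' v v'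
  proof -
    have "blinfun_apply (F y) v - blinfun_apply (F y') v' = blinfun_apply (F y - F y') v + blinfun_apply (F y') (v - v')"
      by (simp add: blinfun.diff_left blinfun.diff_right)
    also have "norm \<dots> \<le> (B * norm (y - y')) * norm v + B * norm (v - v')"
      by (intro norm_triangle_mono Fv order_trans[OF norm_blinfun] mult_right_mono lip norm_ge_zero)
    finally show ?thesis by (simp add: algebra_simps)
  qed
  have BK: "B ^ 3 \<le> K" "B \<le> K" "B^2 \<le> K" using BB h0 by (auto simp: K_def)
  have "rough_field F P K"
  proof
    show "1 \<le> K" using BB h0 by (simp add: K_def)
    show "norm (F y) \<le> K" for y using B(1)[of y] BK by simp
    show "norm (F y - F z) \<le> K * norm (y - z)" for y z
      using lip(1)[of y z] mult_right_mono[OF BK(2), of "norm (y - z)"] by simp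
    show "second_order_lipschitz (K * norm A) (\<lambda>y. DFF F y A)" for A by (rule soH)
    show "blinfun_apply (F (y + blinfun_apply (F y) v + r)) w
        = blinfun_apply (F y) w + DFF F y (tensor v w) + blinfun_apply (P y v r) w" for y v r w
      using frechet_derivative_at[OF d(1)[of y]] by (simp add: DFF_tensor[OF d(1)] P_def blinfun.diff_left)
    show "norm (P y v r) \<le> K * (norm r + (norm v)\<^sup>2)" for y v r
    proof -
      have "norm (P y v r) \<le> B * norm r + B * (B * norm v)\<^sup>2"
        unfolding PG using lip(1)[of "y + blinfun_apply (F y) v + r" "y + blinfun_apply (F y) v"] Bge
        by (intro norm_triangle_mono order_trans[OF G(1)] mult_left_mono power_mono Fv) auto
      also have "\<dots> = B * norm r + B^3 * (norm v)\<^sup>2" by (simp add: power_mult_distrib power2_eq_square power3_eq_cube)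
      also have "\<dots> \<le> K * norm r + K * (norm v)\<^sup>2" using BK by (intro add_mono mult_right_mono) auto
      finally show ?thesis by (simp add: algebra_simps)
    qed
    show "norm (P y v r - P y' v' r') \<le> K * (norm (r - r')
        + norm r' * (norm (y - y') * (1 + norm v) + norm (v - v')) + (norm v)\<^sup>2 * norm (y - y')
        + (norm v + norm v') * (norm (y - y') * norm v + norm (v - v')))" for y v r y' v' r'
    proof -
      define m where "m = y + blinfun_apply (F y) v"
      define m' where "m' = y' + blinfun_apply (F y') v'"
      define e where "e = norm (y - y') * norm v + norm (v - v')"
      have e: "norm (blinfun_apply (F y) v - blinfun_apply (F y') v') \<le> B * e" "0 \<le> e"
        using Fv'[of y v y' v'] by (auto simp: e_def)
      have mm: "norm (m - m') \<le> B * (norm (y - y') + e)"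
      proof -
        have "m - m' = (y - y') + (blinfun_apply (F y) v - blinfun_apply (F y') v')" by (simp add: m_def m'_def)
        also have "norm \<dots> \<le> norm (y - y') + B * e" by (intro norm_triangle_mono e order_refl)
        also have "norm (y - y') \<le> B * norm (y - y')" using Bge by (simp add: mult_le_cancel_right1)
        finally show ?thesis by (simp add: algebra_simps)
      qed
      have "norm ((F (m + r) - F m) - (F (m' + r') - F m')) \<le> B * (norm (r - r') + norm r' * norm (m - m'))"
        using soF by (simp add: second_order_lipschitz_def)
      also have "\<dots> \<le> B * (norm (r - r') + norm r' * (B * (norm (y - y') + e)))"
        using mm Bge by (intro mult_left_mono add_left_mono) auto
      also have "\<dots> = B * norm (r - r') + B^2 * (norm r' * (norm (y - y') + e))"
        by (simp add: algebra_simps power2_eq_square)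
      also have "\<dots> \<le> K * norm (r - r') + K * (norm r' * (norm (y - y') + e))"
        using BK e by (intro add_mono mult_right_mono) auto
      finally have 1: "norm ((F (m + r) - F m) - (F (m' + r') - F m')) \<le> K * norm (r - r') + K * (norm r' * (norm (y - y') + e))" .
      let ?u = "blinfun_apply (F y) v" and ?u' = "blinfun_apply (F y') v'"
      have "norm (G y ?u - G y' ?u') \<le> B * (norm ?u)\<^sup>2 * norm (y - y') + B * (norm ?u + norm ?u') * norm (?u - ?u')"
        by (rule G(2))
      also have "\<dots> \<le> B * (B * norm v)\<^sup>2 * norm (y - y') + B * (B * norm v + B * norm v') * (B * e)"
        using Bge e by (intro add_mono mult_mono power_mono Fv mult_nonneg_nonneg order_refl add_nonneg_nonneg) auto
      also have "\<dots> = B^3 * ((norm v)\<^sup>2 * norm (y - y') + (norm v + norm v') * e)"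
        by (simp add: algebra_simps power2_eq_square power3_eq_cube)
      also have "\<dots> \<le> K * ((norm v)\<^sup>2 * norm (y - y') + (norm v + norm v') * e)"
        using BK e by (intro mult_right_mono) auto
      finally have 2: "norm (G y ?u - G y' ?u') \<le> K * ((norm v)\<^sup>2 * norm (y - y') + (norm v + norm v') * e)" .
      have "P y v r - P y' v' r' = ((F (m + r) - F m) - (F (m' + r') - F m')) + (G y ?u - G y' ?u')"
        by (simp add: PG m_def m'_def)
      also have "norm \<dots> \<le> (K * norm (r - r') + K * (norm r' * (norm (y - y') + e)))
          + K * ((norm v)\<^sup>2 * norm (y - y') + (norm v + norm v') * e)"
        by (intro norm_triangle_mono 1 2)
      finally show ?thesis by (simp add: e_def algebra_simps)
    qed
  qed
  then show thesis using that by blast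
qed

section \<open>Estimates over short intervals\<close>

text \<open>The set of times is arbitrary, so that intervals and the finite sets of times of Euler schemes
  are treated alike.\<close>

definition rough_on :: "real set \<Rightarrow> real \<Rightarrow> (real \<Rightarrow> real) \<Rightarrow> (real \<Rightarrow> real^'d) \<Rightarrow> (real \<Rightarrow> real \<Rightarrow> real^'d^'d) \<Rightarrow> bool" where
  "rough_on J p g X XX \<longleftrightarrow> mono_on J g \<and>
     (\<forall>s\<in>J. \<forall>u\<in>J. \<forall>t\<in>J. s \<le> u \<longrightarrow> u \<le> t \<longrightarrow> XX s t = XX s u + XX u t + tensor (incr X s u) (incr X u t)) \<and>
     (\<forall>s\<in>J. \<forall>t\<in>J. s \<le> t \<longrightarrow> norm (incr X s t) \<le> modulus p g s t \<and> norm (XX s t) \<le> (modulus p g s t)\<^sup>2)"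

lemma rough_on_subset: "rough_on J p g X XX \<Longrightarrow> I \<subseteq> J \<Longrightarrow> rough_on I p g X XX"
  unfolding rough_on_def by (blast intro: mono_on_subset)

lemma rough_onD:
  assumes "rough_on J p g X XX" "s \<in> J" "t \<in> J" "s \<le> t"
  shows rough_on_le: "g s \<le> g t" and rough_on_first: "norm (incr X s t) \<le> modulus p g s t"
    and rough_on_second: "norm (XX s t) \<le> (modulus p g s t)\<^sup>2"
  using assms unfolding rough_on_def mono_on_def by blast+

lemma rough_on_chen:
  assumes "rough_on J p g X XX" "s \<in> J" "u \<in> J" "t \<in> J" "s \<le> u" "u \<le> t"
  shows "XX s t = XX s u + XX u t + tensor (incr X s u) (incr X u t)"
  using assms unfolding rough_on_def by blast

lemma incr_self [simp]: "incr X s s = 0"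
  by (simp add: incr_def)

lemma incr_split: "incr X s t = incr X s u + incr X u t"
  by (simp add: incr_def)

lemma rough_on_diag: "rough_on J p g X XX \<Longrightarrow> s \<in> J \<Longrightarrow> XX s s = 0"
proof -
  assume "rough_on J p g X XX" "s \<in> J"
  then have "XX s s = XX s s + XX s s + tensor (incr X s s) (incr X s s)"
    unfolding rough_on_def by blast
  then show ?thesis by (simp add: tensor_def vec_eq_iff)
qed

text \<open>Iterating \<open>D \<mapsto> A + D/2\<close> from any start leads to \<open>2A\<close>: a bound by an uncontrolled finite \<open>D0\<close> is thus
  replaced by one that depends on \<open>A\<close> alone.\<close>

lemma halving_iteration:
  fixes A D0 :: real
  assumes "\<And>D. 0 \<le> D \<Longrightarrow> Q D \<Longrightarrow> Q (A + D / 2)" "Q D0" "0 \<le> D0" "0 \<le> A"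
  obtains D where "D \<longlonglongrightarrow> 2 * A" "\<And>n. Q (D n)"
proof -
  define D where "D n = 2 * A + (D0 - 2 * A) * (1/2) ^ n" for n :: nat
  have "Q (D n) \<and> 0 \<le> D n" for n
  proof (induction n)
    case (Suc n)
    have "D (Suc n) = A + D n / 2" by (simp add: D_def field_simps)
    with Suc assms show ?case by simp
  qed (use assms in \<open>simp add: D_def\<close>)
  moreover have "D \<longlonglongrightarrow> 2 * A + (D0 - 2 * A) * 0"
    unfolding D_def by (intro tendsto_intros LIMSEQ_realpow_zero) auto
  ultimately show thesis using that[of D] by simp
qed

lemma (in rough_field) DFF_bound: "norm (DFF F y A) \<le> K * norm A"
  using DFF_second_order by (simp add: second_order_lipschitz_def)

lemma (in rough_field) DFF_lipschitz: "norm (DFF F y A - DFF F z A) \<le> K * norm A * norm (y - z)"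
  using DFF_second_order by (simp add: second_order_lipschitz_def)

lemma (in rough_field) F_apply_bound: "norm (blinfun_apply (F y) v) \<le> K * norm v"
  using norm_blinfun[of "F y" v] F_bound[of y] by (meson mult_right_mono norm_ge_zero order_trans)

context rough_field
begin

text \<open>One step of the second-order Euler scheme.\<close>

definition Xi :: "(real \<Rightarrow> real^'d) \<Rightarrow> (real \<Rightarrow> real \<Rightarrow> real^'d^'d) \<Rightarrow> (real \<Rightarrow> real^'e) \<Rightarrow> real \<Rightarrow> real \<Rightarrow> real^'e" where
  "Xi X XX Y s t = blinfun_apply (F (Y s)) (incr X s t) + DFF F (Y s) (XX s t)"

definition Rem :: "(real \<Rightarrow> real^'d) \<Rightarrow> (real \<Rightarrow> real^'e) \<Rightarrow> real \<Rightarrow> real \<Rightarrow> real^'e" where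
  "Rem X Y s t = incr Y s t - blinfun_apply (F (Y s)) (incr X s t)"

lemma Rem_self [simp]: "Rem X Y s s = 0"
  by (simp add: Rem_def blinfun.zero_right)

lemma incr_eq_Rem: "incr Y s t = blinfun_apply (F (Y s)) (incr X s t) + Rem X Y s t"
  by (simp add: Rem_def)

text \<open>Chen's relation cancels the first-order part of \<open>F(Y\<^sub>u) - F(Y\<^sub>s)\<close>; what is left are the expansion
  error \<open>P\<close> against \<open>X\<^sub>u\<^sub>,\<^sub>t\<close> and an increment of \<open>DF F\<close> against the second level, both of third order.\<close>

lemma Xi_defect:
  assumes "XX s t = XX s u + XX u t + tensor (incr X s u) (incr X u t)"
  shows "Xi X XX Y s t - Xi X XX Y s u - Xi X XX Y u t =
    - (blinfun_apply (P (Y s) (incr X s u) (Rem X Y s u)) (incr X u t)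
       + (DFF F (Y u) (XX u t) - DFF F (Y s) (XX u t)))"
proof -
  have "Y u = Y s + blinfun_apply (F (Y s)) (incr X s u) + Rem X Y s u"
    by (simp add: Rem_def incr_def[of Y])
  then have "blinfun_apply (F (Y u)) (incr X u t) = blinfun_apply (F (Y s)) (incr X u t)
      + DFF F (Y s) (tensor (incr X s u) (incr X u t))
      + blinfun_apply (P (Y s) (incr X s u) (Rem X Y s u)) (incr X u t)"
    using P_expansion[of "Y s" "incr X s u" "Rem X Y s u" "incr X u t"] by simp
  then show ?thesis
    unfolding Xi_def assms incr_split[of X s t u] by (simp add: DFF_add blinfun.add_right)
qed

lemma Xi_defect_bound:
  assumes "XX s t = XX s u + XX u t + tensor (incr X s u) (incr X u t)"
  shows "norm (Xi X XX Y s t - Xi X XX Y s u - Xi X XX Y u t) \<le>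
    K * (norm (Rem X Y s u) + (norm (incr X s u))\<^sup>2) * norm (incr X u t) + K * norm (XX u t) * norm (incr Y s u)"
  unfolding Xi_defect[OF assms] norm_minus_cancel
  using DFF_lipschitz[of "Y u" "XX u t" "Y s"]
  by (intro norm_triangle_mono order_trans[OF norm_blinfun] mult_right_mono P_bound) (auto simp: incr_def)

text \<open>The unknown \<open>D\<close> enters the sewing bound of order three linearly, so one of the three factors
  \<open>\<omega> \<le> \<epsilon>\<close> can be spent to make its coefficient at most one half.\<close>

lemma remainder_step:
  assumes p: "0 < p" "p < 3" and rough: "rough_on J p g X XX"
    and small: "\<And>s t. s \<in> J \<Longrightarrow> t \<in> J \<Longrightarrow> s \<le> t \<Longrightarrow> modulus p g s t \<le> \<epsilon>"
    and eps: "\<epsilon> \<le> 1" "4 * sew_const p * K\<^sup>2 * \<epsilon> \<le> 1"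
    and lim: "\<And>s t. s \<in> J \<Longrightarrow> t \<in> J \<Longrightarrow> s < t \<Longrightarrow> has_chain_limit J (Xi X XX Y) (incr Y s t) s t"
    and D: "0 \<le> D" "\<And>s t. s \<in> J \<Longrightarrow> t \<in> J \<Longrightarrow> s \<le> t \<Longrightarrow> norm (Rem X Y s t) \<le> D * (modulus p g s t)\<^sup>2"
    and st: "s \<in> J" "t \<in> J" "s \<le> t"
  shows "norm (incr Y s t) \<le> (K + D) * modulus p g s t"
    and "norm (incr Y s t - Xi X XX Y s t) \<le> 2 * sew_const p * K\<^sup>2 * (1 + D) * modulus p g s t ^ 3"
    and "norm (Rem X Y s t) \<le> (2 * K + D / 2) * (modulus p g s t)\<^sup>2"
proof -
  let ?m = "modulus p g"
  define c where "c = sew_const p"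
  have c: "1 \<le> c" using sew_const_props(1)[OF p] by (simp add: c_def)
  have X: "norm (incr X a b) \<le> ?m a b" "norm (XX a b) \<le> (?m a b)\<^sup>2" if "a \<in> J" "b \<in> J" "a \<le> b" for a b
    using rough_onD[OF rough that] by simp_all
  have mono: "mono_on J g" using rough by (simp add: rough_on_def)
  have mm: "?m a b \<le> ?m a' b'" if "a' \<in> J" "a \<in> J" "b \<in> J" "b' \<in> J" "a' \<le> a" "a \<le> b" "b \<le> b'" for a b a' b'
    using that mono p by (intro modulus_mono) (auto simp: mono_on_def)
  have Y: "norm (incr Y a b) \<le> (K + D) * ?m a b" if ab: "a \<in> J" "b \<in> J" "a \<le> b" for a b
  proof -
    have "norm (incr Y a b) \<le> K * ?m a b + D * (?m a b)\<^sup>2"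
      unfolding incr_eq_Rem[of Y a b X] using K_ge_1 X[OF ab]
      by (intro norm_triangle_mono D ab order_trans[OF F_apply_bound] mult_left_mono) auto
    also have "(?m a b)\<^sup>2 \<le> ?m a b"
      using small[OF ab] eps by (simp add: power2_eq_square mult_left_le_one_le)
    finally show ?thesis using D(1) by (simp add: ring_distribs mult_left_mono)
  qed
  show "norm (incr Y s t) \<le> (K + D) * ?m s t" by (rule Y[OF st])
  have defect: "norm (Xi X XX Y a b - Xi X XX Y a u - Xi X XX Y u b) \<le> 2 * K\<^sup>2 * (1 + D) * ?m a b ^ 3"
    if J: "a \<in> J" "u \<in> J" "b \<in> J" and le: "a \<le> u" "u \<le> b" for a u b
  proof -
    let ?\<mu> = "?m a b"
    have m: "?m a u \<le> ?\<mu>" "?m u b \<le> ?\<mu>" using mm J le by auto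
    have "XX a b = XX a u + XX u b + tensor (incr X a u) (incr X u b)"
      by (rule rough_on_chen[OF rough J le])
    then have "norm (Xi X XX Y a b - Xi X XX Y a u - Xi X XX Y u b) \<le>
       K * (norm (Rem X Y a u) + (norm (incr X a u))\<^sup>2) * norm (incr X u b) + K * norm (XX u b) * norm (incr Y a u)"
      by (rule Xi_defect_bound)
    also have "\<dots> \<le> K * (D * ?\<mu>\<^sup>2 + ?\<mu>\<^sup>2) * ?\<mu> + K * ?\<mu>\<^sup>2 * ((K + D) * ?\<mu>)"
    proof -
      have r: "norm (Rem X Y a u) \<le> D * ?\<mu>\<^sup>2"
        using D(2)[of a u] J le by (rule_tac order_trans[OF _ mult_left_mono[OF power_mono[OF m(1)]]]) (auto simp: D(1))
      have x: "norm (incr X a u) \<le> ?\<mu>" "norm (incr X u b) \<le> ?\<mu>" using X[of a u] X[of u b] J le m by auto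
      have xx: "norm (XX u b) \<le> ?\<mu>\<^sup>2" using X(2)[of u b] J le power_mono[OF m(2) modulus_nonneg, of 2] by linarith
      have y: "norm (incr Y a u) \<le> (K + D) * ?\<mu>"
        using Y[of a u] J le K_ge_1 D(1) by (rule_tac order_trans[OF _ mult_left_mono[OF m(1)]]) auto
      show ?thesis using K_ge_1 D(1) r x xx y
        by (intro add_mono mult_mono power_mono mult_nonneg_nonneg add_nonneg_nonneg order_refl) auto
    qed
    also have "\<dots> = (K * (1 + D) + K * (K + D)) * ?\<mu> ^ 3"
      by (simp add: power2_eq_square power3_eq_cube algebra_simps)
    also have "\<dots> \<le> 2 * K\<^sup>2 * (1 + D) * ?\<mu> ^ 3"
    proof (rule mult_right_mono)
      have "K \<le> K * K" using K_ge_1 by (simp add: mult_le_cancel_left1)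
      then have "K * (1 + D) \<le> K * K * (1 + D)" "K * D \<le> K * K * D"
        using D(1) by (intro mult_right_mono; simp)+
      then show "K * (1 + D) + K * (K + D) \<le> 2 * K\<^sup>2 * (1 + D)"
        by (simp add: power2_eq_square algebra_simps)
    qed simp
    finally show ?thesis .
  qed
  have S: "norm (incr Y s t - Xi X XX Y s t) \<le> sew_const p * (2 * K\<^sup>2 * (1 + D)) * ?m s t ^ 3"
  proof (cases "s = t")
    case True
    then show ?thesis using rough_on_diag[OF rough st(1)] by (simp add: Xi_def blinfun.zero_right modulus_def)
  next
    case False
    show ?thesis
    proof (rule sewing[OF p _ mono _ defect])
      show "has_chain_limit J (Xi X XX Y) (incr Y s t) s t" using lim st False by simp
      show "Xi X XX Y a a = 0" if "a \<in> J" for a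
        using rough_on_diag[OF rough that] by (simp add: Xi_def blinfun.zero_right)
    qed (use D in auto)
  qed
  then show "norm (incr Y s t - Xi X XX Y s t) \<le> 2 * sew_const p * K\<^sup>2 * (1 + D) * ?m s t ^ 3"
    by (simp add: mult_ac)
  have "Rem X Y s t = (incr Y s t - Xi X XX Y s t) + DFF F (Y s) (XX s t)"
    by (simp add: Rem_def Xi_def)
  also have "norm \<dots> \<le> c * (2 * K\<^sup>2 * (1 + D)) * ?m s t ^ 3 + K * (?m s t)\<^sup>2"
    using X[OF st] K_ge_1 S
    by (intro norm_triangle_mono order_trans[OF DFF_bound] mult_left_mono) (auto simp: c_def)
  also have "?m s t ^ 3 \<le> \<epsilon> * (?m s t)\<^sup>2"
    using small[OF st] by (simp add: power3_eq_cube power2_eq_square mult.assoc mult_right_mono)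
  then have "c * (2 * K\<^sup>2 * (1 + D)) * ?m s t ^ 3 \<le> c * (2 * K\<^sup>2 * (1 + D)) * (\<epsilon> * (?m s t)\<^sup>2)"
    using c D by (intro mult_left_mono) auto
  also have "c * (2 * K\<^sup>2 * (1 + D)) * (\<epsilon> * (?m s t)\<^sup>2) = (4 * c * K\<^sup>2 * \<epsilon>) * ((1 + D) / 2) * (?m s t)\<^sup>2"
    by (simp add: algebra_simps)
  also have "\<dots> \<le> 1 * ((1 + D) / 2) * (?m s t)\<^sup>2"
    using eps D by (intro mult_right_mono) (auto simp: c_def)
  finally have "norm (Rem X Y s t) \<le> (K + 1 / 2 + D / 2) * (?m s t)\<^sup>2" by (simp add: algebra_simps add_divide_distrib)
  also have "\<dots> \<le> (2 * K + D / 2) * (?m s t)\<^sup>2" using K_ge_1 by (intro mult_right_mono) auto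
  finally show "norm (Rem X Y s t) \<le> (2 * K + D / 2) * (?m s t)\<^sup>2" .
qed

lemma remainder_apriori_of_bound:
  assumes p: "0 < p" "p < 3" and rough: "rough_on J p g X XX"
    and small: "\<And>s t. s \<in> J \<Longrightarrow> t \<in> J \<Longrightarrow> s \<le> t \<Longrightarrow> modulus p g s t \<le> \<epsilon>"
    and eps: "\<epsilon> \<le> 1" "4 * sew_const p * K\<^sup>2 * \<epsilon> \<le> 1"
    and lim: "\<And>s t. s \<in> J \<Longrightarrow> t \<in> J \<Longrightarrow> s < t \<Longrightarrow> has_chain_limit J (Xi X XX Y) (incr Y s t) s t"
    and D: "0 \<le> D" "\<And>s t. s \<in> J \<Longrightarrow> t \<in> J \<Longrightarrow> s \<le> t \<Longrightarrow> norm (Rem X Y s t) \<le> D * (modulus p g s t)\<^sup>2"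
    and st: "s \<in> J" "t \<in> J" "s \<le> t"
  shows "norm (Rem X Y s t) \<le> 4 * K * (modulus p g s t)\<^sup>2"
proof -
  define Q where "Q D \<longleftrightarrow> (\<forall>s\<in>J. \<forall>t\<in>J. s \<le> t \<longrightarrow> norm (Rem X Y s t) \<le> D * (modulus p g s t)\<^sup>2)" for D
  obtain E where E: "E \<longlonglongrightarrow> 2 * (2 * K)" "\<And>n. Q (E n)"
  proof (rule halving_iteration[of Q "2 * K" D])
    show "Q (2 * K + D' / 2)" if D': "0 \<le> D'" "Q D'" for D'
    proof -
      have "norm (Rem X Y s t) \<le> D' * (modulus p g s t)\<^sup>2" if "s \<in> J" "t \<in> J" "s \<le> t" for s t
        using D'(2) that by (simp add: Q_def)
      from remainder_step(3)[OF p rough small eps lim D'(1) this] show ?thesis by (simp add: Q_def)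
    qed
  qed (use D K_ge_1 in \<open>auto simp: Q_def\<close>)
  have "norm (Rem X Y s t) \<le> E n * (modulus p g s t)\<^sup>2" for n using E(2)[of n] st by (simp add: Q_def)
  moreover have "(\<lambda>n. E n * (modulus p g s t)\<^sup>2) \<longlonglongrightarrow> 2 * (2 * K) * (modulus p g s t)\<^sup>2"
    by (intro tendsto_intros E)
  ultimately show ?thesis using LIMSEQ_le_const by fastforce
qed

text \<open>Finite variation of the remainder, in the form of a second control \<open>h\<close> of unknown size,
  suffices to start the iteration: with respect to \<open>g + \<delta> h\<close> the remainder is bounded by
  \<open>\<delta>\<^sup>-\<^sup>2\<^sup>/\<^sup>p\<close> times the second power of the modulus, and for small \<open>\<delta>\<close> this control is still small enough. The resulting constant \<open>4K\<close> does
  not depend on \<open>\<delta>\<close>, which then tends to zero. Half of the smallness is reserved for \<open>\<delta> h\<close>.\<close>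

lemma local_apriori:
  assumes p: "0 < p" "p < 3" and rough: "rough_on J p g X XX"
    and eps: "0 < \<epsilon>" "\<epsilon> \<le> 1" "4 * sew_const p * K\<^sup>2 * \<epsilon> \<le> 1"
    and small: "\<And>s t. s \<in> J \<Longrightarrow> t \<in> J \<Longrightarrow> s \<le> t \<Longrightarrow> g t - g s \<le> \<epsilon> powr p / 2"
    and lim: "\<And>s t. s \<in> J \<Longrightarrow> t \<in> J \<Longrightarrow> s < t \<Longrightarrow> has_chain_limit J (Xi X XX Y) (incr Y s t) s t"
    and h: "\<And>s t. s \<in> J \<Longrightarrow> t \<in> J \<Longrightarrow> s < t \<Longrightarrow> norm (Rem X Y s t) powr (p / 2) \<le> h t - h s"
    and bound: "\<And>s t. s \<in> J \<Longrightarrow> t \<in> J \<Longrightarrow> s \<le> t \<Longrightarrow> h t - h s \<le> H" and H: "0 < H"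
    and st: "s \<in> J" "t \<in> J" "s \<le> t"
  shows "norm (Rem X Y s t) \<le> 4 * K * (modulus p g s t)\<^sup>2"
    and "norm (incr Y s t) \<le> 5 * K * modulus p g s t"
    and "norm (incr Y s t - Xi X XX Y s t) \<le> 10 * sew_const p * K ^ 3 * modulus p g s t ^ 3"
proof -
  define c where "c = sew_const p"
  have c: "1 \<le> c" using sew_const_props(1)[OF p] by (simp add: c_def)
  define \<kappa> where "\<kappa> = \<epsilon> powr p / 2"
  have \<kappa>: "0 < \<kappa>" using eps by (simp add: \<kappa>_def)
  have h_mono: "0 \<le> h b - h a" if "a \<in> J" "b \<in> J" "a \<le> b" for a b
    using order_trans[OF powr_ge_zero h[OF that(1,2)]] that(3) by (cases "a = b") auto
  have small_mod: "modulus p g a b \<le> \<epsilon>" if "a \<in> J" "b \<in> J" "a \<le> b" for a b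
    by (rule modulus_le_of_half[OF p(1) eps(1)]) (use rough_on_le[OF rough that] small[OF that] in auto)
  obtain \<delta> where \<delta>: "\<And>n. 0 < \<delta> n" "\<And>n s t. s \<in> J \<Longrightarrow> t \<in> J \<Longrightarrow> s \<le> t \<Longrightarrow> \<delta> n * (h t - h s) \<le> \<kappa>" "\<delta> \<longlonglongrightarrow> 0"
  proof
    define \<delta> where "\<delta> n = \<kappa> / H * (1 / real (Suc n))" for n
    show "0 < \<delta> n" for n using \<kappa> H by (simp add: \<delta>_def)
    show "\<delta> \<longlonglongrightarrow> 0" unfolding \<delta>_def using LIMSEQ_inverse_real_of_nat
      by (intro tendsto_mult_right_zero) (simp add: inverse_eq_divide)
    show "\<delta> n * (h t - h s) \<le> \<kappa>" if "s \<in> J" "t \<in> J" "s \<le> t" for n s t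
    proof -
      have "\<delta> n * (h t - h s) \<le> \<kappa> / H * 1 * H"
        unfolding \<delta>_def using H \<kappa> bound[OF that] h_mono[OF that] by (intro mult_mono mult_left_mono) auto
      then show ?thesis using H by simp
    qed
  qed
  have *: "norm (Rem X Y s t) \<le> 4 * K * (modulus p g s t)\<^sup>2"
    if st: "s \<in> J" "t \<in> J" "s \<le> t" for s t
  proof -
  have "norm (Rem X Y s t) \<le> 4 * K * ((g t - g s) + \<delta> n * (h t - h s)) powr (2 / p)" for n
  proof -
    define g' where "g' t = g t + \<delta> n * h t" for t
    have g'_diff: "g' b - g' a = (g b - g a) + \<delta> n * (h b - h a)" for a b by (simp add: g'_def algebra_simps)
    have nn: "0 \<le> \<delta> n * (h b - h a)" if "a \<in> J" "b \<in> J" "a \<le> b" for a b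
      using h_mono[OF that] \<delta>(1)[of n] by simp
    have le_mod: "modulus p g a b \<le> modulus p g' a b" if "a \<in> J" "b \<in> J" "a \<le> b" for a b
      unfolding modulus_def g'_diff using nn[OF that] rough_on_le[OF rough that] p by (intro powr_mono2) auto
    have rough': "rough_on J p g' X XX"
      unfolding rough_on_def
    proof (intro conjI ballI impI)
      show "mono_on J g'"
      proof (rule mono_onI)
        fix a b assume ab: "a \<in> J" "b \<in> J" "a \<le> b"
        from nn[OF ab] rough_on_le[OF rough ab] g'_diff[of b a] show "g' a \<le> g' b" by simp
      qed
      show "XX a b = XX a u + XX u b + tensor (incr X a u) (incr X u b)"
        if "a \<in> J" "u \<in> J" "b \<in> J" "a \<le> u" "u \<le> b" for a u b
        by (rule rough_on_chen[OF rough that])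
      show "norm (incr X a b) \<le> modulus p g' a b" "norm (XX a b) \<le> (modulus p g' a b)\<^sup>2"
        if "a \<in> J" "b \<in> J" "a \<le> b" for a b
        using rough_onD[OF rough that] le_mod[OF that] power_mono[OF le_mod[OF that] modulus_nonneg, of 2] by linarith+
    qed
    have "norm (Rem X Y s t) \<le> 4 * K * (modulus p g' s t)\<^sup>2"
    proof (rule remainder_apriori_of_bound[OF p rough' _ eps(2,3) lim _ _ st])
      show "modulus p g' a b \<le> \<epsilon>" if "a \<in> J" "b \<in> J" "a \<le> b" for a b
      proof -
        have "modulus p g' a b \<le> (\<epsilon> powr p) powr (1 / p)"
          unfolding modulus_def g'_diff
          using small[OF that] \<delta>(2)[OF that, of n] nn[OF that] rough_on_le[OF rough that] p
          by (intro powr_mono2) (auto simp: \<kappa>_def)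
        then show ?thesis using p eps by (simp add: powr_powr)
      qed
      show "0 \<le> \<delta> n powr - (2 / p)" by simp
      show "norm (Rem X Y a b) \<le> \<delta> n powr - (2 / p) * (modulus p g' a b)\<^sup>2" if "a \<in> J" "b \<in> J" "a \<le> b" for a b
      proof (cases "a = b")
        case False
        have "norm (Rem X Y a b) = (norm (Rem X Y a b) powr (p / 2)) powr (2 / p)" using p by (simp add: powr_powr)
        also have "\<dots> \<le> (h b - h a) powr (2 / p)" using h[OF that(1,2)] that False p by (intro powr_mono2) auto
        also have "\<dots> = \<delta> n powr - (2 / p) * (\<delta> n * (h b - h a)) powr (2 / p)"
          using \<delta>(1)[of n] h_mono[OF that] by (simp add: powr_mult flip: powr_add mult.assoc)
        also have "\<dots> \<le> \<delta> n powr - (2 / p) * (g' b - g' a) powr (2 / p)"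
          unfolding g'_diff using nn[OF that] rough_on_le[OF rough that] p by (intro mult_left_mono powr_mono2) auto
        finally show ?thesis using p by (simp add: modulus_power)
      qed simp
    qed
    then show ?thesis using p by (simp add: modulus_power g'_diff)
  qed
  moreover have "(\<lambda>n. 4 * K * ((g t - g s) + \<delta> n * (h t - h s)) powr (2 / p)) \<longlonglongrightarrow> 4 * K * ((g t - g s) + 0 * (h t - h s)) powr (2 / p)"
    using \<delta>(1) h_mono[OF st] rough_on_le[OF rough st] p
    by (intro tendsto_intros tendsto_powr' \<delta>(3) disjI2 conjI always_eventually) (auto intro!: add_nonneg_nonneg mult_nonneg_nonneg simp: less_imp_le)
  ultimately have "norm (Rem X Y s t) \<le> 4 * K * ((g t - g s) + 0 * (h t - h s)) powr (2 / p)"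
    using LIMSEQ_le_const by fast
  then show ?thesis using p by (simp add: modulus_power)
  qed
  show "norm (Rem X Y s t) \<le> 4 * K * (modulus p g s t)\<^sup>2" by (rule *[OF st])
  have D: "0 \<le> 4 * K" using K_ge_1 by simp
  have "norm (incr Y s t) \<le> (K + 4 * K) * modulus p g s t"
    by (rule remainder_step(1)[OF p rough small_mod eps(2,3) lim D * st])
  then show "norm (incr Y s t) \<le> 5 * K * modulus p g s t" by simp
  have "norm (incr Y s t - Xi X XX Y s t) \<le> 2 * c * K\<^sup>2 * (1 + 4 * K) * modulus p g s t ^ 3"
    unfolding c_def by (rule remainder_step(2)[OF p rough small_mod eps(2,3) lim D * st])
  also have "\<dots> \<le> 2 * c * K\<^sup>2 * (5 * K) * modulus p g s t ^ 3"
    using K_ge_1 c by (intro mult_right_mono mult_left_mono) auto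
  finally show "norm (incr Y s t - Xi X XX Y s t) \<le> 10 * sew_const p * K ^ 3 * modulus p g s t ^ 3"
    by (simp add: c_def power2_eq_square power3_eq_cube mult_ac)
qed


lemma DFF_diff_bound:
  "norm (DFF F y A - DFF F z B) \<le> K * norm A * norm (y - z) + K * norm (A - B)"
proof -
  have "DFF F y A - DFF F z B = (DFF F y A - DFF F z A) + DFF F z (A - B)" by (simp add: DFF_diff)
  then show ?thesis using norm_triangle_mono[OF DFF_lipschitz DFF_bound] by metis
qed

lemma Xi_diff_bound:
  "norm (Xi X XX Y s t - Xi X' XX' Y' s t) \<le> K * (norm (incr X s t) + norm (XX s t)) * norm (Y s - Y' s)
     + K * (norm (incr X s t - incr X' s t) + norm (XX s t - XX' s t))"
proof -
  have "Xi X XX Y s t - Xi X' XX' Y' s t =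
      (blinfun_apply (F (Y s)) (incr X s t) - blinfun_apply (F (Y' s)) (incr X' s t))
      + (DFF F (Y s) (XX s t) - DFF F (Y' s) (XX' s t))" by (simp add: Xi_def)
  also have "norm \<dots> \<le> ((K * norm (Y s - Y' s)) * norm (incr X s t) + K * norm (incr X s t - incr X' s t))
      + (K * norm (XX s t) * norm (Y s - Y' s) + K * norm (XX s t - XX' s t))"
    by (intro norm_triangle_mono DFF_diff_bound order_trans[OF norm_blinfun_diff] add_mono mult_right_mono F_lipschitz F_bound norm_ge_zero)
  finally show ?thesis by (simp add: algebra_simps)
qed

text \<open>Every factor in the defect is compared in turn; each difference is of the order of the factor
  itself times \<open>D + r\<close>, where \<open>r\<close> measures the distance of the drivers and \<open>D\<close> the unknown distance
  of the solutions.\<close>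

lemma Xi_defect_diff_bound:
  assumes chen: "XX s t = XX s u + XX u t + tensor (incr X s u) (incr X u t)"
      "XX' s t = XX' s u + XX' u t + tensor (incr X' s u) (incr X' u t)"
    and \<mu>: "0 \<le> \<mu>" "\<mu> \<le> 1" and D: "0 \<le> D" "0 \<le> r"
    and X: "norm (incr X s u) \<le> \<mu>" "norm (incr X' s u) \<le> \<mu>" "norm (incr X u t) \<le> \<mu>" "norm (XX u t) \<le> \<mu>\<^sup>2"
    and dX: "norm (incr X s u - incr X' s u) \<le> r * \<mu>" "norm (incr X u t - incr X' u t) \<le> r * \<mu>"
      "norm (XX u t - XX' u t) \<le> r * \<mu>\<^sup>2"
    and R': "norm (Rem X' Y' s u) \<le> 4 * K * \<mu>\<^sup>2" and Y': "norm (incr Y' s u) \<le> 5 * K * \<mu>"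
    and dY: "norm (Y s - Y' s) \<le> D" "norm (incr Y s u - incr Y' s u) \<le> 2 * K * (D + r) * \<mu>"
    and dR: "norm (Rem X Y s u - Rem X' Y' s u) \<le> D * \<mu>\<^sup>2"
  shows "norm ((Xi X XX Y s t - Xi X XX Y s u - Xi X XX Y u t) - (Xi X' XX' Y' s t - Xi X' XX' Y' s u - Xi X' XX' Y' u t))
    \<le> 29 * K\<^sup>2 * (D + r) * \<mu> ^ 3"
proof -
  define E where "E = D + r"
  have E: "0 \<le> E" "D \<le> E" "r \<le> E" using D by (auto simp: E_def)
  let ?P = "P (Y s) (incr X s u) (Rem X Y s u)" and ?P' = "P (Y' s) (incr X' s u) (Rem X' Y' s u)"
  have mu2: "\<mu> * \<mu> \<le> \<mu>" using \<mu> by (simp add: mult_left_le_one_le)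
  have dP: "norm (?P - ?P') \<le> 12 * K\<^sup>2 * E * \<mu>\<^sup>2"
  proof -
    have "norm (?P - ?P') \<le> K * (D * \<mu>\<^sup>2 + (4 * K * \<mu>\<^sup>2) * (D * (1 + 1) + r * 1) + \<mu>\<^sup>2 * D + (\<mu> + \<mu>) * (D * \<mu> + r * \<mu>))"
    proof (rule order_trans[OF P_lipschitz mult_left_mono])
      have x1: "norm (incr X s u) \<le> 1" using X(1) \<mu> by simp
      have rmu: "r * \<mu> \<le> r * 1" using \<mu> D by (intro mult_left_mono)
      show "norm (Rem X Y s u - Rem X' Y' s u) + norm (Rem X' Y' s u) *
            (norm (Y s - Y' s) * (1 + norm (incr X s u)) + norm (incr X s u - incr X' s u))
          + (norm (incr X s u))\<^sup>2 * norm (Y s - Y' s)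
          + (norm (incr X s u) + norm (incr X' s u)) * (norm (Y s - Y' s) * norm (incr X s u) + norm (incr X s u - incr X' s u))
          \<le> D * \<mu>\<^sup>2 + (4 * K * \<mu>\<^sup>2) * (D * (1 + 1) + r * 1) + \<mu>\<^sup>2 * D + (\<mu> + \<mu>) * (D * \<mu> + r * \<mu>)"
        using dR R' dY X dX x1 rmu \<mu> D K_ge_1
        by (intro add_mono mult_mono power_mono mult_nonneg_nonneg add_nonneg_nonneg order_refl order_trans[OF dX(1) rmu]) auto
    qed (use K_ge_1 in auto)
    also have "\<dots> = K * \<mu>\<^sup>2 * (4 * K * (2 * D + r) + 4 * D + 2 * r)"
      by (simp add: algebra_simps power2_eq_square)
    also have "\<dots> \<le> K * \<mu>\<^sup>2 * (4 * K * (2 * E) + 4 * (K * E))"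
    proof -
      have "1 * E \<le> K * E" using K_ge_1 E by (intro mult_right_mono) auto
      then have "4 * D + 2 * r \<le> 4 * (K * E)" using D by (simp add: E_def)
      moreover have "4 * K * (2 * D + r) \<le> 4 * K * (2 * E)"
        using K_ge_1 D by (intro mult_left_mono) (auto simp: E_def)
      ultimately have "4 * K * (2 * D + r) + 4 * D + 2 * r \<le> 4 * K * (2 * E) + 4 * (K * E)" by linarith
      then show ?thesis using K_ge_1 by (rule_tac mult_left_mono) auto
    qed
    finally show ?thesis by (simp add: power2_eq_square mult_ac)
  qed
  have P': "norm ?P' \<le> 5 * K\<^sup>2 * \<mu>\<^sup>2"
  proof -
    have "norm ?P' \<le> K * (4 * K * \<mu>\<^sup>2 + \<mu>\<^sup>2)"
      using R' X K_ge_1 by (intro order_trans[OF P_bound] mult_left_mono add_mono power_mono) auto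
    also have "\<dots> \<le> K * (4 * K * \<mu>\<^sup>2 + K * \<mu>\<^sup>2)"
      using K_ge_1 mult_right_mono[OF K_ge_1, of "\<mu>\<^sup>2"] by (intro mult_left_mono add_left_mono) auto
    finally show ?thesis by (simp add: power2_eq_square algebra_simps)
  qed
  have 1: "norm (blinfun_apply ?P (incr X u t) - blinfun_apply ?P' (incr X' u t)) \<le> 17 * K\<^sup>2 * E * \<mu> ^ 3"
  proof -
    have "norm (blinfun_apply ?P (incr X u t) - blinfun_apply ?P' (incr X' u t))
        \<le> (12 * K\<^sup>2 * E * \<mu>\<^sup>2) * \<mu> + (5 * K\<^sup>2 * \<mu>\<^sup>2) * (E * \<mu>)"
      using dP P' X dX E \<mu> mult_right_mono[OF E(3) \<mu>(1)]
      by (intro order_trans[OF norm_blinfun_diff] add_mono mult_mono mult_nonneg_nonneg order_trans[OF dX(2)]) auto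
    then show ?thesis by (simp add: power2_eq_square power3_eq_cube algebra_simps)
  qed
  have Yu: "Y u = Y s + incr Y s u" "Y' u = Y' s + incr Y' s u" by (auto simp: incr_def)
  let ?A = "XX u t" and ?A' = "XX' u t"
  have 2: "norm ((DFF F (Y u) ?A - DFF F (Y s) ?A) - (DFF F (Y' u) ?A - DFF F (Y' s) ?A)) \<le> 7 * K\<^sup>2 * E * \<mu> ^ 3"
  proof -
    have "norm ((DFF F (Y u) ?A - DFF F (Y s) ?A) - (DFF F (Y' u) ?A - DFF F (Y' s) ?A))
       \<le> (K * norm ?A) * (norm (incr Y s u - incr Y' s u) + norm (incr Y' s u) * norm (Y s - Y' s))"
      unfolding Yu using DFF_second_order[of ?A] unfolding second_order_lipschitz_def by blast
    also have "\<dots> \<le> (K * \<mu>\<^sup>2) * (2 * K * (D + r) * \<mu> + (5 * K * \<mu>) * E)"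
      using K_ge_1 X dY Y' E \<mu> D
      by (intro mult_mono add_mono mult_nonneg_nonneg add_nonneg_nonneg order_trans[OF dY(1)] order_refl) auto
    finally show ?thesis by (simp add: E_def power2_eq_square power3_eq_cube algebra_simps)
  qed
  have 3: "norm (DFF F (Y' u) (?A - ?A') - DFF F (Y' s) (?A - ?A')) \<le> 5 * K\<^sup>2 * E * \<mu> ^ 3"
  proof -
    have "norm (DFF F (Y' u) (?A - ?A') - DFF F (Y' s) (?A - ?A')) \<le> K * norm (?A - ?A') * norm (incr Y' s u)"
      using DFF_lipschitz by (simp add: incr_def)
    also have "\<dots> \<le> K * (E * \<mu>\<^sup>2) * (5 * K * \<mu>)"
      using K_ge_1 dX Y' E \<mu> mult_right_mono[OF E(3), of "\<mu>\<^sup>2"]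
      by (intro mult_mono mult_nonneg_nonneg order_trans[OF dX(3)]) auto
    finally show ?thesis by (simp add: power2_eq_square power3_eq_cube algebra_simps)
  qed
  have "(Xi X XX Y s t - Xi X XX Y s u - Xi X XX Y u t) - (Xi X' XX' Y' s t - Xi X' XX' Y' s u - Xi X' XX' Y' u t)
     = - ((blinfun_apply ?P (incr X u t) - blinfun_apply ?P' (incr X' u t))
        + ((DFF F (Y u) ?A - DFF F (Y s) ?A) - (DFF F (Y' u) ?A - DFF F (Y' s) ?A))
        + (DFF F (Y' u) (?A - ?A') - DFF F (Y' s) (?A - ?A')))"
    unfolding Xi_defect[OF chen(1)] Xi_defect[OF chen(2)] DFF_diff by simp
  also have "norm \<dots> \<le> 17 * K\<^sup>2 * E * \<mu> ^ 3 + 7 * K\<^sup>2 * E * \<mu> ^ 3 + 5 * K\<^sup>2 * E * \<mu> ^ 3"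
    unfolding norm_minus_cancel by (intro norm_triangle_mono 1 2 3)
  also have "\<dots> = 29 * K\<^sup>2 * E * \<mu> ^ 3" by simp
  finally show ?thesis unfolding E_def .
qed

text \<open>The second-order term \<open>DFF F (Y\<^sub>s) XX\<^sub>s\<^sub>,\<^sub>t\<close> contributes the distance of \<open>Y\<close> and \<open>Y'\<close> at \<open>s\<close> without a small factor. Hence
  this distance is estimated first, from its value at the left end \<open>a\<close>, which makes its dependence
  on \<open>D\<close> small.\<close>

lemma difference_step:
  assumes p: "0 < p" "p < 3" and rough: "rough_on J p g X XX" "rough_on J p g X' XX'"
    and small: "\<And>s t. s \<in> J \<Longrightarrow> t \<in> J \<Longrightarrow> s \<le> t \<Longrightarrow> modulus p g s t \<le> \<epsilon>"
    and eps: "\<epsilon> \<le> 1" "62 * sew_const p * K\<^sup>2 * \<epsilon> \<le> 1"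
    and dX: "\<And>s t. s \<in> J \<Longrightarrow> t \<in> J \<Longrightarrow> s \<le> t \<Longrightarrow> norm (incr X s t - incr X' s t) \<le> r * modulus p g s t"
      "\<And>s t. s \<in> J \<Longrightarrow> t \<in> J \<Longrightarrow> s \<le> t \<Longrightarrow> norm (XX s t - XX' s t) \<le> r * (modulus p g s t)\<^sup>2"
    and apriori: "\<And>s t. s \<in> J \<Longrightarrow> t \<in> J \<Longrightarrow> s \<le> t \<Longrightarrow> norm (Rem X' Y' s t) \<le> 4 * K * (modulus p g s t)\<^sup>2"
      "\<And>s t. s \<in> J \<Longrightarrow> t \<in> J \<Longrightarrow> s \<le> t \<Longrightarrow> norm (incr Y' s t) \<le> 5 * K * modulus p g s t"
    and lim: "\<And>s t. s \<in> J \<Longrightarrow> t \<in> J \<Longrightarrow> s < t \<Longrightarrow>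
        has_chain_limit J (\<lambda>s t. Xi X XX Y s t - Xi X' XX' Y' s t) (incr Y s t - incr Y' s t) s t"
    and start: "a \<in> J" "\<And>t. t \<in> J \<Longrightarrow> a \<le> t" "norm (Y a - Y' a) \<le> r"
    and D: "0 \<le> D" "\<And>s. s \<in> J \<Longrightarrow> norm (Y s - Y' s) \<le> D"
      "\<And>s t. s \<in> J \<Longrightarrow> t \<in> J \<Longrightarrow> s \<le> t \<Longrightarrow> norm (Rem X Y s t - Rem X' Y' s t) \<le> D * (modulus p g s t)\<^sup>2"
    and st: "s \<in> J" "t \<in> J" "s \<le> t"
  shows "norm (incr Y s t - incr Y' s t) \<le> 2 * K * (D + r) * modulus p g s t"
    and "norm (Y s - Y' s) \<le> 3 * K * r + D / 2"
    and "norm (Rem X Y s t - Rem X' Y' s t) \<le> (3 * K * r + D / 2) * (modulus p g s t)\<^sup>2"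
proof -
  let ?m = "modulus p g"
  define c where "c = sew_const p"
  have c: "1 \<le> c" using sew_const_props(1)[OF p] by (simp add: c_def)
  have r: "0 \<le> r" using start(3) norm_ge_zero order_trans by blast
  have X: "norm (incr X a b) \<le> ?m a b" "norm (XX a b) \<le> (?m a b)\<^sup>2" if "a \<in> J" "b \<in> J" "a \<le> b" for a b
    using rough_onD[OF rough(1) that] by simp_all
  have X': "norm (incr X' a b) \<le> ?m a b" "norm (XX' a b) \<le> (?m a b)\<^sup>2" if "a \<in> J" "b \<in> J" "a \<le> b" for a b
    using rough_onD[OF rough(2) that] by simp_all
  have mono: "mono_on J g" using rough by (simp add: rough_on_def)
  have mm: "?m a b \<le> ?m a' b'" if "a' \<in> J" "a \<in> J" "b \<in> J" "b' \<in> J" "a' \<le> a" "a \<le> b" "b \<le> b'" for a b a' b'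
    using that mono p by (intro modulus_mono) (auto simp: mono_on_def)
  have dY: "norm (incr Y a b - incr Y' a b) \<le> 2 * K * (D + r) * ?m a b" if ab: "a \<in> J" "b \<in> J" "a \<le> b" for a b
  proof -
    have "incr Y a b - incr Y' a b = (blinfun_apply (F (Y a)) (incr X a b) - blinfun_apply (F (Y' a)) (incr X' a b))
        + (Rem X Y a b - Rem X' Y' a b)"
      unfolding incr_eq_Rem[of Y a b X] incr_eq_Rem[of Y' a b X'] by simp
    also have "norm \<dots> \<le> ((K * D) * ?m a b + K * (r * ?m a b)) + D * (?m a b)\<^sup>2"
      using K_ge_1 D(1) D(2)[OF ab(1)] D(3)[OF ab] X[OF ab] dX[OF ab]
      by (intro norm_triangle_mono order_trans[OF norm_blinfun_diff] add_mono mult_mono F_bound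
          order_trans[OF F_lipschitz] mult_left_mono mult_nonneg_nonneg ab) auto
    also have "D * (?m a b)\<^sup>2 \<le> D * (K * ?m a b)"
    proof (rule mult_left_mono[OF _ D(1)])
      have "?m a b * ?m a b \<le> K * ?m a b" using small[OF ab] eps K_ge_1 by (intro mult_right_mono) auto
      then show "(?m a b)\<^sup>2 \<le> K * ?m a b" by (simp add: power2_eq_square)
    qed
    also have "(K * D) * ?m a b + K * (r * ?m a b) + D * (K * ?m a b) = K * (2 * D + r) * ?m a b"
      by (simp add: algebra_simps)
    also have "\<dots> \<le> 2 * K * (D + r) * ?m a b"
      using K_ge_1 r by (intro mult_right_mono) (auto simp: algebra_simps)
    finally show ?thesis by simp
  qed
  show "norm (incr Y s t - incr Y' s t) \<le> 2 * K * (D + r) * ?m s t" by (rule dY[OF st])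
  have e0: "0 \<le> \<epsilon>" using small[OF st] modulus_nonneg order_trans by blast
  have cK: "1 \<le> K\<^sup>2" "K \<le> K\<^sup>2" using K_ge_1 by (auto simp: power2_eq_square intro: order_trans[OF K_ge_1] mult_le_cancel_right1[THEN iffD2])
  have cK2: "K \<le> c * K\<^sup>2" "K\<^sup>2 \<le> c * K\<^sup>2" using cK c mult_right_mono[OF c, of "K\<^sup>2"] by auto
  have Ed: "0 \<le> D + r" using D r by simp
  have sup': "norm (Y b - Y' b) \<le> r + 2 * K * \<epsilon> * (D + r)" if "b \<in> J" for b
  proof -
    have "Y b - Y' b = (Y a - Y' a) + (incr Y a b - incr Y' a b)" by (simp add: incr_def)
    also have "norm \<dots> \<le> r + 2 * K * (D + r) * \<epsilon>"
      using K_ge_1 Ed small[OF start(1) that start(2)[OF that]]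
      by (intro norm_triangle_mono start order_trans[OF dY[OF start(1) that start(2)[OF that]]] mult_left_mono) auto
    finally show ?thesis by (simp add: mult_ac)
  qed
  have "2 * K * \<epsilon> \<le> 1 / 2"
    using mult_right_mono[OF cK2(1) e0] eps by (simp add: c_def mult_ac)
  then have "2 * K * \<epsilon> * (D + r) \<le> 1 / 2 * (D + r)" using Ed by (intro mult_right_mono)
  with sup'[OF st(1)] have "norm (Y s - Y' s) \<le> r + 1 / 2 * (D + r)" by (rule_tac order_trans) auto
  moreover have Kr: "r \<le> K * r" "3 * K * r = 3 * (K * r)" "2 * K * r = 2 * (K * r)"
    using mult_right_mono[OF K_ge_1 r] by simp_all
  moreover have "1 / 2 * (D + r) = D / 2 + r / 2" by (simp add: field_simps)
  ultimately show "norm (Y s - Y' s) \<le> 3 * K * r + D / 2" using r unfolding Kr(2) by linarith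
  have defect: "norm ((Xi X XX Y a b - Xi X' XX' Y' a b) - (Xi X XX Y a u - Xi X' XX' Y' a u) - (Xi X XX Y u b - Xi X' XX' Y' u b))
      \<le> 29 * K\<^sup>2 * (D + r) * ?m a b ^ 3"
    if J: "a \<in> J" "u \<in> J" "b \<in> J" and le: "a \<le> u" "u \<le> b" for a u b
  proof -
    have m: "?m a u \<le> ?m a b" "?m u b \<le> ?m a b" "?m a b \<le> 1" using mm J le small[of a b] eps by auto
    have m2: "(?m a u)\<^sup>2 \<le> (?m a b)\<^sup>2" "(?m u b)\<^sup>2 \<le> (?m a b)\<^sup>2" using m by (auto intro: power_mono)
    have "norm ((Xi X XX Y a b - Xi X XX Y a u - Xi X XX Y u b) - (Xi X' XX' Y' a b - Xi X' XX' Y' a u - Xi X' XX' Y' u b))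
      \<le> 29 * K\<^sup>2 * (D + r) * ?m a b ^ 3"
    proof (rule Xi_defect_diff_bound)
      show "XX a b = XX a u + XX u b + tensor (incr X a u) (incr X u b)" by (rule rough_on_chen[OF rough(1) J le])
      show "XX' a b = XX' a u + XX' u b + tensor (incr X' a u) (incr X' u b)" by (rule rough_on_chen[OF rough(2) J le])
      show "norm (incr X a u) \<le> ?m a b" "norm (incr X' a u) \<le> ?m a b" "norm (incr X u b) \<le> ?m a b"
        "norm (XX u b) \<le> (?m a b)\<^sup>2"
        using X[OF J(1,2) le(1)] X'[OF J(1,2) le(1)] X[OF J(2,3) le(2)] m m2 by linarith+
      show "norm (incr X a u - incr X' a u) \<le> r * ?m a b"
        by (rule order_trans[OF dX(1)[OF J(1,2) le(1)] mult_left_mono[OF m(1) r]])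
      show "norm (incr X u b - incr X' u b) \<le> r * ?m a b"
        by (rule order_trans[OF dX(1)[OF J(2,3) le(2)] mult_left_mono[OF m(2) r]])
      show "norm (XX u b - XX' u b) \<le> r * (?m a b)\<^sup>2"
        by (rule order_trans[OF dX(2)[OF J(2,3) le(2)] mult_left_mono[OF m2(2) r]])
      show "norm (Rem X' Y' a u) \<le> 4 * K * (?m a b)\<^sup>2"
        using K_ge_1 by (intro order_trans[OF apriori(1)[OF J(1,2) le(1)] mult_left_mono[OF m2(1)]]) auto
      show "norm (incr Y' a u) \<le> 5 * K * ?m a b"
        using K_ge_1 by (intro order_trans[OF apriori(2)[OF J(1,2) le(1)] mult_left_mono[OF m(1)]]) auto
      show "norm (incr Y a u - incr Y' a u) \<le> 2 * K * (D + r) * ?m a b"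
        using K_ge_1 Ed by (intro order_trans[OF dY[OF J(1,2) le(1)] mult_left_mono[OF m(1)]]) auto
      show "norm (Rem X Y a u - Rem X' Y' a u) \<le> D * (?m a b)\<^sup>2"
        by (rule order_trans[OF D(3)[OF J(1,2) le(1)] mult_left_mono[OF m2(1) D(1)]])
    qed (use m D r J in auto)
    then show ?thesis by (simp add: algebra_simps)
  qed
  have S: "norm ((incr Y s t - incr Y' s t) - (Xi X XX Y s t - Xi X' XX' Y' s t)) \<le> c * (29 * K\<^sup>2 * (D + r)) * ?m s t ^ 3"
  proof (cases "s = t")
    case True
    then show ?thesis using rough_on_diag[OF rough(1) st(1)] rough_on_diag[OF rough(2) st(1)]
      by (simp add: Xi_def blinfun.zero_right modulus_def)
  next
    case False
    show ?thesis
      unfolding c_def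
    proof (rule sewing[OF p _ mono _ defect])
      show "has_chain_limit J (\<lambda>s t. Xi X XX Y s t - Xi X' XX' Y' s t) (incr Y s t - incr Y' s t) s t" using lim st False by simp
      show "Xi X XX Y b b - Xi X' XX' Y' b b = 0" if "b \<in> J" for b
        using rough_on_diag[OF rough(1) that] rough_on_diag[OF rough(2) that] by (simp add: Xi_def blinfun.zero_right)
    qed (use Ed in auto)
  qed
  have "Rem X Y s t - Rem X' Y' s t = ((incr Y s t - incr Y' s t) - (Xi X XX Y s t - Xi X' XX' Y' s t))
      + (DFF F (Y s) (XX s t) - DFF F (Y' s) (XX' s t))"
    by (simp add: Rem_def Xi_def)
  also have "norm \<dots> \<le> c * (29 * K\<^sup>2 * (D + r)) * ?m s t ^ 3
      + (K * (?m s t)\<^sup>2 * (r + 2 * K * \<epsilon> * (D + r)) + K * (r * (?m s t)\<^sup>2))"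
    using K_ge_1 X[OF st] dX[OF st] sup'[OF st(1)] e0 Ed r
    by (intro norm_triangle_mono S order_trans[OF DFF_diff_bound] add_mono mult_mono mult_nonneg_nonneg mult_left_mono) auto
  also have "c * (29 * K\<^sup>2 * (D + r)) * ?m s t ^ 3 \<le> c * (29 * K\<^sup>2 * (D + r)) * (\<epsilon> * (?m s t)\<^sup>2)"
  proof (rule mult_left_mono)
    show "?m s t ^ 3 \<le> \<epsilon> * (?m s t)\<^sup>2"
      using small[OF st] by (simp add: power3_eq_cube power2_eq_square mult.assoc mult_right_mono)
    show "0 \<le> c * (29 * K\<^sup>2 * (D + r))" using c Ed by (intro mult_nonneg_nonneg) auto
  qed
  also have "c * (29 * K\<^sup>2 * (D + r)) * (\<epsilon> * (?m s t)\<^sup>2) + (K * (?m s t)\<^sup>2 * (r + 2 * K * \<epsilon> * (D + r)) + K * (r * (?m s t)\<^sup>2))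
      = (2 * K * r + (29 * (c * K\<^sup>2) + 2 * K\<^sup>2) * \<epsilon> * (D + r)) * (?m s t)\<^sup>2"
    by (simp add: algebra_simps power2_eq_square)
  also have "\<dots> \<le> (3 * K * r + D / 2) * (?m s t)\<^sup>2"
  proof (rule mult_right_mono)
    have "(29 * (c * K\<^sup>2) + 2 * K\<^sup>2) * \<epsilon> \<le> 31 * (c * K\<^sup>2) * \<epsilon>" using cK2 e0 by (intro mult_right_mono) auto
    also have "\<dots> \<le> 1 / 2" using eps by (simp add: c_def mult_ac)
    finally have "(29 * (c * K\<^sup>2) + 2 * K\<^sup>2) * \<epsilon> * (D + r) \<le> 1 / 2 * (D + r)" using Ed by (intro mult_right_mono)
    then show "2 * K * r + (29 * (c * K\<^sup>2) + 2 * K\<^sup>2) * \<epsilon> * (D + r) \<le> 3 * K * r + D / 2"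
      using Kr(1) r unfolding Kr(2,3) by (simp add: algebra_simps)
  qed simp
  finally show "norm (Rem X Y s t - Rem X' Y' s t) \<le> (3 * K * r + D / 2) * (?m s t)\<^sup>2" by simp
qed

lemma local_difference:
  assumes p: "0 < p" "p < 3" and rough: "rough_on J p g X XX" "rough_on J p g X' XX'"
    and small: "\<And>s t. s \<in> J \<Longrightarrow> t \<in> J \<Longrightarrow> s \<le> t \<Longrightarrow> modulus p g s t \<le> \<epsilon>"
    and eps: "\<epsilon> \<le> 1" "62 * sew_const p * K\<^sup>2 * \<epsilon> \<le> 1"
    and dX: "\<And>s t. s \<in> J \<Longrightarrow> t \<in> J \<Longrightarrow> s \<le> t \<Longrightarrow> norm (incr X s t - incr X' s t) \<le> r * modulus p g s t"
      "\<And>s t. s \<in> J \<Longrightarrow> t \<in> J \<Longrightarrow> s \<le> t \<Longrightarrow> norm (XX s t - XX' s t) \<le> r * (modulus p g s t)\<^sup>2"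
    and apriori: "\<And>s t. s \<in> J \<Longrightarrow> t \<in> J \<Longrightarrow> s \<le> t \<Longrightarrow> norm (Rem X Y s t) \<le> 4 * K * (modulus p g s t)\<^sup>2"
      "\<And>s t. s \<in> J \<Longrightarrow> t \<in> J \<Longrightarrow> s \<le> t \<Longrightarrow> norm (incr Y s t) \<le> 5 * K * modulus p g s t"
    and apriori': "\<And>s t. s \<in> J \<Longrightarrow> t \<in> J \<Longrightarrow> s \<le> t \<Longrightarrow> norm (Rem X' Y' s t) \<le> 4 * K * (modulus p g s t)\<^sup>2"
      "\<And>s t. s \<in> J \<Longrightarrow> t \<in> J \<Longrightarrow> s \<le> t \<Longrightarrow> norm (incr Y' s t) \<le> 5 * K * modulus p g s t"
    and lim: "\<And>s t. s \<in> J \<Longrightarrow> t \<in> J \<Longrightarrow> s < t \<Longrightarrow>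
        has_chain_limit J (\<lambda>s t. Xi X XX Y s t - Xi X' XX' Y' s t) (incr Y s t - incr Y' s t) s t"
    and start: "a \<in> J" "\<And>t. t \<in> J \<Longrightarrow> a \<le> t" "norm (Y a - Y' a) \<le> r"
    and t: "t \<in> J"
  shows "norm (incr Y a t - incr Y' a t) \<le> 14 * K\<^sup>2 * r * modulus p g a t"
proof -
  have r: "0 \<le> r" using start(3) norm_ge_zero order_trans by blast
  define Q where "Q D \<longleftrightarrow> (\<forall>s\<in>J. norm (Y s - Y' s) \<le> D) \<and>
    (\<forall>s\<in>J. \<forall>t\<in>J. s \<le> t \<longrightarrow> norm (Rem X Y s t - Rem X' Y' s t) \<le> D * (modulus p g s t)\<^sup>2)" for D
  define D0 where "D0 = r + 10 * K"
  obtain E where E: "E \<longlonglongrightarrow> 2 * (3 * K * r)" "\<And>n. Q (E n)"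
  proof (rule halving_iteration[of Q "3 * K * r" D0])
    show "Q (3 * K * r + D / 2)" if D: "0 \<le> D" "Q D" for D
    proof -
      have D': "norm (Y s - Y' s) \<le> D" if "s \<in> J" for s using D(2) that by (simp add: Q_def)
      have D'': "norm (Rem X Y s t - Rem X' Y' s t) \<le> D * (modulus p g s t)\<^sup>2" if "s \<in> J" "t \<in> J" "s \<le> t" for s t
        using D(2) that by (simp add: Q_def)
      show ?thesis
        unfolding Q_def
      proof (intro conjI ballI impI)
        fix s assume s: "s \<in> J"
        show "norm (Y s - Y' s) \<le> 3 * K * r + D / 2"
          by (rule difference_step(2)[OF p rough small eps dX apriori' lim start D(1) D' D'' s s order_refl])
        fix t assume t: "t \<in> J" "s \<le> t"
        show "norm (Rem X Y s t - Rem X' Y' s t) \<le> (3 * K * r + D / 2) * (modulus p g s t)\<^sup>2"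
          by (rule difference_step(3)[OF p rough small eps dX apriori' lim start D(1) D' D'' s t])
      qed
    qed
    show "Q D0"
      unfolding Q_def
    proof (intro conjI ballI impI)
      fix s assume s: "s \<in> J"
      have 1: "norm (incr Y a s) \<le> 5 * K" "norm (incr Y' a s) \<le> 5 * K"
      proof -
        have "modulus p g a s \<le> 1" using small[OF start(1) s start(2)[OF s]] eps by simp
        then have "5 * K * modulus p g a s \<le> 5 * K * 1" using K_ge_1 by (intro mult_left_mono) auto
        then show "norm (incr Y a s) \<le> 5 * K" "norm (incr Y' a s) \<le> 5 * K"
          using apriori(2)[OF start(1) s start(2)[OF s]] apriori'(2)[OF start(1) s start(2)[OF s]] by linarith+
      qed
      have "Y s - Y' s = (Y a - Y' a) + (incr Y a s - incr Y' a s)" by (simp add: incr_def)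
      also have "norm \<dots> \<le> r + (5 * K + 5 * K)"
        by (intro norm_triangle_mono start order_trans[OF norm_triangle_ineq4] add_mono 1)
      finally show "norm (Y s - Y' s) \<le> D0" by (simp add: D0_def)
      fix t assume t: "t \<in> J" "s \<le> t"
      have "norm (Rem X Y s t - Rem X' Y' s t) \<le> (4 * K + 4 * K) * (modulus p g s t)\<^sup>2"
        unfolding ring_distribs
        by (intro order_trans[OF norm_triangle_ineq4] add_mono apriori apriori' s t)
      also have "\<dots> \<le> D0 * (modulus p g s t)\<^sup>2" using r K_ge_1 by (intro mult_right_mono) (auto simp: D0_def)
      finally show "norm (Rem X Y s t - Rem X' Y' s t) \<le> D0 * (modulus p g s t)\<^sup>2" .
    qed
  qed (use r K_ge_1 in \<open>auto simp: D0_def\<close>)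
  have Q: "Q (6 * K * r)"
    unfolding Q_def
  proof (intro conjI ballI impI)
    fix s assume s: "s \<in> J"
    have "norm (Y s - Y' s) \<le> E n" for n using E(2)[of n] s by (simp add: Q_def)
    then show "norm (Y s - Y' s) \<le> 6 * K * r" using E(1) LIMSEQ_le_const by fastforce
    fix t assume t: "t \<in> J" "s \<le> t"
    have "norm (Rem X Y s t - Rem X' Y' s t) \<le> E n * (modulus p g s t)\<^sup>2" for n
      using E(2)[of n] s t by (simp add: Q_def)
    moreover have "(\<lambda>n. E n * (modulus p g s t)\<^sup>2) \<longlonglongrightarrow> 2 * (3 * K * r) * (modulus p g s t)\<^sup>2"
      by (intro tendsto_intros E)
    ultimately show "norm (Rem X Y s t - Rem X' Y' s t) \<le> 6 * K * r * (modulus p g s t)\<^sup>2"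
      using LIMSEQ_le_const by fastforce
  qed
  have "norm (incr Y a t - incr Y' a t) \<le> 2 * K * (6 * K * r + r) * modulus p g a t"
  proof -
    have Q0: "0 \<le> 6 * K * r" using K_ge_1 r by simp
    have Q1: "norm (Y s - Y' s) \<le> 6 * K * r" if "s \<in> J" for s using Q that by (simp add: Q_def)
    have Q2: "norm (Rem X Y s t - Rem X' Y' s t) \<le> 6 * K * r * (modulus p g s t)\<^sup>2" if "s \<in> J" "t \<in> J" "s \<le> t" for s t
      using Q that by (simp add: Q_def)
    show ?thesis
      by (rule difference_step(1)[OF p rough small eps dX apriori' lim start Q0 Q1 Q2 start(1) t start(2)[OF t]])
  qed
  also have "\<dots> \<le> 2 * K * (6 * K * r + K * r) * modulus p g a t"
    using K_ge_1 r mult_right_mono[OF K_ge_1 r] by (intro mult_right_mono mult_left_mono) auto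
  finally show ?thesis by (simp add: power2_eq_square mult_ac)
qed

end

section \<open>Mesh limits\<close>

lemma has_mesh_limitD:
  assumes "has_mesh_limit \<Xi> l a b" "0 < e"
  shows "\<exists>\<delta>>0. \<forall>n u. is_partition a b n u \<and> (\<forall>i<n. u (Suc i) - u i < \<delta>) \<longrightarrow>
      norm ((\<Sum>i<n. \<Xi> (u i) (u (Suc i))) - l) < e"
  using assms by (simp only: has_mesh_limit_def)

lemma mesh_limit_imp_chain_limit:
  assumes "has_mesh_limit \<Xi> l s t" "s \<le> t" "{s..t} \<subseteq> J"
  shows "has_chain_limit J \<Xi> l s t"
  unfolding has_chain_limit_def
proof (intro allI impI)
  fix e :: real assume "0 < e"
  obtain \<delta> where \<delta>: "0 < \<delta>" "\<forall>n u. is_partition s t n u \<and> (\<forall>i<n. u (Suc i) - u i < \<delta>) \<longrightarrow>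
      norm ((\<Sum>i<n. \<Xi> (u i) (u (Suc i))) - l) < e"
    using has_mesh_limitD[OF assms(1) \<open>0 < e\<close>] by (elim exE conjE)
  note mesh_delta = \<delta>(2)[rule_format, OF conjI]
  obtain n u where u: "is_partition s t n u" "\<forall>i<n. u (Suc i) - u i < \<delta>"
    using fine_partition_exists[OF assms(2) \<delta>(1)] .
  have "u i \<in> {s..t}" if "i \<le> n" for i using is_partition_range[OF u(1) that] by simp
  then have "u ` {..n} \<subseteq> J" using assms(3) by (intro image_subsetI) (simp add: subset_iff)
  with u(1) mesh_delta[OF u] show "\<exists>n u. is_partition s t n u \<and> u ` {..n} \<subseteq> J \<and> norm ((\<Sum>i<n. \<Xi> (u i) (u (Suc i))) - l) < e"
    by (intro exI[of _ n] exI[of _ u] conjI)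
qed

lemma has_mesh_limit_diff:
  assumes "has_mesh_limit \<Xi> l s t" "has_mesh_limit \<Xi>' l' s t"
  shows "has_mesh_limit (\<lambda>s t. \<Xi> s t - \<Xi>' s t) (l - l') s t"
  unfolding has_mesh_limit_def
proof (intro allI impI)
  fix e :: real assume "0 < e"
  then have e2: "0 < e / 2" by simp
  obtain \<delta>1 where \<delta>1: "0 < \<delta>1" "\<forall>n u. is_partition s t n u \<and> (\<forall>i<n. u (Suc i) - u i < \<delta>1) \<longrightarrow>
      norm ((\<Sum>i<n. \<Xi> (u i) (u (Suc i))) - l) < e / 2"
    using has_mesh_limitD[OF assms(1) e2] by (elim exE conjE)
  note mesh_delta1 = \<delta>1(2)[rule_format, OF conjI]
  obtain \<delta>2 where \<delta>2: "0 < \<delta>2" "\<forall>n u. is_partition s t n u \<and> (\<forall>i<n. u (Suc i) - u i < \<delta>2) \<longrightarrow>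
      norm ((\<Sum>i<n. \<Xi>' (u i) (u (Suc i))) - l') < e / 2"
    using has_mesh_limitD[OF assms(2) e2] by (elim exE conjE)
  note mesh_delta2 = \<delta>2(2)[rule_format, OF conjI]
  show "\<exists>\<delta>>0. \<forall>n u. is_partition s t n u \<and> (\<forall>i<n. u (Suc i) - u i < \<delta>) \<longrightarrow>
      norm ((\<Sum>i<n. \<Xi> (u i) (u (Suc i)) - \<Xi>' (u i) (u (Suc i))) - (l - l')) < e"
  proof (intro exI[of _ "min \<delta>1 \<delta>2"] conjI allI impI)
    fix n u assume u: "is_partition s t n u \<and> (\<forall>i<n. u (Suc i) - u i < min \<delta>1 \<delta>2)"
    have "(\<Sum>i<n. \<Xi> (u i) (u (Suc i)) - \<Xi>' (u i) (u (Suc i))) - (l - l')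
        = ((\<Sum>i<n. \<Xi> (u i) (u (Suc i))) - l) - ((\<Sum>i<n. \<Xi>' (u i) (u (Suc i))) - l')"
      by (simp add: sum_subtractf)
    also have "norm \<dots> < e / 2 + e / 2"
      using u by (intro order.strict_trans1[OF norm_triangle_ineq4] add_strict_mono mesh_delta1 mesh_delta2) auto
    finally show "norm ((\<Sum>i<n. \<Xi> (u i) (u (Suc i)) - \<Xi>' (u i) (u (Suc i))) - (l - l')) < e" by simp
  qed (use \<delta>1 \<delta>2 in auto)
qed

text \<open>A partition of \<open>[s,t]\<close> is completed to one of \<open>[0,t]\<close> by a fixed fine partition of \<open>[0,s]\<close>.\<close>

lemma mesh_limit_restart:
  fixes \<Xi> :: "real \<Rightarrow> real \<Rightarrow> 'a::real_normed_vector"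
  assumes lim: "has_mesh_limit \<Xi> (Y s - y0) 0 s" "has_mesh_limit \<Xi> (Y t - y0) 0 t"
    and st: "0 \<le> s" "s \<le> t"
  shows "has_mesh_limit \<Xi> (incr Y s t) s t"
  unfolding has_mesh_limit_def
proof (intro allI impI)
  fix e :: real assume "0 < e"
  then have e2: "0 < e / 2" by simp
  obtain \<delta>1 where \<delta>1: "0 < \<delta>1" "\<forall>n u. is_partition 0 s n u \<and> (\<forall>i<n. u (Suc i) - u i < \<delta>1) \<longrightarrow>
      norm ((\<Sum>i<n. \<Xi> (u i) (u (Suc i))) - (Y s - y0)) < e / 2"
    using has_mesh_limitD[OF lim(1) e2] by (elim exE conjE)
  note mesh_delta1 = \<delta>1(2)[rule_format, OF conjI]
  obtain \<delta>2 where \<delta>2: "0 < \<delta>2" "\<forall>n u. is_partition 0 t n u \<and> (\<forall>i<n. u (Suc i) - u i < \<delta>2) \<longrightarrow>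
      norm ((\<Sum>i<n. \<Xi> (u i) (u (Suc i))) - (Y t - y0)) < e / 2"
    using has_mesh_limitD[OF lim(2) e2] by (elim exE conjE)
  note mesh_delta2 = \<delta>2(2)[rule_format, OF conjI]
  define \<delta> where "\<delta> = min \<delta>1 \<delta>2"
  have \<delta>: "0 < \<delta>" using \<delta>1 \<delta>2 by (simp add: \<delta>_def)
  obtain m v where v: "is_partition 0 s m v" "\<forall>i<m. v (Suc i) - v i < \<delta>"
    using fine_partition_exists[OF st(1) \<delta>] .
  show "\<exists>\<delta>>0. \<forall>n u. is_partition s t n u \<and> (\<forall>i<n. u (Suc i) - u i < \<delta>) \<longrightarrow>
      norm ((\<Sum>i<n. \<Xi> (u i) (u (Suc i))) - incr Y s t) < e"
  proof (intro exI[of _ \<delta>] conjI allI impI \<delta>)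
    fix n u assume u: "is_partition s t n u \<and> (\<forall>i<n. u (Suc i) - u i < \<delta>)"
    obtain w where w: "is_partition 0 t (m + n) w" "\<forall>i<m+n. w (Suc i) - w i < \<delta>"
      "(\<Sum>i<m+n. \<Xi> (w i) (w (Suc i))) = (\<Sum>i<m. \<Xi> (v i) (v (Suc i))) + (\<Sum>i<n. \<Xi> (u i) (u (Suc i)))"
      using partition_concat[OF v(1) u[THEN conjunct1] v(2) u[THEN conjunct2], of \<Xi>] by (elim exE conjE)
    have "(\<Sum>i<n. \<Xi> (u i) (u (Suc i))) - incr Y s t
       = ((\<Sum>i<m+n. \<Xi> (w i) (w (Suc i))) - (Y t - y0)) - ((\<Sum>i<m. \<Xi> (v i) (v (Suc i))) - (Y s - y0))"
      unfolding w(3) incr_def by simp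
    also have "norm \<dots> < e / 2 + e / 2"
      using v w by (intro order.strict_trans1[OF norm_triangle_ineq4] add_strict_mono mesh_delta1 mesh_delta2) (auto simp: \<delta>_def)
    finally show "norm ((\<Sum>i<n. \<Xi> (u i) (u (Suc i))) - incr Y s t) < e" by simp
  qed
qed

text \<open>This is the argument of the Saks-Henstock lemma: a short interval \<open>[u,v]\<close> is completed to a fine
  partition of \<open>[0,T]\<close> by partitions of \<open>[0,u]\<close> and \<open>[v,T]\<close> on which the sums are already close to the
  increments of \<open>Y\<close>. It is convergence in mesh, rather than under refinement, that makes the
  error over an interval containing a jump small.\<close>

lemma mesh_limit_uniform:
  fixes \<Xi> :: "real \<Rightarrow> real \<Rightarrow> 'a::real_normed_vector"
  assumes lim: "\<And>s t. 0 \<le> s \<Longrightarrow> s \<le> t \<Longrightarrow> t \<le> T \<Longrightarrow> has_mesh_limit \<Xi> (incr Y s t) s t"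
    and T: "0 \<le> T" and e: "0 < e"
  obtains \<delta> where "0 < \<delta>" "\<And>u v. 0 \<le> u \<Longrightarrow> u < v \<Longrightarrow> v \<le> T \<Longrightarrow> v - u < \<delta> \<Longrightarrow> norm (incr Y u v - \<Xi> u v) \<le> e"
proof -
  have e3: "0 < e / 3" using e by simp
  obtain \<delta> where \<delta>: "0 < \<delta>" "\<forall>n u. is_partition 0 T n u \<and> (\<forall>i<n. u (Suc i) - u i < \<delta>) \<longrightarrow>
      norm ((\<Sum>i<n. \<Xi> (u i) (u (Suc i))) - incr Y 0 T) < e / 3"
    using has_mesh_limitD[OF lim[OF order_refl T order_refl] e3] by (elim exE conjE)
  note mesh_delta = \<delta>(2)[rule_format, OF conjI]
  have approx: "\<exists>n w. is_partition s t n w \<and> (\<forall>i<n. w (Suc i) - w i < \<delta>) \<and>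
      norm ((\<Sum>i<n. \<Xi> (w i) (w (Suc i))) - incr Y s t) < e / 3" if st: "0 \<le> s" "s \<le> t" "t \<le> T" for s t
  proof -
    obtain d where d: "0 < d" "\<forall>n u. is_partition s t n u \<and> (\<forall>i<n. u (Suc i) - u i < d) \<longrightarrow>
      norm ((\<Sum>i<n. \<Xi> (u i) (u (Suc i))) - incr Y s t) < e / 3"
      using has_mesh_limitD[OF lim[OF st] e3] by (elim exE conjE)
  note mesh_d = d(2)[rule_format, OF conjI]
    obtain n w where "is_partition s t n w" "\<forall>i<n. w (Suc i) - w i < min d \<delta>"
      using fine_partition_exists[OF st(2), of "min d \<delta>"] d(1) \<delta>(1) by auto
    then show ?thesis using mesh_d[of n w] by auto
  qed
  have "norm (incr Y u v - \<Xi> u v) \<le> e" if uv: "0 \<le> u" "u < v" "v \<le> T" "v - u < \<delta>" for u v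
  proof -
    obtain n1 w1 where w1: "is_partition 0 u n1 w1" "\<forall>i<n1. w1 (Suc i) - w1 i < \<delta>"
      "norm ((\<Sum>i<n1. \<Xi> (w1 i) (w1 (Suc i))) - incr Y 0 u) < e / 3" using approx[of 0 u] uv by auto
    obtain n2 w2 where w2: "is_partition v T n2 w2" "\<forall>i<n2. w2 (Suc i) - w2 i < \<delta>"
      "norm ((\<Sum>i<n2. \<Xi> (w2 i) (w2 (Suc i))) - incr Y v T) < e / 3" using approx[of v T] uv by auto
    define s where "s i = (if i = 0 then u else v)" for i :: nat
    have s: "is_partition u v 1 s" "\<forall>i<1. s (Suc i) - s i < \<delta>" "(\<Sum>i<1. \<Xi> (s i) (s (Suc i))) = \<Xi> u v"
      using uv by (auto simp: s_def is_partition_def)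
    obtain w3 where w3: "is_partition 0 v (n1 + 1) w3" "\<forall>i<n1+1. w3 (Suc i) - w3 i < \<delta>"
      "(\<Sum>i<n1+1. \<Xi> (w3 i) (w3 (Suc i))) = (\<Sum>i<n1. \<Xi> (w1 i) (w1 (Suc i))) + \<Xi> u v"
      using partition_concat[OF w1(1) s(1) w1(2) s(2), of \<Xi>] unfolding s(3) by (elim exE conjE)
    obtain w where w: "is_partition 0 T (n1 + 1 + n2) w" "\<forall>i<n1+1+n2. w (Suc i) - w i < \<delta>"
      "(\<Sum>i<n1+1+n2. \<Xi> (w i) (w (Suc i))) = (\<Sum>i<n1+1. \<Xi> (w3 i) (w3 (Suc i))) + (\<Sum>i<n2. \<Xi> (w2 i) (w2 (Suc i)))"
      using partition_concat[OF w3(1) w2(1) w3(2) w2(2), of \<Xi>] by (elim exE conjE)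
    let ?A = "(\<Sum>i<n1. \<Xi> (w1 i) (w1 (Suc i))) - incr Y 0 u" and ?B = "(\<Sum>i<n2. \<Xi> (w2 i) (w2 (Suc i))) - incr Y v T"
    let ?C = "(\<Sum>i<n1+1+n2. \<Xi> (w i) (w (Suc i))) - incr Y 0 T"
    have "incr Y u v - \<Xi> u v = ?A + ?B - ?C"
      unfolding w(3) w3(3) incr_def by simp
    also have "norm \<dots> \<le> norm ?A + norm ?B + norm ?C"
      by (intro order_trans[OF norm_triangle_ineq4] add_right_mono norm_triangle_ineq)
    also have "\<dots> \<le> e / 3 + e / 3 + e / 3"
      by (intro add_mono less_imp_le[OF w1(3)] less_imp_le[OF w2(3)] less_imp_le[OF mesh_delta[OF w(1,2)]])
    finally show ?thesis by simp
  qed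
  then show thesis using that \<delta>(1) by blast
qed

section \<open>Growth over levels\<close>

text \<open>Within a level set of \<open>g\<close> of height \<open>\<kappa>\<close> the local bound applies directly. Consecutive level sets are bridged by
  one step of a chain, namely the step that first reaches the next level; it may pass over several
  empty level sets when \<open>g\<close> jumps.\<close>

lemma level_growth:
  fixes g \<phi> :: "real \<Rightarrow> real" and \<Lambda> \<kappa> :: real
  assumes mono: "mono_on J g" and \<Lambda>: "1 \<le> \<Lambda>" and \<phi>: "\<And>t. t \<in> J \<Longrightarrow> 0 \<le> \<phi> t"
    and a: "a \<in> J" "\<And>t. t \<in> J \<Longrightarrow> a \<le> t"
    and loc: "\<And>s t. s \<in> J \<Longrightarrow> t \<in> J \<Longrightarrow> s \<le> t \<Longrightarrow> g t - g s \<le> \<kappa> \<Longrightarrow> \<phi> t \<le> \<Lambda> * \<phi> s"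
    and chain: "\<And>t. t \<in> J \<Longrightarrow> \<exists>n u. is_partition a t n u \<and> u ` {..n} \<subseteq> J \<and> (\<forall>i<n. \<phi> (u (Suc i)) \<le> \<Lambda> * \<phi> (u i))"
    and t: "t \<in> J" "g t < g a + real (Suc k) * \<kappa>"
  shows "\<phi> t \<le> \<Lambda> ^ (2 * k + 1) * \<phi> a"
  using t
proof (induction k arbitrary: t)
  case 0
  then show ?case using loc[OF a(1) 0(1) a(2)[OF 0(1)]] 0(2) by simp
next
  case (Suc k)
  have pw: "\<Lambda> ^ i \<le> \<Lambda> ^ j" if "i \<le> j" for i j using that \<Lambda> by (intro power_increasing) auto
  show ?case
  proof (cases "g t < g a + real (Suc k) * \<kappa>")
    case True
    have "\<phi> t \<le> \<Lambda> ^ (2 * k + 1) * \<phi> a" by (rule Suc.IH[OF Suc.prems(1) True])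
    also have "\<dots> \<le> \<Lambda> ^ (2 * Suc k + 1) * \<phi> a" using \<phi>[OF a(1)] by (intro mult_right_mono pw) auto
    finally show ?thesis .
  next
    case False
    define c where "c = g a + real (Suc k) * \<kappa>"
    have \<kappa>: "0 < \<kappa>" using False Suc.prems(2) by (simp add: algebra_simps)
    obtain n u where u: "is_partition a t n u" "u ` {..n} \<subseteq> J" "\<And>i. i < n \<Longrightarrow> \<phi> (u (Suc i)) \<le> \<Lambda> * \<phi> (u i)"
      using chain[OF Suc.prems(1)] by blast
    have u0: "u 0 = a" "u n = t" using u(1) by (auto simp: is_partition_def)
    have uJ: "u i \<in> J" if "i \<le> n" for i using u(2) that by auto
    \<comment> \<open>The first point of the chain that reaches the level.\<close>
    define j where "j = (LEAST i. c \<le> g (u i))"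
    have ex: "c \<le> g (u n)" using False by (simp add: c_def u0)
    have j: "c \<le> g (u j)" "j \<le> n" unfolding j_def by (rule LeastI[of _ n], rule ex) (rule Least_le, rule ex)
    have "0 < c - g a" using \<kappa> by (simp add: c_def)
    then have "j \<noteq> 0" using j(1) u0 by (intro notI) simp
    then obtain i where i: "j = Suc i" by (cases j) auto
    have "\<not> c \<le> g (u i)" using not_less_Least[of i "\<lambda>i. c \<le> g (u i)"] i unfolding j_def by simp
    then have "\<phi> (u i) \<le> \<Lambda> ^ (2 * k + 1) * \<phi> a"
      using i j uJ by (intro Suc.IH) (auto simp: c_def)
    moreover have "\<phi> (u j) \<le> \<Lambda> * \<phi> (u i)" using u(3)[of i] i j by simp
    moreover have "\<phi> t \<le> \<Lambda> * \<phi> (u j)"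
    proof (rule loc[OF uJ[OF j(2)] Suc.prems(1)])
      show "u j \<le> t" using is_partition_range(2)[OF u(1) j(2)] .
      show "g t - g (u j) \<le> \<kappa>" using j(1) Suc.prems(2) by (simp add: c_def algebra_simps)
    qed
    ultimately have "\<phi> t \<le> \<Lambda> * (\<Lambda> * (\<Lambda> ^ (2 * k + 1) * \<phi> a))"
      using \<Lambda> by (meson mult_left_mono order_trans zero_le_one)
    then show ?thesis by (simp add: mult_ac)
  qed
qed

section \<open>Stability over the whole interval\<close>

lemma rough_on_control_mono:
  assumes "rough_on J p g X XX" "0 < p"
    and le: "\<And>s t. s \<in> J \<Longrightarrow> t \<in> J \<Longrightarrow> s \<le> t \<Longrightarrow> g t - g s \<le> g' t - g' s"
  shows "rough_on J p g' X XX"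
  unfolding rough_on_def
proof (intro conjI ballI impI)
  have m: "modulus p g s t \<le> modulus p g' s t" if "s \<in> J" "t \<in> J" "s \<le> t" for s t
    unfolding modulus_def using le[OF that] rough_on_le[OF assms(1) that] assms(2) by (intro powr_mono2) auto
  show "mono_on J g'"
    using rough_on_le[OF assms(1)] le by (intro mono_onI) (smt (verit))
  show "XX s t = XX s u + XX u t + tensor (incr X s u) (incr X u t)"
    if "s \<in> J" "u \<in> J" "t \<in> J" "s \<le> u" "u \<le> t" for s u t
    by (rule rough_on_chen[OF assms(1) that])
  show "norm (incr X s t) \<le> modulus p g' s t" "norm (XX s t) \<le> (modulus p g' s t)\<^sup>2" if "s \<in> J" "t \<in> J" "s \<le> t" for s t
    using rough_onD[OF assms(1) that] m[OF that] power_mono[OF m[OF that] modulus_nonneg, of 2] by linarith+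
qed

context rough_field
begin

text \<open>Compared with \<open>rde_solution\<close>, the mesh limit is taken over every subinterval and the initial value
  is left open.\<close>

definition solves :: "real \<Rightarrow> real \<Rightarrow> (real \<Rightarrow> real^'d) \<Rightarrow> (real \<Rightarrow> real \<Rightarrow> real^'d^'d) \<Rightarrow> (real \<Rightarrow> real^'e) \<Rightarrow> bool" where
  "solves p T X XX Y \<longleftrightarrow> finite_var (p / 2) T (Rem X Y) \<and>
     (\<forall>s t. 0 \<le> s \<and> s \<le> t \<and> t \<le> T \<longrightarrow> has_mesh_limit (Xi X XX Y) (incr Y s t) s t)"

lemma solves_of_rde_solution:
  assumes "rde_solution p T F X XX y0 Y"
  shows "solves p T X XX Y"
proof -
  have "has_mesh_limit (Xi X XX Y) (Y t - y0) 0 t" if t: "0 \<le> t" "t \<le> T" for t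
  proof -
    have "\<exists>I. has_mesh_limit (\<lambda>u v. blinfun_apply (F (Y u)) (incr X u v) + DFF F (Y u) (XX u v)) I 0 t \<and> Y t = y0 + I"
      using assms t by (simp only: rde_solution_def)
    then obtain I where "has_mesh_limit (Xi X XX Y) I 0 t" "Y t = y0 + I"
      unfolding Xi_def[abs_def] by (elim exE conjE)
    then show ?thesis by simp
  qed
  then have "has_mesh_limit (Xi X XX Y) (incr Y s t) s t" if "0 \<le> s" "s \<le> t" "t \<le> T" for s t
    using that by (intro mesh_limit_restart[where ?y0.0 = y0]) auto
  moreover have "finite_var (p / 2) T (Rem X Y)"
    using assms by (simp add: rde_solution_def Rem_def[abs_def])
  ultimately show ?thesis by (simp add: solves_def)
qed

lemma solves_local_apriori:
  assumes p: "0 < p" "p < 3" and T: "0 \<le> T" and rough: "rough_on {0..T} p g X XX" and Y: "solves p T X XX Y"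
    and eps: "0 < \<epsilon>" "\<epsilon> \<le> 1" "4 * sew_const p * K\<^sup>2 * \<epsilon> \<le> 1"
    and ab: "0 \<le> a" "b \<le> T" "g b - g a \<le> \<epsilon> powr p / 2"
    and st: "s \<in> {a..b}" "t \<in> {a..b}" "s \<le> t"
  shows "norm (Rem X Y s t) \<le> 4 * K * (modulus p g s t)\<^sup>2"
    and "norm (incr Y s t) \<le> 5 * K * modulus p g s t"
proof -
  have "finite_var (p / 2) T (Rem X Y)" using Y by (simp add: solves_def)
  then obtain h where h: "\<And>s t. 0 \<le> s \<Longrightarrow> s < t \<Longrightarrow> t \<le> T \<Longrightarrow> norm (Rem X Y s t) powr (p / 2) \<le> h t - h s"
    using finite_var_increasing_control[OF _ T] by metis
  have sub: "{a..b} \<subseteq> {0..T}" using ab by auto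
  have h_le: "h s \<le> h t" if "0 \<le> s" "s \<le> t" "t \<le> T" for s t
  proof (cases "s = t")
    case False
    then show ?thesis using order_trans[OF powr_ge_zero h[of s t]] that by simp
  qed simp
  have bound: "h t - h s \<le> h T - h 0 + 1" if "s \<in> {a..b}" "t \<in> {a..b}" "s \<le> t" for s t
    using h_le[of 0 s] h_le[of t T] that ab by simp
  have H: "0 < h T - h 0 + 1" using h_le[of 0 T] T by simp
  have small: "g t - g s \<le> \<epsilon> powr p / 2" if "s \<in> {a..b}" "t \<in> {a..b}" "s \<le> t" for s t
  proof -
    have "g a \<le> g s" "g t \<le> g b" using rough_on_le[OF rough] that ab by auto
    then show ?thesis using ab(3) by simp
  qed
  have lim: "has_chain_limit {a..b} (Xi X XX Y) (incr Y s t) s t" if "s \<in> {a..b}" "t \<in> {a..b}" "s < t" for s t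
    using that ab Y by (intro mesh_limit_imp_chain_limit) (auto simp: solves_def)
  have h': "norm (Rem X Y s t) powr (p / 2) \<le> h t - h s" if "s \<in> {a..b}" "t \<in> {a..b}" "s < t" for s t
    using h[of s t] that ab by simp
  note * = local_apriori[OF p rough_on_subset[OF rough sub] eps small lim h' bound H st]
  show "norm (Rem X Y s t) \<le> 4 * K * (modulus p g s t)\<^sup>2" by (rule *(1))
  show "norm (incr Y s t) \<le> 5 * K * modulus p g s t" by (rule *(2))
qed

text \<open>The quantity propagated by \<open>level_growth\<close> is \<open>|Y\<^sub>t - Y'\<^sub>t| + r\<close>. Adding \<open>r\<close> makes all bounds
  multiplicative, and it also absorbs the errors \<open>r/2\<close> that are tolerated for each solution in a bridging
  step. Increments over intervals with a large control are bounded by twice the supremum,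
  since there the modulus is bounded below.\<close>

lemma stability:
  assumes p: "0 < p" "p < 3" "1 \<le> p" and T: "0 \<le> T"
    and rough: "rough_on {0..T} p g X XX" "rough_on {0..T} p g X' XX'"
    and sol: "solves p T X XX Y" "solves p T X' XX' Y'"
    and eps: "0 < \<epsilon>" "\<epsilon> \<le> 1" "62 * sew_const p * K\<^sup>2 * \<epsilon> \<le> 1"
    and r: "0 < r" "norm (Y 0 - Y' 0) \<le> r"
    and dX: "\<And>s t. 0 \<le> s \<Longrightarrow> s \<le> t \<Longrightarrow> t \<le> T \<Longrightarrow> norm (incr X s t - incr X' s t) \<le> r * modulus p g s t"
      "\<And>s t. 0 \<le> s \<Longrightarrow> s \<le> t \<Longrightarrow> t \<le> T \<Longrightarrow> norm (XX s t - XX' s t) \<le> r * (modulus p g s t)\<^sup>2"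
    and N: "g T - g 0 < real (Suc N) * (\<epsilon> powr p / 2)"
  defines "\<Lambda> \<equiv> 15 * K\<^sup>2 + K * (modulus p g 0 T + (modulus p g 0 T)\<^sup>2)"
  shows "0 \<le> s \<Longrightarrow> s \<le> t \<Longrightarrow> t \<le> T \<Longrightarrow> norm (Y t - Y' t) \<le> \<Lambda> ^ (2 * N + 1) * (2 * r)"
    and "0 \<le> s \<Longrightarrow> s \<le> t \<Longrightarrow> t \<le> T \<Longrightarrow>
      norm (incr Y s t - incr Y' s t) \<le> (14 * K\<^sup>2 + 4 / \<epsilon>) * \<Lambda> ^ (2 * N + 1) * (2 * r) * modulus p g s t"
proof -
  let ?m = "modulus p g"
  define \<kappa> where "\<kappa> = \<epsilon> powr p / 2"
  have \<kappa>: "0 < \<kappa>" using eps by (simp add: \<kappa>_def)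
  have c: "1 \<le> sew_const p" by (rule sew_const_props(1)[OF p(1,2)])
  have eps4: "4 * sew_const p * K\<^sup>2 * \<epsilon> \<le> 1"
  proof -
    have "4 * (sew_const p * K\<^sup>2 * \<epsilon>) \<le> 62 * (sew_const p * K\<^sup>2 * \<epsilon>)"
      using c eps(1) by (intro mult_right_mono) auto
    then show ?thesis using eps(3) by (simp add: mult.assoc)
  qed
  define \<phi> where "\<phi> t = norm (Y t - Y' t) + r" for t
  have \<phi>: "r \<le> \<phi> t" "0 \<le> \<phi> t" "norm (Y t - Y' t) \<le> \<phi> t" for t using r by (auto simp: \<phi>_def)
  have K2: "1 \<le> K\<^sup>2" using K_ge_1 by (simp add: one_le_power)
  have incr_diff: "Y t - Y' t = (Y s - Y' s) + (incr Y s t - incr Y' s t)" for s t by (simp add: incr_def)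
  have small_mod: "?m s t \<le> \<epsilon>" if "g t - g s \<le> \<kappa>" "g s \<le> g t" for s t
    by (rule modulus_le_of_half[OF p(1) eps(1)]) (use that in \<open>auto simp: \<kappa>_def\<close>)
  have local: "norm (incr Y s t - incr Y' s t) \<le> 14 * K\<^sup>2 * \<phi> s * ?m s t"
    if st: "0 \<le> s" "s \<le> t" "t \<le> T" and sm: "g t - g s \<le> \<kappa>" for s t
  proof (rule local_difference[where J = "{s..t}" and \<epsilon> = \<epsilon> and X = X and XX = XX and X' = X' and XX' = XX'])
    show "0 < p" "p < 3" "\<epsilon> \<le> 1" "62 * sew_const p * K\<^sup>2 * \<epsilon> \<le> 1" by fact+
    have sub: "{s..t} \<subseteq> {0..T}" using st by auto
    show "rough_on {s..t} p g X XX" "rough_on {s..t} p g X' XX'" using rough sub by (auto intro: rough_on_subset)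
    fix a b assume ab: "a \<in> {s..t}" "b \<in> {s..t}" 
    have g: "g s \<le> g a" "g b \<le> g t" using rough_on_le[OF rough(1)] ab st by auto
    {
      assume "a \<le> b"
      then have gab: "g a \<le> g b" "0 \<le> a" "a \<le> b" "b \<le> T" using rough_on_le[OF rough(1)] ab st by auto
      show "?m a b \<le> \<epsilon>" using g gab sm by (intro small_mod) auto
      show "norm (incr X a b - incr X' a b) \<le> \<phi> s * ?m a b"
        by (rule order_trans[OF dX(1)[OF gab(2-4)] mult_right_mono[OF \<phi>(1)]]) simp
      show "norm (XX a b - XX' a b) \<le> \<phi> s * (?m a b)\<^sup>2"
        by (rule order_trans[OF dX(2)[OF gab(2-4)] mult_right_mono[OF \<phi>(1)]]) simp
      show "norm (Rem X Y a b) \<le> 4 * K * (?m a b)\<^sup>2" "norm (incr Y a b) \<le> 5 * K * ?m a b"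
        using solves_local_apriori[OF p(1,2) T rough(1) sol(1) eps(1,2) eps4 st(1) st(3) sm[unfolded \<kappa>_def] ab \<open>a \<le> b\<close>] by auto
      show "norm (Rem X' Y' a b) \<le> 4 * K * (?m a b)\<^sup>2" "norm (incr Y' a b) \<le> 5 * K * ?m a b"
        using solves_local_apriori[OF p(1,2) T rough(2) sol(2) eps(1,2) eps4 st(1) st(3) sm[unfolded \<kappa>_def] ab \<open>a \<le> b\<close>] by auto
    }
    show "has_chain_limit {s..t} (\<lambda>s t. Xi X XX Y s t - Xi X' XX' Y' s t) (incr Y a b - incr Y' a b) a b" if "a < b"
      using ab that st sol by (intro mesh_limit_imp_chain_limit has_mesh_limit_diff) (auto simp: solves_def)
  qed (use st \<phi> in auto)
  have loc: "\<phi> t \<le> \<Lambda> * \<phi> s" if st: "s \<in> {0..T}" "t \<in> {0..T}" "s \<le> t" and sm: "g t - g s \<le> \<kappa>" for s t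
  proof -
    have "norm (Y t - Y' t) \<le> norm (Y s - Y' s) + 14 * K\<^sup>2 * \<phi> s * ?m s t"
      unfolding incr_diff[of t s] using st sm by (intro norm_triangle_mono order_refl local) auto
    also have "14 * K\<^sup>2 * \<phi> s * ?m s t \<le> 14 * K\<^sup>2 * \<phi> s * 1"
      using small_mod[OF sm rough_on_le[OF rough(1) st]] eps(2) \<phi>(2) K_ge_1 by (intro mult_left_mono) auto
    finally have "\<phi> t \<le> 1 * \<phi> s + 14 * K\<^sup>2 * \<phi> s" by (simp add: \<phi>_def)
    also have "\<dots> \<le> K\<^sup>2 * \<phi> s + 14 * K\<^sup>2 * \<phi> s" using K2 \<phi>(2) by (intro add_right_mono mult_right_mono)
    also have "\<dots> = 15 * K\<^sup>2 * \<phi> s" by simp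
    also have "\<dots> \<le> \<Lambda> * \<phi> s" unfolding \<Lambda>_def using K_ge_1 \<phi>(2) by (intro mult_right_mono) auto
    finally show ?thesis .
  qed
  have "0 \<le> K * (?m 0 T + (?m 0 T)\<^sup>2)" using K_ge_1 by (intro mult_nonneg_nonneg add_nonneg_nonneg) auto
  with K2 have \<Lambda>: "1 \<le> \<Lambda>" "2 + K * (?m 0 T + (?m 0 T)\<^sup>2) \<le> \<Lambda>" unfolding \<Lambda>_def by linarith+
  have chain: "\<exists>n u. is_partition 0 t n u \<and> u ` {..n} \<subseteq> {0..T} \<and> (\<forall>i<n. \<phi> (u (Suc i)) \<le> \<Lambda> * \<phi> (u i))"
    if t: "t \<in> {0..T}" for t
  proof -
    have r2: "0 < r / 2" using r by simp
    have mesh: "has_mesh_limit (Xi X XX Y) (incr Y s t) s t" "has_mesh_limit (Xi X' XX' Y') (incr Y' s t) s t"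
      if "0 \<le> s" "s \<le> t" "t \<le> T" for s t using sol that by (auto simp: solves_def)
    obtain \<delta>1 where \<delta>1: "0 < \<delta>1" "\<And>u v. 0 \<le> u \<Longrightarrow> u < v \<Longrightarrow> v \<le> T \<Longrightarrow> v - u < \<delta>1 \<Longrightarrow> norm (incr Y u v - Xi X XX Y u v) \<le> r / 2"
      using mesh_limit_uniform[OF mesh(1) T r2] by metis
    obtain \<delta>2 where \<delta>2: "0 < \<delta>2" "\<And>u v. 0 \<le> u \<Longrightarrow> u < v \<Longrightarrow> v \<le> T \<Longrightarrow> v - u < \<delta>2 \<Longrightarrow> norm (incr Y' u v - Xi X' XX' Y' u v) \<le> r / 2"
      using mesh_limit_uniform[OF mesh(2) T r2] by metis
    obtain n u where u: "is_partition 0 t n u" "\<forall>i<n. u (Suc i) - u i < min \<delta>1 \<delta>2"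
      using fine_partition_exists[of 0 t "min \<delta>1 \<delta>2"] t \<delta>1 \<delta>2 by auto
    have rng: "u i \<in> {0..T}" if "i \<le> n" for i using is_partition_range[OF u(1) that] t by simp
    have "\<phi> (u (Suc i)) \<le> \<Lambda> * \<phi> (u i)" if i: "i < n" for i
    proof -
      define a where "a = u i"
      define b where "b = u (Suc i)"
      have ab: "0 \<le> a" "a < b" "b \<le> T" "a \<in> {0..T}" "b \<in> {0..T}" "a \<le> b" "b - a < \<delta>1" "b - a < \<delta>2"
        using rng[of i] rng[of "Suc i"] i u by (auto simp: a_def b_def is_partition_def)
      have m: "?m a b \<le> ?m 0 T" using rough_on_le[OF rough(1)] ab T p by (intro modulus_mono) auto
      have m2: "(?m a b)\<^sup>2 \<le> (?m 0 T)\<^sup>2" by (rule power_mono[OF m]) simp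
      note X = order_trans[OF rough_on_first[OF rough(1) ab(4,5,6)] m] order_trans[OF rough_on_second[OF rough(1) ab(4,5,6)] m2]
      have "norm (Xi X XX Y a b - Xi X' XX' Y' a b) \<le> K * (norm (incr X a b) + norm (XX a b)) * norm (Y a - Y' a)
          + K * (norm (incr X a b - incr X' a b) + norm (XX a b - XX' a b))" by (rule Xi_diff_bound)
      also have "\<dots> \<le> K * (?m 0 T + (?m 0 T)\<^sup>2) * norm (Y a - Y' a) + K * (r * ?m 0 T + r * (?m 0 T)\<^sup>2)"
        using K_ge_1 r
        by (intro add_mono mult_mono X order_trans[OF dX(1)[OF ab(1,6,3)]] order_trans[OF dX(2)[OF ab(1,6,3)]]
            mult_nonneg_nonneg m m2 order_refl add_nonneg_nonneg) auto
      also have "\<dots> = K * (?m 0 T + (?m 0 T)\<^sup>2) * \<phi> a" by (simp add: \<phi>_def algebra_simps)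
      finally have Xi: "norm (Xi X XX Y a b - Xi X' XX' Y' a b) \<le> K * (?m 0 T + (?m 0 T)\<^sup>2) * \<phi> a" .
      have "norm (Y b - Y' b) = norm ((Y a - Y' a) + (Xi X XX Y a b - Xi X' XX' Y' a b) +
          ((incr Y a b - Xi X XX Y a b) - (incr Y' a b - Xi X' XX' Y' a b)))" by (simp add: incr_def)
      also have "\<dots> \<le> norm (Y a - Y' a) + K * (?m 0 T + (?m 0 T)\<^sup>2) * \<phi> a + (r / 2 + r / 2)"
        by (intro norm_triangle_mono Xi order_refl order_trans[OF norm_triangle_ineq4
            add_mono[OF \<delta>1(2)[OF ab(1,2,3,7)] \<delta>2(2)[OF ab(1,2,3,8)]]])
      finally have "norm (Y b - Y' b) \<le> norm (Y a - Y' a) + K * (?m 0 T + (?m 0 T)\<^sup>2) * \<phi> a + (r / 2 + r / 2)" .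
      moreover have "\<phi> b = norm (Y b - Y' b) + r" "norm (Y a - Y' a) = \<phi> a - r" by (simp_all add: \<phi>_def)
      ultimately have "\<phi> b \<le> \<phi> a + K * (?m 0 T + (?m 0 T)\<^sup>2) * \<phi> a + r" by linarith
      also have "\<dots> \<le> \<phi> a + K * (?m 0 T + (?m 0 T)\<^sup>2) * \<phi> a + \<phi> a" using \<phi> by simp
      also have "\<dots> = (2 + K * (?m 0 T + (?m 0 T)\<^sup>2)) * \<phi> a" by (simp add: algebra_simps)
      also have "\<dots> \<le> \<Lambda> * \<phi> a" using \<Lambda>(2) \<phi>(2) by (intro mult_right_mono)
      finally show ?thesis by (simp add: a_def b_def)
    qed
    then show ?thesis using u rng by (intro exI[of _ n] exI[of _ u]) auto
  qed
  have mono: "mono_on {0..T} g" using rough(1) by (simp add: rough_on_def)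
  have glob: "\<phi> t \<le> \<Lambda> ^ (2 * N + 1) * (2 * r)" if t: "t \<in> {0..T}" for t
  proof -
    have "g t \<le> g T" using rough_on_le[OF rough(1)] t by auto
    then have "\<phi> t \<le> \<Lambda> ^ (2 * N + 1) * \<phi> 0"
      using N[folded \<kappa>_def] t T by (intro level_growth[where \<kappa> = \<kappa>, OF mono \<Lambda>(1) \<phi>(2) _ _ loc chain]) auto
    also have "\<dots> \<le> \<Lambda> ^ (2 * N + 1) * (2 * r)" using r \<Lambda> by (intro mult_left_mono) (auto simp: \<phi>_def)
    finally show ?thesis .
  qed
  define B where "B = \<Lambda> ^ (2 * N + 1) * (2 * r)"
  have B: "0 \<le> B" using r \<Lambda> by (simp add: B_def)
  have le_B: "norm (Y t - Y' t) \<le> B" if "t \<in> {0..T}" for t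
    using order_trans[OF \<phi>(3) glob[OF that]] by (simp only: B_def)
  show "norm (Y t - Y' t) \<le> \<Lambda> ^ (2 * N + 1) * (2 * r)" if "0 \<le> s" "s \<le> t" "t \<le> T" for s t
    using glob[of t] \<phi>(3)[of t] that by auto
  show "norm (incr Y s t - incr Y' s t) \<le> (14 * K\<^sup>2 + 4 / \<epsilon>) * \<Lambda> ^ (2 * N + 1) * (2 * r) * ?m s t"
    if st: "0 \<le> s" "s \<le> t" "t \<le> T" for s t
  proof -
    have "norm (incr Y s t - incr Y' s t) \<le> (14 * K\<^sup>2 + 4 / \<epsilon>) * B * ?m s t"
    proof (cases "g t - g s \<le> \<kappa>")
      case True
      have "norm (incr Y s t - incr Y' s t) \<le> 14 * K\<^sup>2 * \<phi> s * ?m s t" by (rule local[OF st True])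
      also have "\<dots> \<le> (14 * K\<^sup>2 + 4 / \<epsilon>) * B * ?m s t"
        using glob[of s] st \<phi>(2) K_ge_1 eps B by (intro mult_right_mono mult_mono) (auto simp: B_def)
      finally show ?thesis .
    next
      case False
      have "\<epsilon> / 2 \<le> ?m s t"
      proof -
        have "(2 :: real) powr (1 / p) \<le> 2 powr 1" using p by (intro powr_mono) auto
        then have "\<epsilon> / 2 \<le> \<epsilon> / 2 powr (1 / p)" using eps by (intro divide_left_mono) auto
        also have "\<dots> = \<kappa> powr (1 / p)" using p eps by (simp add: \<kappa>_def powr_divide powr_powr)
        also have "\<dots> \<le> ?m s t" unfolding modulus_def using False \<kappa> p by (intro powr_mono2) auto
        finally show ?thesis .
      qed
      then have m: "1 \<le> 2 / \<epsilon> * ?m s t" using eps by (simp add: field_simps)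
      have "incr Y s t - incr Y' s t = (Y t - Y' t) - (Y s - Y' s)" by (simp add: incr_def)
      also have "norm \<dots> \<le> B + B"
        using st by (intro order_trans[OF norm_triangle_ineq4 add_mono[OF le_B le_B]]) auto
      also have "\<dots> = 2 * B * 1" by simp
      also have "\<dots> \<le> 2 * B * (2 / \<epsilon> * ?m s t)" using B m by (intro mult_left_mono) auto
      also have "\<dots> = 4 / \<epsilon> * B * ?m s t" by simp
      also have "\<dots> \<le> (14 * K\<^sup>2 + 4 / \<epsilon>) * B * ?m s t" using B by (intro mult_right_mono) auto
      finally show ?thesis .
    qed
    then show ?thesis by (simp add: B_def mult.assoc)
  qed
qed

end

section \<open>Controls of rough paths\<close>

lemma var_norm_powr:
  assumes "0 < q" "0 \<le> Sup (var_sums q T \<Xi>)"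
  shows "var_norm q T \<Xi> powr q = Sup (var_sums q T \<Xi>)" "0 \<le> var_norm q T \<Xi>"
  using assms by (simp_all add: var_norm_def powr_powr)

definition is_control :: "real \<Rightarrow> real \<Rightarrow> (real \<Rightarrow> real \<Rightarrow> 'a::real_normed_vector) \<Rightarrow> (real \<Rightarrow> real) \<Rightarrow> bool" where
  "is_control q T \<Xi> g \<longleftrightarrow> mono_on {0..T} g \<and>
     (\<forall>s t. 0 \<le> s \<and> s < t \<and> t \<le> T \<longrightarrow> norm (\<Xi> s t) powr q \<le> g t - g s)"

lemma is_controlD:
  assumes "is_control q T \<Xi> g" "0 \<le> s" "s < t" "t \<le> T"
  shows "norm (\<Xi> s t) powr q \<le> g t - g s"
  using assms by (simp add: is_control_def)

lemma finite_var_imp_control: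
  assumes q: "0 < q" and T: "0 < T" and fv: "finite_var q T \<Xi>"
  obtains g where "is_control q T \<Xi> g" "g T - g 0 = var_norm q T \<Xi> powr q" "0 \<le> var_norm q T \<Xi>"
proof (rule finite_var_increasing_control[OF fv less_imp_le[OF T]])
  fix g assume g: "g 0 = 0" "g T = Sup (var_sums q T \<Xi>)"
    "\<And>s t. 0 \<le> s \<Longrightarrow> s < t \<Longrightarrow> t \<le> T \<Longrightarrow> norm (\<Xi> s t) powr q \<le> g t - g s"
  have "mono_on {0..T} g"
  proof (rule mono_onI)
    fix s t assume "s \<in> {0..T}" "t \<in> {0..T}" "s \<le> t"
    then show "g s \<le> g t" using order_trans[OF powr_ge_zero g(3)[of s t]] by (cases "s = t") auto
  qed
  then have ctrl: "is_control q T \<Xi> g" using g(3) by (simp add: is_control_def)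
  have "0 \<le> Sup (var_sums q T \<Xi>)" by (rule control_imp_finite_var(2)[OF T g(3)])
  note norm = var_norm_powr[OF q this]
  show thesis by (rule that[OF ctrl _ norm(2)]) (simp add: g norm)
qed

lemma le_powr_inverse:
  fixes x q y :: real
  assumes "x powr q \<le> y" "0 < q" "0 \<le> x"
  shows "x \<le> y powr (1 / q)"
proof -
  have "x = (x powr q) powr (1 / q)" using assms by (simp add: powr_powr)
  also have "\<dots> \<le> y powr (1 / q)" using assms by (intro powr_mono2) auto
  finally show ?thesis .
qed

lemma rough_path_control:
  assumes p: "0 < p" and T: "0 < T" and X: "rough_path p T X XX"
  obtains g where "rough_on {0..T} p g X XX"
    "g T - g 0 = var_norm p T (incr X) powr p + var_norm (p / 2) T XX powr (p / 2)"
    "0 \<le> var_norm p T (incr X)" "0 \<le> var_norm (p / 2) T XX"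
proof -
  have fv: "finite_var p T (incr X)" "finite_var (p / 2) T XX"
    and chen: "\<And>s u t. 0 \<le> s \<Longrightarrow> s \<le> u \<Longrightarrow> u \<le> t \<Longrightarrow> t \<le> T \<Longrightarrow> XX s t = XX s u + XX u t + tensor (incr X s u) (incr X u t)"
    using X unfolding rough_path_def by blast+
  have p2: "0 < p / 2" using p by simp
  obtain g1 where g1: "is_control p T (incr X) g1" "g1 T - g1 0 = var_norm p T (incr X) powr p" "0 \<le> var_norm p T (incr X)"
    using finite_var_imp_control[OF p T fv(1)] .
  obtain g2 where g2: "is_control (p / 2) T XX g2" "g2 T - g2 0 = var_norm (p / 2) T XX powr (p / 2)" "0 \<le> var_norm (p / 2) T XX"
    using finite_var_imp_control[OF p2 T fv(2)] .
  have mono: "mono_on {0..T} g1" "mono_on {0..T} g2" using g1(1) g2(1) by (simp_all add: is_control_def)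
  define g where "g t = g1 t + g2 t" for t
  have "rough_on {0..T} p g X XX"
    unfolding rough_on_def
  proof (intro conjI ballI impI)
    show "mono_on {0..T} g"
      using mono by (auto simp: g_def mono_on_def intro!: add_mono)
    show "XX s t = XX s u + XX u t + tensor (incr X s u) (incr X u t)"
      if "s \<in> {0..T}" "u \<in> {0..T}" "t \<in> {0..T}" "s \<le> u" "u \<le> t" for s u t
      using that by (intro chen) auto
    fix s t assume st: "s \<in> {0..T}" "t \<in> {0..T}" "s \<le> t"
    have g: "g1 s \<le> g1 t" "g2 s \<le> g2 t" using mono st by (auto simp: mono_on_def)
    show "norm (incr X s t) \<le> modulus p g s t"
    proof (cases "s = t")
      case False
      have "norm (incr X s t) powr p \<le> g t - g s" using is_controlD[OF g1(1), of s t] g st False by (simp add: g_def)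
      then show ?thesis unfolding modulus_def using p by (intro le_powr_inverse) auto
    qed simp
    show "norm (XX s t) \<le> (modulus p g s t)\<^sup>2"
    proof (cases "s = t")
      case True
      have "XX s s = XX s s + XX s s + tensor (incr X s s) (incr X s s)" using st by (intro chen) auto
      then have "XX s s = 0" by (simp add: tensor_def vec_eq_iff)
      then show ?thesis using True by simp
    next
      case False
      have "norm (XX s t) powr (p / 2) \<le> g t - g s" using is_controlD[OF g2(1), of s t] g st False by (simp add: g_def)
      then have "norm (XX s t) \<le> (g t - g s) powr (1 / (p / 2))" using p by (intro le_powr_inverse) auto
      then show ?thesis using p by (simp add: modulus_power)
    qed
  qed
  then show thesis using that[of g] g1 g2 by (simp add: g_def)
qed

text \<open>Together with \<open>finite_var_imp_control\<close> this translates between variation norms and pointwise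
  bounds by a modulus.\<close>

lemma finite_var_of_modulus_bound:
  assumes T: "0 < T" and p: "0 < p" and q: "0 < q" and A: "0 \<le> A" and mono: "mono_on {0..T} g"
    and b: "\<And>s t. 0 \<le> s \<Longrightarrow> s < t \<Longrightarrow> t \<le> T \<Longrightarrow> norm (\<Xi> s t) \<le> A * (g t - g s) powr (1 / q)"
  shows "finite_var q T \<Xi>" "var_norm q T \<Xi> \<le> A * (g T - g 0) powr (1 / q)" "0 \<le> var_norm q T \<Xi>"
proof -
  have gd: "0 \<le> g t - g s" if "0 \<le> s" "s \<le> t" "t \<le> T" for s t using mono that by (auto simp: mono_on_def)
  have ctrl: "norm (\<Xi> s t) powr q \<le> A powr q * g t - A powr q * g s" if "0 \<le> s" "s < t" "t \<le> T" for s t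
  proof -
    have "norm (\<Xi> s t) powr q \<le> (A * (g t - g s) powr (1 / q)) powr q"
      using b[OF that] q by (intro powr_mono2) auto
    also have "\<dots> = A powr q * (g t - g s)"
      using A q gd[of s t] that by (simp add: powr_mult powr_powr)
    finally show ?thesis by (simp add: algebra_simps)
  qed
  note * = control_imp_finite_var[where g = "\<lambda>t. A powr q * g t", OF T ctrl]
  show "finite_var q T \<Xi>" by (rule *(1))
  have "var_norm q T \<Xi> \<le> (A powr q * (g T - g 0)) powr (1 / q)"
    unfolding var_norm_def using *(2,3) q by (intro powr_mono2) (auto simp: algebra_simps)
  also have "\<dots> = A * (g T - g 0) powr (1 / q)"
    using A q gd[of 0 T] T by (simp add: powr_mult powr_powr)
  finally show "var_norm q T \<Xi> \<le> A * (g T - g 0) powr (1 / q)" .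
  show "0 \<le> var_norm q T \<Xi>" by (simp add: var_norm_def)
qed

context rough_field
begin

text \<open>Small enough for the halving arguments of \<open>remainder_step\<close> and \<open>difference_step\<close> alike.\<close>

definition step_size :: "real \<Rightarrow> real" where
  "step_size p = 1 / (62 * sew_const p * K\<^sup>2)"

lemma step_size:
  assumes "0 < p" "p < 3"
  shows "0 < step_size p" "step_size p \<le> 1" "62 * sew_const p * K\<^sup>2 * step_size p \<le> 1"
    "4 * sew_const p * K\<^sup>2 * step_size p \<le> 1"
proof -
  have c: "1 \<le> sew_const p" by (rule sew_const_props(1)[OF assms])
  have "1 \<le> K\<^sup>2" using K_ge_1 by (simp add: one_le_power)
  then have "1 * 1 \<le> sew_const p * K\<^sup>2" using c by (intro mult_mono) auto
  then show "0 < step_size p" "step_size p \<le> 1" "62 * sew_const p * K\<^sup>2 * step_size p \<le> 1"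
    "4 * sew_const p * K\<^sup>2 * step_size p \<le> 1"
    by (auto simp: step_size_def field_simps)
qed

text \<open>Equal drivers and equal initial values are at distance at most \<open>r\<close> for every \<open>r > 0\<close>.\<close>

lemma solves_unique:
  assumes p: "0 < p" "p < 3" "1 \<le> p" and T: "0 < T" and X: "rough_path p T X XX"
    and sol: "solves p T X XX Y" "solves p T X XX Z" "Y 0 = Z 0" and t: "0 \<le> t" "t \<le> T"
  shows "Y t = Z t"
proof -
  obtain g where g: "rough_on {0..T} p g X XX" using rough_path_control[OF p(1) T X] .
  define \<epsilon> where "\<epsilon> = step_size p"
  note eps = step_size[OF p(1,2), folded \<epsilon>_def]
  obtain N where N: "(g T - g 0) / (\<epsilon> powr p / 2) < real N" using reals_Archimedean2 by blast
  have N': "g T - g 0 < real (Suc N) * (\<epsilon> powr p / 2)"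
  proof -
    have "g T - g 0 < real N * (\<epsilon> powr p / 2)" using N eps(1) by (simp add: pos_divide_less_eq)
    also have "\<dots> \<le> real (Suc N) * (\<epsilon> powr p / 2)" by (intro mult_right_mono) auto
    finally show ?thesis .
  qed
  define B where "B = 2 * (15 * K\<^sup>2 + K * (modulus p g 0 T + (modulus p g 0 T)\<^sup>2)) ^ (2 * N + 1)"
  have "norm (Y t - Z t) \<le> B * r" if "0 < r" for r
    using stability(1)[OF p less_imp_le[OF T] g g sol(1,2) eps(1-3) that _ _ _ N' order_refl t] sol(3) that
    by (simp add: B_def mult_ac)
  then have le: "norm (Y t - Z t) \<le> B * r" if "0 < r" for r using that .
  have "norm (Y t - Z t) \<le> 0"
  proof (rule tendsto_lowerbound)
    show "((\<lambda>r. B * r) \<longlongrightarrow> 0) (at_right 0)" by (rule tendsto_eq_intros refl | simp)+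
    show "\<forall>\<^sub>F r in at_right 0. norm (Y t - Z t) \<le> B * r"
      using le by (auto simp: eventually_at_right_field intro: exI[of _ 1])
  qed simp
  then show ?thesis by simp
qed


text \<open>The control must dominate the differences of the drivers divided by \<open>r\<close> as well; these
  normalised differences have variation at most one, so the total control is at most
  \<open>6 (1 \<or> L)\<^sup>p\<close>, whatever \<open>r\<close> is. Taking \<open>r\<close> slightly larger than the distance of the data keeps it
  positive; at the end it decreases to that distance.\<close>

lemma global_lipschitz:
  assumes p: "2 \<le> p" "p < 3" and T: "0 < T"
    and X: "rough_path p T X XX" "rough_path p T X' XX'"
    and L: "0 < L" "rough_norm p T X XX < L" "rough_norm p T X' XX' < L"
    and sol: "solves p T X XX Y" "solves p T X' XX' Y'"
  defines "\<kappa> \<equiv> step_size p powr p / 2" and "l \<equiv> max 1 L"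
  defines "C0 \<equiv> 12 * (14 * K\<^sup>2 + 4 / step_size p) * (57 * K\<^sup>2)" and "N \<equiv> nat \<lfloor>6 * l powr p / \<kappa>\<rfloor>"
  shows "var_norm p T (incr (\<lambda>t. Y t - Y' t)) \<le> (C0 * l) ^ (4 * N + 3) * (rough_dist p T X XX X' XX' + norm (Y 0 - Y' 0))"
proof -
  have p': "0 < p" "p < 3" "1 \<le> p" "0 < p / 2" "p / 2 \<le> p" using p by auto
  define \<epsilon> where "\<epsilon> = step_size p"
  note eps = step_size[OF p'(1,2), folded \<epsilon>_def]
  have \<kappa>: "0 < \<kappa>" using eps by (simp add: \<kappa>_def \<epsilon>_def)
  have l: "1 \<le> l" "L \<le> l" by (auto simp: l_def)
  define V where "V = 14 * K\<^sup>2 + 4 / \<epsilon>"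
  have K2: "1 \<le> K\<^sup>2" using K_ge_1 by (simp add: one_le_power)
  have V: "1 \<le> V" using K2 eps by (simp add: V_def add_increasing2)
  obtain g1 where g1: "rough_on {0..T} p g1 X XX"
    "g1 T - g1 0 = var_norm p T (incr X) powr p + var_norm (p / 2) T XX powr (p / 2)"
    "0 \<le> var_norm p T (incr X)" "0 \<le> var_norm (p / 2) T XX"
    using rough_path_control[OF p'(1) T X(1)] .
  obtain g2 where g2: "rough_on {0..T} p g2 X' XX'"
    "g2 T - g2 0 = var_norm p T (incr X') powr p + var_norm (p / 2) T XX' powr (p / 2)"
    "0 \<le> var_norm p T (incr X')" "0 \<le> var_norm (p / 2) T XX'"
    using rough_path_control[OF p'(1) T X(2)] .
  define DX where "DX = incr (\<lambda>t. X t - X' t)"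
  define DXX where "DXX s t = XX s t - XX' s t" for s t
  have DX: "DX s t = incr X s t - incr X' s t" for s t by (simp add: DX_def incr_def)
  have mono12: "mono_on {0..T} (\<lambda>t. g1 t + g2 t)"
    using g1(1) g2(1) by (auto simp: rough_on_def mono_on_def intro!: add_mono)
  have fvD: "finite_var p T DX" "finite_var (p / 2) T DXX"
  proof -
    have r12: "rough_on {0..T} p (\<lambda>t. g1 t + g2 t) X XX" "rough_on {0..T} p (\<lambda>t. g1 t + g2 t) X' XX'"
      using rough_on_le[OF g1(1)] rough_on_le[OF g2(1)]
      by (auto intro!: rough_on_control_mono[OF g1(1) p'(1)] rough_on_control_mono[OF g2(1) p'(1)])
    have b: "norm (DX s t) \<le> 2 * modulus p (\<lambda>t. g1 t + g2 t) s t"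
      and b2: "norm (DXX s t) \<le> 2 * (modulus p (\<lambda>t. g1 t + g2 t) s t)\<^sup>2" if st: "0 \<le> s" "s < t" "t \<le> T" for s t
    proof -
      have J: "s \<in> {0..T}" "t \<in> {0..T}" "s \<le> t" using st by auto
      show "norm (DX s t) \<le> 2 * modulus p (\<lambda>t. g1 t + g2 t) s t"
        using norm_triangle_ineq4[of "incr X s t" "incr X' s t"] rough_on_first[OF r12(1) J] rough_on_first[OF r12(2) J]
        unfolding DX by linarith
      show "norm (DXX s t) \<le> 2 * (modulus p (\<lambda>t. g1 t + g2 t) s t)\<^sup>2"
        using norm_triangle_ineq4[of "XX s t" "XX' s t"] rough_on_second[OF r12(1) J] rough_on_second[OF r12(2) J]
        unfolding DXX_def by linarith
    qed
    show "finite_var p T DX"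
      using b by (intro finite_var_of_modulus_bound(1)[where A = 2, OF T p'(1) p'(1) _ mono12]) (auto simp: modulus_def)
    show "finite_var (p / 2) T DXX"
      using b2 p' by (intro finite_var_of_modulus_bound(1)[where A = 2, OF T p'(1) p'(4) _ mono12]) (auto simp: modulus_power)
  qed
  obtain g3 where g3: "is_control p T DX g3" "g3 T - g3 0 = var_norm p T DX powr p" "0 \<le> var_norm p T DX"
    using finite_var_imp_control[OF p'(1) T fvD(1)] .
  obtain g4 where g4: "is_control (p / 2) T DXX g4" "g4 T - g4 0 = var_norm (p / 2) T DXX powr (p / 2)" "0 \<le> var_norm (p / 2) T DXX"
    using finite_var_imp_control[OF p'(4) T fvD(2)] .
  define \<rho> where "\<rho> = rough_dist p T X XX X' XX'"
  have \<rho>: "\<rho> = var_norm p T DX + var_norm (p / 2) T DXX" by (simp add: \<rho>_def rough_dist_def DX_def DXX_def[abs_def])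
  have main: "var_norm p T (incr (\<lambda>t. Y t - Y' t)) \<le> (C0 * l) ^ (4 * N + 3) * r"
    if r: "\<rho> + norm (Y 0 - Y' 0) < r" for r
  proof -
    have r0: "0 < r" "norm (Y 0 - Y' 0) \<le> r" "var_norm p T DX \<le> r" "var_norm (p / 2) T DXX \<le> r"
      using r g3(3) g4(3) norm_ge_zero[of "Y 0 - Y' 0"] unfolding \<rho> by linarith+
    \<comment> \<open>The differences of the drivers, divided by r, contribute at most 2 to the control.\<close>
    define g where "g t = g1 t + g2 t + (g3 t / r powr p + g4 t / r powr (p / 2))" for t
    have mono: "mono_on {0..T} g3" "mono_on {0..T} g4" using g3(1) g4(1) by (simp_all add: is_control_def)
    have le: "g1 s \<le> g1 t" "g2 s \<le> g2 t" "g3 s / r powr p \<le> g3 t / r powr p" "g4 s / r powr (p / 2) \<le> g4 t / r powr (p / 2)"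
      if "s \<in> {0..T}" "t \<in> {0..T}" "s \<le> t" for s t
      using rough_on_le[OF g1(1) that] rough_on_le[OF g2(1) that] mono that by (auto simp: mono_on_def intro!: divide_right_mono)
    have "g1 t - g1 s \<le> g t - g s" "g2 t - g2 s \<le> g t - g s" if "s \<in> {0..T}" "t \<in> {0..T}" "s \<le> t" for s t
      unfolding g_def using le[OF that] by linarith+
    then have rough: "rough_on {0..T} p g X XX" "rough_on {0..T} p g X' XX'"
      by (auto intro!: rough_on_control_mono[OF g1(1) p'(1)] rough_on_control_mono[OF g2(1) p'(1)])
    have dX: "norm (incr X s t - incr X' s t) \<le> r * modulus p g s t" if st: "0 \<le> s" "s \<le> t" "t \<le> T" for s t
    proof (cases "s = t")
      case False
      have "norm (DX s t) powr p / r powr p \<le> g t - g s"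
        using is_controlD[OF g3(1), of s t] st False le[of s t] divide_right_mono[of "norm (DX s t) powr p" "g3 t - g3 s" "r powr p"]
        by (simp add: g_def diff_divide_distrib)
      then have "(norm (DX s t) / r) powr p \<le> g t - g s" using r0 by (simp add: powr_divide)
      then have "norm (DX s t) / r \<le> modulus p g s t"
        unfolding modulus_def using p' r0 by (intro le_powr_inverse) auto
      then show ?thesis using r0 by (simp add: DX field_simps)
    qed (use r0 in simp)
    have dXX: "norm (XX s t - XX' s t) \<le> r * (modulus p g s t)\<^sup>2" if st: "0 \<le> s" "s \<le> t" "t \<le> T" for s t
    proof (cases "s = t")
      case True
      then show ?thesis using rough_on_diag[OF rough(1), of s] rough_on_diag[OF rough(2), of s] st r0 by simp
    next
      case False
      have "norm (DXX s t) powr (p / 2) / r powr (p / 2) \<le> g t - g s"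
        using is_controlD[OF g4(1), of s t] st False le[of s t] divide_right_mono[of "norm (DXX s t) powr (p / 2)" "g4 t - g4 s" "r powr (p / 2)"]
        by (simp add: g_def diff_divide_distrib)
      then have "(norm (DXX s t) / r) powr (p / 2) \<le> g t - g s" using r0 by (simp add: powr_divide)
      then have "norm (DXX s t) / r \<le> (g t - g s) powr (1 / (p / 2))"
        using p' r0 by (intro le_powr_inverse) auto
      then have "norm (DXX s t) / r \<le> (modulus p g s t)\<^sup>2" using p' by (simp add: modulus_power)
      then show ?thesis using r0 by (simp add: DXX_def field_simps)
    qed
    have W: "g T - g 0 \<le> 6 * l powr p"
    proof -
      have "var_norm p T (incr X) powr p \<le> l powr p" "var_norm p T (incr X') powr p \<le> l powr p"
        using g1 g2 L l p' by (auto intro!: powr_mono2 simp: rough_norm_def)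
      moreover have "var_norm (p / 2) T XX powr (p / 2) \<le> l powr p" "var_norm (p / 2) T XX' powr (p / 2) \<le> l powr p"
      proof -
        have "var_norm (p / 2) T XX powr (p / 2) \<le> l powr (p / 2)" "var_norm (p / 2) T XX' powr (p / 2) \<le> l powr (p / 2)"
          using g1 g2 L l p' by (auto intro!: powr_mono2 simp: rough_norm_def)
        moreover have "l powr (p / 2) \<le> l powr p" using l p' by (intro powr_mono) auto
        ultimately show "var_norm (p / 2) T XX powr (p / 2) \<le> l powr p" "var_norm (p / 2) T XX' powr (p / 2) \<le> l powr p" by auto
      qed
      moreover have "(g3 T - g3 0) / r powr p \<le> 1"
        unfolding g3(2) using g3(3) r0 p' by (simp add: powr_mono2)
      moreover have "(g4 T - g4 0) / r powr (p / 2) \<le> 1"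
        unfolding g4(2) using g4(3) r0 p' by (simp add: powr_mono2)
      moreover have "1 \<le> l powr p" using l p' by (intro ge_one_powr_ge_zero) auto
      moreover have "g T - g 0 = (g1 T - g1 0) + (g2 T - g2 0) + (g3 T - g3 0) / r powr p + (g4 T - g4 0) / r powr (p / 2)"
        by (simp add: g_def diff_divide_distrib)
      ultimately show ?thesis unfolding g1(2) g2(2) by linarith
    qed
    have N: "g T - g 0 < real (Suc N) * (\<epsilon> powr p / 2)"
    proof -
      have "6 * l powr p / \<kappa> < real (Suc N)" unfolding N_def by linarith
      then have "6 * l powr p < real (Suc N) * \<kappa>" using \<kappa> by (simp add: pos_divide_less_eq)
      then show ?thesis using W by (simp add: \<kappa>_def \<epsilon>_def)
    qed
    define m where "m = modulus p g 0 T"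
    have m: "0 \<le> m" "m \<le> 6 * l"
    proof -
      have gle: "g 0 \<le> g T" using rough_on_le[OF rough(1)] T by auto
      have "m \<le> (6 * l powr p) powr (1 / p)" unfolding m_def modulus_def using W gle p' by (intro powr_mono2) auto
      also have "\<dots> = 6 powr (1 / p) * l" using l p' by (simp add: powr_mult powr_powr)
      also have "6 powr (1 / p) \<le> (6::real) powr 1" using p' by (intro powr_mono) auto
      finally show "m \<le> 6 * l" using l by (simp add: mult_right_mono)
    qed (simp add: m_def)
    define \<Lambda> where "\<Lambda> = 15 * K\<^sup>2 + K * (m + m\<^sup>2)"
    have \<Lambda>: "0 \<le> \<Lambda>" "\<Lambda> \<le> (57 * K\<^sup>2 * l)\<^sup>2"
    proof -
      show "0 \<le> \<Lambda>" using m K_ge_1 by (simp add: \<Lambda>_def)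
      have ll: "1 \<le> l\<^sup>2" "l \<le> l\<^sup>2" using l by (auto simp: power2_eq_square mult_le_cancel_right1 intro: order_trans[OF l(1)])
      have "m\<^sup>2 \<le> (6 * l)\<^sup>2" using m by (intro power_mono)
      then have "m + m\<^sup>2 \<le> 42 * l\<^sup>2" using m ll by (simp add: power_mult_distrib)
      moreover have KK: "K \<le> K\<^sup>2" using K_ge_1 by (simp add: power2_eq_square mult_le_cancel_right1)
      ultimately have "K * (m + m\<^sup>2) \<le> K\<^sup>2 * (42 * l\<^sup>2)" using m K_ge_1 by (intro mult_mono) auto
      moreover have "15 * K\<^sup>2 * 1 \<le> 15 * K\<^sup>2 * l\<^sup>2" using ll K2 by (intro mult_left_mono) auto
      ultimately have "\<Lambda> \<le> 57 * (K\<^sup>2 * l\<^sup>2)" unfolding \<Lambda>_def by linarith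
      also have "57 * (K\<^sup>2 * l\<^sup>2) \<le> (57 * 57 * K\<^sup>2) * (K\<^sup>2 * l\<^sup>2)" using K2 by (intro mult_right_mono) auto
      finally show "\<Lambda> \<le> (57 * K\<^sup>2 * l)\<^sup>2" by (simp add: power2_eq_square mult_ac)
    qed
    have "norm (incr (\<lambda>t. Y t - Y' t) s t) \<le> V * \<Lambda> ^ (2 * N + 1) * (2 * r) * (g t - g s) powr (1 / p)"
      if st: "0 \<le> s" "s < t" "t \<le> T" for s t
      using stability(2)[OF p'(1-3) less_imp_le[OF T] rough sol eps(1-3) r0(1,2) dX dXX N st(1) less_imp_le[OF st(2)] st(3)]
      by (simp add: V_def \<Lambda>_def m_def modulus_def incr_def algebra_simps)
    moreover have "mono_on {0..T} g" using rough by (simp add: rough_on_def)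
    ultimately have "var_norm p T (incr (\<lambda>t. Y t - Y' t)) \<le> V * \<Lambda> ^ (2 * N + 1) * (2 * r) * (g T - g 0) powr (1 / p)"
      using V \<Lambda> r0 by (intro finite_var_of_modulus_bound(2)[OF T p'(1) p'(1)]) auto
    also have "(g T - g 0) powr (1 / p) = m" by (simp add: m_def modulus_def)
    also have "V * \<Lambda> ^ (2 * N + 1) * (2 * r) * m \<le> V * ((57 * K\<^sup>2 * l)\<^sup>2) ^ (2 * N + 1) * (2 * r) * (6 * l)"
      using V \<Lambda> r0 m by (intro mult_mono mult_nonneg_nonneg power_mono) auto
    also have "\<dots> = (12 * V * l) * (57 * K\<^sup>2 * l) ^ (4 * N + 2) * r"
    proof -
      have "V * (D\<^sup>2) ^ (2 * N + 1) * (2 * r) * (6 * l) = (12 * V * l) * D ^ (4 * N + 2) * r" for D :: real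
        by (subst power_mult[symmetric]) (simp add: mult_ac)
      then show ?thesis .
    qed
    also have "\<dots> \<le> (C0 * l) * (C0 * l) ^ (4 * N + 2) * r"
    proof -
      have C0: "C0 = 12 * V * (57 * K\<^sup>2)" by (simp add: C0_def V_def \<epsilon>_def)
      have "12 * V * 1 \<le> 12 * V * (57 * K\<^sup>2)" using K2 V by (intro mult_left_mono) auto
      moreover have "1 * (57 * K\<^sup>2) \<le> (12 * V) * (57 * K\<^sup>2)" using V K2 by (intro mult_right_mono) auto
      ultimately have "12 * V \<le> C0" "57 * K\<^sup>2 \<le> C0" unfolding C0 by simp_all
      from this[THEN mult_right_mono, of l] have le: "12 * V * l \<le> C0 * l" "57 * K\<^sup>2 * l \<le> C0 * l" using l by simp_all
      have nn: "0 \<le> 12 * V * l" "0 \<le> 57 * K\<^sup>2 * l" using V l by auto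
      from le nn have C0l: "0 \<le> C0 * l" by linarith
      show ?thesis
        by (rule mult_right_mono[OF mult_mono[OF le(1) power_mono[OF le(2) nn(2)] C0l zero_le_power[OF nn(2)]] less_imp_le[OF r0(1)]])
    qed
    also have "\<dots> = (C0 * l) ^ (4 * N + 3) * r"
      by (simp add: numeral_3_eq_3)
    finally show ?thesis .
  qed
  have "var_norm p T (incr (\<lambda>t. Y t - Y' t)) \<le> (C0 * l) ^ (4 * N + 3) * (\<rho> + norm (Y 0 - Y' 0))"
  proof (rule tendsto_lowerbound)
    show "((\<lambda>r. (C0 * l) ^ (4 * N + 3) * r) \<longlongrightarrow> (C0 * l) ^ (4 * N + 3) * (\<rho> + norm (Y 0 - Y' 0))) (at_right (\<rho> + norm (Y 0 - Y' 0)))"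
      by (intro tendsto_intros)
    show "\<forall>\<^sub>F r in at_right (\<rho> + norm (Y 0 - Y' 0)). var_norm p T (incr (\<lambda>t. Y t - Y' t)) \<le> (C0 * l) ^ (4 * N + 3) * r"
      by (rule eventually_mono[OF eventually_at_right_less main])
  qed simp
  then show ?thesis by (simp add: \<rho>_def)
qed

text \<open>For \<open>L > 1\<close> the exponent \<open>4N + 3\<close> of \<open>global_lipschitz\<close> is at most a multiple of \<open>L\<^sup>p\<close>, hence at most \<open>M\<close>.
  For \<open>L \<le> 1\<close> it is bounded by a number that depends on \<open>p\<close> and \<open>F\<close> only, and the whole power is absorbed in \<open>C\<close>.\<close>

lemma lipschitz_constants:
  assumes p: "2 \<le> p" "p < 3"
  shows "\<exists>C>0. \<forall>L>0. \<exists>M::nat. real M \<le> C * L powr p + 1 \<and>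
            (\<forall>(T::real) (X :: real \<Rightarrow> real^'d) (XX :: real \<Rightarrow> real \<Rightarrow> real^'d^'d)
               (X' :: real \<Rightarrow> real^'d) (XX' :: real \<Rightarrow> real \<Rightarrow> real^'d^'d)
               (Y :: real \<Rightarrow> real^'e) (Y' :: real \<Rightarrow> real^'e).
               0 < T \<and> cadlag_rough_path p T X XX \<and> cadlag_rough_path p T X' XX' \<and>
               rough_norm p T X XX < L \<and> rough_norm p T X' XX' < L \<and>
               rde_solution p T F X XX (Y 0) Y \<and> rde_solution p T F X' XX' (Y' 0) Y' \<longrightarrow>
               var_norm p T (incr (\<lambda>t. Y t - Y' t))
                 \<le> (real M)\<^sup>2 * (C * max 1 L) ^ (M + 1) *
                   (rough_dist p T X XX X' XX' + norm (Y 0 - Y' 0)))"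
    (is "\<exists>C>0. \<forall>L>0. \<exists>M. _ \<and> ?estimate C L M")
proof -
  have p': "0 < p" "p < 3" using p by auto
  note eps = step_size[OF p']
  define \<kappa> where "\<kappa> = step_size p powr p / 2"
  have \<kappa>: "0 < \<kappa>" using eps by (simp add: \<kappa>_def)
  define C0 where "C0 = 12 * (14 * K\<^sup>2 + 4 / step_size p) * (57 * K\<^sup>2)"
  define C1 where "C1 = 24 / \<kappa> + 3"
  define n1 where "n1 = nat \<lceil>C1\<rceil>"
  define C where "C = C0 ^ n1 + C1 + C0"
  have K2: "1 \<le> K\<^sup>2" using K_ge_1 by (simp add: one_le_power)
  have C0: "1 \<le> C0"
  proof -
    have "0 \<le> 4 / step_size p" using eps by simp
    then have "1 \<le> 12 * (14 * K\<^sup>2 + 4 / step_size p)" unfolding ring_distribs using K2 by linarith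
    moreover have "1 \<le> 57 * K\<^sup>2" using K2 by linarith
    ultimately have "1 * 1 \<le> 12 * (14 * K\<^sup>2 + 4 / step_size p) * (57 * K\<^sup>2)" by (intro mult_mono) auto
    then show ?thesis by (simp add: C0_def)
  qed
  have C1: "3 \<le> C1" using \<kappa> by (simp add: C1_def)
  have C: "C0 \<le> C" "C1 \<le> C" "C0 ^ n1 \<le> C" "1 \<le> C"
    using C0 C1 one_le_power[OF C0, of n1] unfolding C_def by linarith+
  show ?thesis
  proof (intro exI[of _ C] conjI allI impI)
    show "0 < C" using C by simp
    fix L :: real assume L: "0 < L"
    define l where "l = max 1 L"
    have l: "1 \<le> l" by (simp add: l_def)
    define N where "N = nat \<lfloor>6 * l powr p / \<kappa>\<rfloor>"
    define M where "M = nat \<lfloor>C * L powr p\<rfloor> + 1"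
    have CL: "0 \<le> C * L powr p" using C by simp
    have M: "real M \<le> C * L powr p + 1" "C * L powr p \<le> real M" "1 \<le> M"
      using CL unfolding M_def by linarith+
    have NC: "real (4 * N + 3) \<le> C1 * l powr p"
    proof -
      have "real N \<le> 6 * l powr p / \<kappa>" using \<kappa> unfolding N_def by (simp add: of_nat_nat)
      moreover have "1 \<le> l powr p" using l p' by (intro ge_one_powr_ge_zero) auto
      ultimately have "real (4 * N + 3) \<le> 4 * (6 * l powr p / \<kappa>) + 3 * (l powr p)" by simp
      then show ?thesis by (simp add: C1_def algebra_simps)
    qed
    have key: "(C0 * l) ^ (4 * N + 3) \<le> (real M)\<^sup>2 * (C * l) ^ (M + 1)"
    proof -
      have Cl: "1 \<le> C * l" using C(4) l by (metis mult_mono' mult_1 zero_le_one)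
      have "(C0 * l) ^ (4 * N + 3) \<le> (C * l) ^ (M + 1)"
      proof (cases "L \<le> 1")
        case True
        then have l1: "l = 1" by (simp add: l_def)
        have "4 * N + 3 \<le> n1" using NC l1 unfolding n1_def by (simp add: nat_le_iff le_nat_iff) linarith
        then have "C0 ^ (4 * N + 3) \<le> C0 ^ n1" using C0 by (intro power_increasing) auto
        also have "\<dots> \<le> C" by (rule C(3))
        also have "\<dots> \<le> C ^ (M + 1)" using power_increasing[of 1 "M + 1" C] C by simp
        finally show ?thesis by (simp add: l1)
      next
        case False
        then have lL: "l = L" by (simp add: l_def)
        have "real (4 * N + 3) \<le> real M"
          using NC C(2) M(2) mult_right_mono[OF C(2), of "L powr p"] by (simp add: lL)
        then have "4 * N + 3 \<le> M + 1" by linarith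
        then have "(C * l) ^ (4 * N + 3) \<le> (C * l) ^ (M + 1)" using Cl by (rule power_increasing)
        moreover have "(C0 * l) ^ (4 * N + 3) \<le> (C * l) ^ (4 * N + 3)"
          using C C0 l by (intro power_mono mult_right_mono) auto
        ultimately show ?thesis by linarith
      qed
      also have "\<dots> = 1 * (C * l) ^ (M + 1)" by simp
      also have "\<dots> \<le> (real M)\<^sup>2 * (C * l) ^ (M + 1)"
        using M(3) Cl by (intro mult_right_mono one_le_power) auto
      finally show ?thesis .
    qed
    have "var_norm p T (incr (\<lambda>t. Y t - Y' t))
        \<le> (real M)\<^sup>2 * (C * max 1 L) ^ (M + 1) * (rough_dist p T X XX X' XX' + norm (Y 0 - Y' 0))"
      if *: "0 < T \<and> cadlag_rough_path p T X XX \<and> cadlag_rough_path p T X' XX' \<and>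
        rough_norm p T X XX < L \<and> rough_norm p T X' XX' < L \<and>
        rde_solution p T F X XX (Y 0) Y \<and> rde_solution p T F X' XX' (Y' 0) Y'"
      for T X XX X' XX' Y Y'
    proof -
      have h: "0 < T" "rough_path p T X XX" "rough_path p T X' XX'" "rough_norm p T X XX < L" "rough_norm p T X' XX' < L"
        "solves p T X XX Y" "solves p T X' XX' Y'"
        using * by (auto simp: cadlag_rough_path_def intro: solves_of_rde_solution)
      have "var_norm p T (incr (\<lambda>t. Y t - Y' t))
        \<le> (C0 * l) ^ (4 * N + 3) * (rough_dist p T X XX X' XX' + norm (Y 0 - Y' 0))"
        unfolding C0_def l_def N_def \<kappa>_def by (rule global_lipschitz[OF p h(1-3) L h(4-7)])
      also have "\<dots> \<le> (real M)\<^sup>2 * (C * l) ^ (M + 1) * (rough_dist p T X XX X' XX' + norm (Y 0 - Y' 0))"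
        by (intro mult_right_mono key add_nonneg_nonneg norm_ge_zero) (simp add: rough_dist_def var_norm_def)
      finally show ?thesis by (simp add: l_def)
    qed
    then have "?estimate C L M" by blast
    then show "\<exists>M. real M \<le> C * L powr p + 1 \<and> ?estimate C L M"
      using M(1) by blast
  qed
qed

end

section \<open>Euler schemes\<close>

context rough_field
begin

text \<open>The scheme is described by what it does at the points of \<open>Q\<close>: it starts at \<open>y0\<close> in the first point and
  moves from each point to the next one by an Euler step.\<close>

definition euler_scheme :: "real set \<Rightarrow> (real \<Rightarrow> real^'d) \<Rightarrow> (real \<Rightarrow> real \<Rightarrow> real^'d^'d) \<Rightarrow> real^'e \<Rightarrow> (real \<Rightarrow> real^'e) \<Rightarrow> bool" where
  "euler_scheme Q X XX y0 Y \<longleftrightarrow>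
     (\<forall>s\<in>Q. (\<forall>u\<in>Q. s \<le> u) \<longrightarrow> Y s = y0) \<and>
     (\<forall>s\<in>Q. \<forall>t\<in>Q. s < t \<and> (\<forall>u\<in>Q. \<not> (s < u \<and> u < t)) \<longrightarrow> Y t = Y s + Xi X XX Y s t)"

lemma euler_scheme_exists:
  assumes "finite Q"
  shows "\<exists>Y. euler_scheme Q X XX y0 Y"
  using assms
proof (induction Q rule: finite_linorder_max_induct)
  case empty
  then show ?case by (simp add: euler_scheme_def)
next
  case (insert b A)
  then obtain Y where Y: "euler_scheme A X XX y0 Y" by blast
  show ?case
  proof (cases "A = {}")
    case True
    then show ?thesis by (intro exI[of _ "\<lambda>_. y0"]) (auto simp: euler_scheme_def)
  next
    case False
    define m where "m = Max A"
    have m: "m \<in> A" "\<And>x. x \<in> A \<Longrightarrow> x \<le> m" "m < b" using insert False by (auto simp: m_def)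
    define Z where "Z = Y(b := Y m + Xi X XX Y m b)"
    have ZA: "Z s = Y s" if "s \<in> A" for s using insert that by (auto simp: Z_def)
    have XiZ: "Xi X XX Z s t = Xi X XX Y s t" if "s \<in> A" for s t using ZA[OF that] by (simp add: Xi_def)
    have "euler_scheme (insert b A) X XX y0 Z"
      unfolding euler_scheme_def
    proof (intro conjI ballI impI)
      fix s assume s: "s \<in> insert b A" "\<forall>u\<in>insert b A. s \<le> u"
      then have "s \<in> A" using m by fastforce
      then show "Z s = y0" using Y s ZA by (simp add: euler_scheme_def)
    next
      fix s t assume st: "s \<in> insert b A" "t \<in> insert b A" "s < t \<and> (\<forall>u\<in>insert b A. \<not> (s < u \<and> u < t))"
      then have sA: "s \<in> A" using insert.hyps by fastforce
      show "Z t = Z s + Xi X XX Z s t"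
      proof (cases "t = b")
        case True
        have "s = m" using st m True sA by (metis insertCI le_neq_trans)
        then show ?thesis using True ZA[OF sA] XiZ[OF sA] by (simp add: Z_def)
      next
        case False
        then have "t \<in> A" using st by simp
        then show ?thesis using Y st sA ZA XiZ by (simp add: euler_scheme_def)
      qed
    qed
    then show ?thesis by blast
  qed
qed

lemma euler_scheme_chain:
  assumes Q: "finite Q" and Y: "euler_scheme Q X XX y0 Y" and st: "s \<in> Q" "t \<in> Q" "s \<le> t"
  shows "\<exists>n u. is_partition s t n u \<and> u ` {..n} \<subseteq> Q \<and> (\<forall>i<n. Y (u (Suc i)) = Y (u i) + Xi X XX Y (u i) (u (Suc i)))"
  using st
proof (induction "card {x \<in> Q. x < t}" arbitrary: t rule: less_induct)
  case less
  show ?case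
  proof (cases "s = t")
    case True
    show ?thesis
      by (rule exI[of _ 0], rule exI[of _ "\<lambda>_. s"]) (use True less.prems in \<open>auto simp: is_partition_def\<close>)
  next
    case False
    define m where "m = Max {x \<in> Q. x < t}"
    have fin: "finite {x \<in> Q. x < t}" "s \<in> {x \<in> Q. x < t}" using Q less.prems False by auto
    then have "m \<in> {x \<in> Q. x < t}" unfolding m_def by (intro Max_in) auto
    then have m: "m \<in> Q" "m < t" "\<And>x. x \<in> Q \<Longrightarrow> x < t \<Longrightarrow> x \<le> m" using fin by (auto simp: m_def)
    have "{x \<in> Q. x < m} \<subset> {x \<in> Q. x < t}" using m by auto
    then have card: "card {x \<in> Q. x < m} < card {x \<in> Q. x < t}" using fin(1) by (rule psubset_card_mono[rotated])
    have "s \<le> m" using m(3)[of s] less.prems False by simp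
    from less.hyps[OF card less.prems(1) m(1) this]
    obtain n u where u: "is_partition s m n u" "u ` {..n} \<subseteq> Q"
      "\<forall>i<n. Y (u (Suc i)) = Y (u i) + Xi X XX Y (u i) (u (Suc i))" by (elim exE conjE)
    have un: "u n = m" using u(1) by (simp add: is_partition_def)
    have step: "Y t = Y m + Xi X XX Y m t"
      using Y m less.prems unfolding euler_scheme_def by (metis not_le)
    have uP: "u i \<in> Q" if "i \<le> n" for i using u(2) that by auto
    show ?thesis
    proof (rule exI[of _ "Suc n"], rule exI[of _ "u(Suc n := t)"], intro conjI allI impI)
      show "is_partition s t (Suc n) (u(Suc n := t))" by (rule is_partition_append[OF u(1) m(2)])
      show "(u(Suc n := t)) ` {..Suc n} \<subseteq> Q"
        by (rule image_subsetI) (use uP less.prems in \<open>auto simp: le_Suc_eq\<close>)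
      fix i assume "i < Suc n"
      then show "Y ((u(Suc n := t)) (Suc i)) = Y ((u(Suc n := t)) i) + Xi X XX Y ((u(Suc n := t)) i) ((u(Suc n := t)) (Suc i))"
        using u(3) step un by (cases "i = n") auto
    qed
  qed
qed

lemma euler_scheme_chain_limit:
  assumes Q: "finite Q" and Y: "euler_scheme Q X XX y0 Y" and st: "s \<in> Q \<inter> {a..b}" "t \<in> Q \<inter> {a..b}" "s \<le> t"
  shows "has_chain_limit (Q \<inter> {a..b}) (Xi X XX Y) (incr Y s t) s t"
proof -
  obtain n u where u: "is_partition s t n u" "u ` {..n} \<subseteq> Q"
      "\<forall>i<n. Y (u (Suc i)) = Y (u i) + Xi X XX Y (u i) (u (Suc i))"
    using euler_scheme_chain[OF Q Y] st by blast
  have "(\<Sum>i<n. Xi X XX Y (u i) (u (Suc i))) = (\<Sum>i<n. Y (u (Suc i)) - Y (u i))"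
    using u(3) by (intro sum.cong) auto
  also have "\<dots> = incr Y s t" using telescope_partition[OF u(1), where g = Y] by (simp add: incr_def)
  finally have sum: "(\<Sum>i<n. Xi X XX Y (u i) (u (Suc i))) = incr Y s t" .
  have "u ` {..n} \<subseteq> Q \<inter> {a..b}"
  proof (rule image_subsetI)
    fix i assume i: "i \<in> {..n}"
    then show "u i \<in> Q \<inter> {a..b}" using is_partition_range[OF u(1), of i] st u(2) by auto
  qed
  then show ?thesis
    unfolding has_chain_limit_def by (intro allI impI exI[of _ n] exI[of _ u] conjI) (use u(1) sum in auto)
qed

text \<open>Between points of the scheme the sums of Euler steps are exact, so \<open>local_apriori\<close> applies on the finite set, with bounds that do
  not depend on the set.\<close>

lemma euler_scheme_local:
  assumes p: "0 < p" "p < 3" and rough: "rough_on {0..T} p g X XX"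
    and Q: "finite Q" "Q \<subseteq> {0..T}" and Y: "euler_scheme Q X XX y0 Y"
    and st: "s \<in> Q" "t \<in> Q" "s \<le> t" and sm: "g t - g s \<le> step_size p powr p / 2"
  shows "norm (Rem X Y s t) \<le> 4 * K * (modulus p g s t)\<^sup>2"
    and "norm (incr Y s t) \<le> 5 * K * modulus p g s t"
    and "norm (incr Y s t - Xi X XX Y s t) \<le> 10 * sew_const p * K ^ 3 * modulus p g s t ^ 3"
proof -
  define J where "J = Q \<inter> {s..t}"
  have J: "finite J" "J \<subseteq> {0..T}" "s \<in> J" "t \<in> J" using Q st by (auto simp: J_def)
  \<comment> \<open>On finitely many points every quantity is controlled by a multiple of the identity.\<close>
  define q where "q a b = norm (Rem X Y a b) powr (p / 2) / \<bar>b - a\<bar>" for a b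
  define c where "c = (\<Sum>a\<in>J. \<Sum>b\<in>J. q a b)"
  have q: "0 \<le> q a b" for a b by (simp add: q_def)
  have qc: "q a b \<le> c" if "a \<in> J" "b \<in> J" for a b
  proof -
    have "q a b \<le> (\<Sum>b\<in>J. q a b)" using J(1) that q by (intro member_le_sum) auto
    also have "\<dots> \<le> c" unfolding c_def using J(1) that q by (intro member_le_sum sum_nonneg) auto
    finally show ?thesis .
  qed
  have c: "0 \<le> c" using q by (auto simp: c_def intro!: sum_nonneg)
  have T: "0 \<le> T" using J by auto
  have rough': "rough_on J p g X XX" by (rule rough_on_subset[OF rough J(2)])
  have small: "g b - g a \<le> step_size p powr p / 2" if ab: "a \<in> J" "b \<in> J" "a \<le> b" for a b
  proof -
    have "g s \<le> g a" "g b \<le> g t" using rough_on_le[OF rough'] ab J by (auto simp: J_def)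
    then show ?thesis using sm by linarith
  qed
  have lim: "has_chain_limit J (Xi X XX Y) (incr Y a b) a b" if "a \<in> J" "b \<in> J" "a < b" for a b
    unfolding J_def using that by (intro euler_scheme_chain_limit[OF Q(1) Y]) (auto simp: J_def)
  have h: "norm (Rem X Y a b) powr (p / 2) \<le> c * b - c * a" if ab: "a \<in> J" "b \<in> J" "a < b" for a b
    using qc[OF ab(1,2)] ab(3) by (simp add: q_def field_simps)
  have bound: "c * b - c * a \<le> c * T + 1" if ab: "a \<in> J" "b \<in> J" "a \<le> b" for a b
  proof -
    have "0 \<le> c * a" "c * b \<le> c * T" using ab J(2) c by (auto intro!: mult_left_mono)
    then show ?thesis by linarith
  qed
  have H: "0 < c * T + 1" using c T by (simp add: add_nonneg_pos)
  note eps = step_size[OF p]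
  note * = local_apriori[OF p rough' eps(1,2,4) small lim h bound H J(3,4) st(3)]
  show "norm (Rem X Y s t) \<le> 4 * K * (modulus p g s t)\<^sup>2" by (rule *(1))
  show "norm (incr Y s t) \<le> 5 * K * modulus p g s t" by (rule *(2))
  show "norm (incr Y s t - Xi X XX Y s t) \<le> 10 * sew_const p * K ^ 3 * modulus p g s t ^ 3" by (rule *(3))
qed

lemma Xi_bound:
  assumes "norm (incr X s t) \<le> m" "norm (XX s t) \<le> m\<^sup>2"
  shows "norm (Xi X XX Y s t) \<le> K * (m + m\<^sup>2)"
proof -
  have "norm (Xi X XX Y s t) \<le> K * m + K * m\<^sup>2"
    unfolding Xi_def using K_ge_1 assms
    by (intro norm_triangle_mono order_trans[OF F_apply_bound] order_trans[OF DFF_bound] mult_left_mono) auto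
  then show ?thesis by (simp add: ring_distribs)
qed

text \<open>The bound does not depend on \<open>Q\<close>; this is what compactness needs.\<close>

lemma euler_scheme_bounded:
  assumes p: "0 < p" "p < 3" and rough: "rough_on {0..T} p g X XX"
    and Q: "finite Q" "Q \<subseteq> {0..T}" "0 \<in> Q" and Y: "euler_scheme Q X XX y0 Y" and t: "t \<in> Q"
    and N: "g T - g 0 < real (Suc N) * (step_size p powr p / 2)"
  shows "norm (Y t) \<le> (1 + 5 * K + K * (modulus p g 0 T + (modulus p g 0 T)\<^sup>2)) ^ (2 * N + 1) * (norm y0 + 1)"
proof -
  define m where "m = modulus p g 0 T"
  define \<Lambda> where "\<Lambda> = 1 + 5 * K + K * (m + m\<^sup>2)"
  define \<phi> where "\<phi> t = norm (Y t) + 1" for t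
  have \<phi>: "1 \<le> \<phi> t" "0 \<le> \<phi> t" for t by (auto simp: \<phi>_def add_nonneg_nonneg)
  have Km: "0 \<le> K * (m + m\<^sup>2)" using K_ge_1 by (intro mult_nonneg_nonneg add_nonneg_nonneg) (auto simp: m_def)
  have \<Lambda>: "1 \<le> \<Lambda>" using Km K_ge_1 unfolding \<Lambda>_def by linarith
  have grow: "\<phi> b \<le> \<Lambda> * \<phi> a" if "norm (incr Y a b) \<le> 5 * K + K * (m + m\<^sup>2)" for a b
  proof -
    have "norm (Y b) \<le> norm (Y a) + (5 * K + K * (m + m\<^sup>2))"
      using norm_triangle_ineq[of "Y a" "incr Y a b"] that by (simp add: incr_def)
    then have "\<phi> b \<le> \<phi> a + (5 * K + K * (m + m\<^sup>2)) * 1" by (simp add: \<phi>_def)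
    also have "\<dots> \<le> \<phi> a + (5 * K + K * (m + m\<^sup>2)) * \<phi> a"
      using Km K_ge_1 \<phi> by (intro add_left_mono mult_left_mono) auto
    also have "\<dots> = \<Lambda> * \<phi> a" by (simp add: \<Lambda>_def ring_distribs)
    finally show ?thesis .
  qed
  have X: "norm (incr X a b) \<le> m" "norm (XX a b) \<le> m\<^sup>2" if ab: "a \<in> Q" "b \<in> Q" "a \<le> b" for a b
  proof -
    have J: "a \<in> {0..T}" "b \<in> {0..T}" using ab Q by auto
    have "modulus p g a b \<le> m"
      unfolding m_def using rough_on_le[OF rough] J ab p by (intro modulus_mono) auto
    moreover from this have "(modulus p g a b)\<^sup>2 \<le> m\<^sup>2" by (rule power_mono) simp
    ultimately show "norm (incr X a b) \<le> m" "norm (XX a b) \<le> m\<^sup>2"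
      using rough_onD[OF rough J ab(3)] by linarith+
  qed
  have loc: "\<phi> b \<le> \<Lambda> * \<phi> a" if ab: "a \<in> Q" "b \<in> Q" "a \<le> b" and sm: "g b - g a \<le> step_size p powr p / 2" for a b
  proof (rule grow)
    have J: "a \<in> {0..T}" "b \<in> {0..T}" using ab Q by auto
    have "g a \<le> g b" by (rule rough_on_le[OF rough J ab(3)])
    then have "modulus p g a b \<le> 1"
      using modulus_le_of_half[where g = g and s = a and t = b, OF p(1) step_size(1)[OF p] _ sm] step_size(2)[OF p] by simp
    then have "5 * K * modulus p g a b \<le> 5 * K * 1" using K_ge_1 by (intro mult_left_mono) auto
    then show "norm (incr Y a b) \<le> 5 * K + K * (m + m\<^sup>2)"
      using euler_scheme_local(2)[OF p rough Q(1,2) Y ab sm] Km by linarith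
  qed
  have chain: "\<exists>n u. is_partition 0 t n u \<and> u ` {..n} \<subseteq> Q \<and> (\<forall>i<n. \<phi> (u (Suc i)) \<le> \<Lambda> * \<phi> (u i))" if t: "t \<in> Q" for t
  proof -
    have "0 \<le> t" using t Q by auto
    from euler_scheme_chain[OF Q(1) Y Q(3) t this]
    obtain n u where u: "is_partition 0 t n u" "u ` {..n} \<subseteq> Q"
      "\<forall>i<n. Y (u (Suc i)) = Y (u i) + Xi X XX Y (u i) (u (Suc i))" by (elim exE conjE)
    have "\<phi> (u (Suc i)) \<le> \<Lambda> * \<phi> (u i)" if i: "i < n" for i
    proof (rule grow)
      have "u i \<in> Q" "u (Suc i) \<in> Q" using u(2) i by auto
      moreover have "u i \<le> u (Suc i)" using is_partition_mono[OF u(1), of i "Suc i"] i by simp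
      ultimately have "norm (Xi X XX Y (u i) (u (Suc i))) \<le> K * (m + m\<^sup>2)" by (intro Xi_bound X)
      then show "norm (incr Y (u i) (u (Suc i))) \<le> 5 * K + K * (m + m\<^sup>2)"
        using u(3) i K_ge_1 by (simp add: incr_def)
    qed
    then show ?thesis using u by blast
  qed
  have mono: "mono_on Q g" using rough Q(2) by (auto simp: rough_on_def intro: mono_on_subset)
  have "g t \<le> g T" using rough_on_le[OF rough, of t T] t Q by auto
  then have t': "g t < g 0 + real (Suc N) * (step_size p powr p / 2)" using N by linarith
  have "0 \<le> t" if "t \<in> Q" for t using that Q by auto
  then have "\<phi> t \<le> \<Lambda> ^ (2 * N + 1) * \<phi> 0"
    using level_growth[where \<phi> = \<phi> and a = 0, OF mono \<Lambda> \<phi>(2) Q(3) _ loc chain t t'] by simp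
  moreover have "Y 0 = y0" using Y Q unfolding euler_scheme_def by (metis atLeastAtMost_iff subsetD)
  ultimately show ?thesis by (simp add: \<phi>_def \<Lambda>_def m_def)
qed

definition jump_const :: "real \<Rightarrow> real \<Rightarrow> real" where
  "jump_const p m = 10 * sew_const p * K ^ 3 + 10 * K\<^sup>2 * (m + m\<^sup>2)"

text \<open>The control is small on \<open>[u,b)\<close> but possibly large on \<open>[u,b]\<close>. The last step before \<open>b\<close> is exact, the
  part before it is covered by the local estimate, and the defect of joining the two is small
  because it contains a factor from the part before.\<close>

lemma euler_scheme_left_jump:
  assumes p: "0 < p" "p < 3" and rough: "rough_on {0..T} p g X XX"
    and Q: "finite Q" "Q \<subseteq> {0..T}" and Y: "euler_scheme Q X XX y0 Y"
    and ub: "u \<in> Q" "b \<in> Q" "u < b"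
    and sm: "\<eta> \<le> step_size p powr p / 2" "\<And>v. v \<in> {u..<b} \<Longrightarrow> g v - g u \<le> \<eta>"
  shows "norm (incr Y u b - Xi X XX Y u b) \<le> jump_const p (modulus p g 0 T) * \<eta> powr (1 / p)"
proof -
  define m where "m = modulus p g 0 T"
  define c where "c = sew_const p"
  have c: "1 \<le> c" using sew_const_props(1)[OF p] by (simp add: c_def)
  have m: "0 \<le> m" by (simp add: m_def)
  \<comment> \<open>The scheme makes no error over the last step, which may contain a large jump.\<close>
  define a where "a = Max {x \<in> Q. x < b}"
  have fin: "finite {x \<in> Q. x < b}" "u \<in> {x \<in> Q. x < b}" using Q ub by auto
  then have "a \<in> {x \<in> Q. x < b}" unfolding a_def by (intro Max_in) auto
  then have a: "a \<in> Q" "a < b" "\<And>x. x \<in> Q \<Longrightarrow> x < b \<Longrightarrow> x \<le> a" using fin by (auto simp: a_def)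
  have ua: "u \<le> a" using a(3)[of u] ub by simp
  have J: "u \<in> {0..T}" "a \<in> {0..T}" "b \<in> {0..T}" using Q ub a by auto
  have gle: "g u \<le> g a" "g a \<le> g b" "g 0 \<le> g a" "g b \<le> g T" using rough_on_le[OF rough] J ua a by auto
  have g_sm: "g a - g u \<le> \<eta>" using sm(2)[of a] ua a by simp
  define \<omega> where "\<omega> = modulus p g u a"
  define \<theta> where "\<theta> = \<eta> powr (1 / p)"
  have \<omega>: "0 \<le> \<omega>" "\<omega> \<le> \<theta>" "\<theta> \<le> 1"
  proof -
    show "\<omega> \<le> \<theta>" unfolding \<omega>_def \<theta>_def modulus_def using g_sm gle p by (intro powr_mono2) auto
    have "\<theta> \<le> (step_size p powr p) powr (1 / p)"
      unfolding \<theta>_def using sm(1) g_sm gle p powr_ge_zero[of "step_size p" p] by (intro powr_mono2) auto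
    then show "\<theta> \<le> 1" using step_size[OF p] p by (simp add: powr_powr)
  qed (simp add: \<omega>_def)
  have \<omega>2: "\<omega>\<^sup>2 \<le> \<omega>" "\<omega> ^ 3 \<le> \<omega>" using \<omega> by (auto intro: power_le_one_iff power_decreasing[of 1 2 \<omega>, simplified] power_decreasing[of 1 3 \<omega>, simplified])
  have mab: "modulus p g a b \<le> m" unfolding m_def using gle p by (intro modulus_mono) auto
  have X: "norm (incr X u a) \<le> \<omega>" "norm (incr X a b) \<le> m" "norm (XX a b) \<le> m\<^sup>2"
    using rough_onD[OF rough J(1,2) ua] order_trans[OF rough_on_first[OF rough J(2,3) less_imp_le[OF a(2)]] mab]
      order_trans[OF rough_on_second[OF rough J(2,3) less_imp_le[OF a(2)]] power_mono[OF mab modulus_nonneg]]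
    by (auto simp: \<omega>_def)
  have "g a - g u \<le> step_size p powr p / 2" using g_sm sm(1) by simp
  note loc = euler_scheme_local[OF p rough Q Y ub(1) a(1) ua this, folded \<omega>_def c_def]
  have last: "incr Y a b = Xi X XX Y a b"
    using Y a ub unfolding euler_scheme_def incr_def by (metis add_diff_cancel_left' not_le)
  let ?D = "Xi X XX Y u b - Xi X XX Y u a - Xi X XX Y a b"
  have D: "norm ?D \<le> 10 * K\<^sup>2 * (m + m\<^sup>2) * \<omega>"
  proof -
    have "norm ?D \<le> K * (norm (Rem X Y u a) + (norm (incr X u a))\<^sup>2) * norm (incr X a b) + K * norm (XX a b) * norm (incr Y u a)"
      using rough_on_chen[OF rough J ua less_imp_le[OF a(2)]] by (rule Xi_defect_bound)
    also have "\<dots> \<le> K * (4 * K * \<omega>\<^sup>2 + \<omega>\<^sup>2) * m + K * m\<^sup>2 * (5 * K * \<omega>)"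
      using K_ge_1 m \<omega> by (intro add_mono mult_mono power_mono loc X mult_nonneg_nonneg add_nonneg_nonneg order_refl) auto
    also have "\<dots> \<le> K * (4 * K * \<omega> + K * \<omega>) * m + K * m\<^sup>2 * (5 * K * \<omega>)"
      using K_ge_1 m \<omega> \<omega>2 mult_mono[OF K_ge_1 \<omega>2(1)] by (intro add_mono mult_right_mono mult_left_mono) auto
    also have "\<dots> = 5 * (K\<^sup>2 * (m + m\<^sup>2) * \<omega>)" by (simp add: power2_eq_square algebra_simps)
    also have "\<dots> \<le> 10 * (K\<^sup>2 * (m + m\<^sup>2) * \<omega>)" using m \<omega> by (intro mult_right_mono) auto
    finally show ?thesis by (simp add: mult_ac)
  qed
  have "incr Y u b - Xi X XX Y u b = (incr Y u a - Xi X XX Y u a) - ?D"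
    unfolding incr_split[of Y u b a] last by simp
  also have "norm \<dots> \<le> 10 * c * K ^ 3 * \<omega> ^ 3 + 10 * K\<^sup>2 * (m + m\<^sup>2) * \<omega>"
    by (rule order_trans[OF norm_triangle_ineq4 add_mono[OF loc(3) D]])
  also have "\<dots> \<le> 10 * c * K ^ 3 * \<theta> + 10 * K\<^sup>2 * (m + m\<^sup>2) * \<theta>"
    using c K_ge_1 m \<omega> \<omega>2 by (intro add_mono mult_left_mono mult_nonneg_nonneg) auto
  finally show ?thesis by (simp add: jump_const_def m_def c_def \<theta>_def ring_distribs)
qed

text \<open>The mirror image: the control is small on \<open>(b,v]\<close>, the step that starts at \<open>b\<close> is exact, and the
  defect contains a factor from the part after it.\<close>

lemma euler_scheme_right_jump:
  assumes p: "0 < p" "p < 3" and rough: "rough_on {0..T} p g X XX"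
    and Q: "finite Q" "Q \<subseteq> {0..T}" and Y: "euler_scheme Q X XX y0 Y"
    and bv: "b \<in> Q" "v \<in> Q" "b < v"
    and sm: "\<eta> \<le> step_size p powr p / 2" "\<And>u. u \<in> {b<..v} \<Longrightarrow> g v - g u \<le> \<eta>"
  shows "norm (incr Y b v - Xi X XX Y b v) \<le> jump_const p (modulus p g 0 T) * \<eta> powr (1 / p)"
proof -
  define m where "m = modulus p g 0 T"
  define c where "c = sew_const p"
  have c: "1 \<le> c" using sew_const_props(1)[OF p] by (simp add: c_def)
  have m: "0 \<le> m" by (simp add: m_def)
  define a where "a = Min {x \<in> Q. b < x}"
  have fin: "finite {x \<in> Q. b < x}" "v \<in> {x \<in> Q. b < x}" using Q bv by auto
  then have "a \<in> {x \<in> Q. b < x}" unfolding a_def by (intro Min_in) auto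
  then have a: "a \<in> Q" "b < a" "\<And>x. x \<in> Q \<Longrightarrow> b < x \<Longrightarrow> a \<le> x" using fin by (auto simp: a_def)
  have av: "a \<le> v" using a(3)[of v] bv by simp
  have J: "b \<in> {0..T}" "a \<in> {0..T}" "v \<in> {0..T}" using Q bv a by auto
  have gle: "g b \<le> g a" "g a \<le> g v" "g 0 \<le> g b" "g a \<le> g T" using rough_on_le[OF rough] J av a by auto
  have g_sm: "g v - g a \<le> \<eta>" using sm(2)[of a] av a by simp
  define \<omega> where "\<omega> = modulus p g a v"
  define \<theta> where "\<theta> = \<eta> powr (1 / p)"
  have \<omega>: "0 \<le> \<omega>" "\<omega> \<le> \<theta>" "\<theta> \<le> 1"
  proof -
    show "\<omega> \<le> \<theta>" unfolding \<omega>_def \<theta>_def modulus_def using g_sm gle p by (intro powr_mono2) auto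
    have "\<theta> \<le> (step_size p powr p) powr (1 / p)"
      unfolding \<theta>_def using sm(1) g_sm gle p powr_ge_zero[of "step_size p" p] by (intro powr_mono2) auto
    then show "\<theta> \<le> 1" using step_size[OF p] p by (simp add: powr_powr)
  qed (simp add: \<omega>_def)
  have \<omega>2: "\<omega>\<^sup>2 \<le> \<omega>" "\<omega> ^ 3 \<le> \<omega>" using \<omega> by (auto intro: power_le_one_iff power_decreasing[of 1 2 \<omega>, simplified] power_decreasing[of 1 3 \<omega>, simplified])
  have mba: "modulus p g b a \<le> m" unfolding m_def using gle p by (intro modulus_mono) auto
  have X: "norm (incr X a v) \<le> \<omega>" "norm (XX a v) \<le> \<omega>\<^sup>2" "norm (incr X b a) \<le> m" "norm (XX b a) \<le> m\<^sup>2"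
    using rough_onD[OF rough J(2,3) av] order_trans[OF rough_on_first[OF rough J(1,2) less_imp_le[OF a(2)]] mba]
      order_trans[OF rough_on_second[OF rough J(1,2) less_imp_le[OF a(2)]] power_mono[OF mba modulus_nonneg]]
    by (auto simp: \<omega>_def)
  have "g v - g a \<le> step_size p powr p / 2" using g_sm sm(1) by simp
  note loc = euler_scheme_local[OF p rough Q Y a(1) bv(2) av this, folded \<omega>_def c_def]
  have first: "incr Y b a = Xi X XX Y b a"
    using Y a bv unfolding euler_scheme_def incr_def by (metis add_diff_cancel_left' not_le)
  have Y1: "norm (incr Y b a) \<le> K * (m + m\<^sup>2)" unfolding first by (intro Xi_bound X(3,4))
  have R1: "norm (Rem X Y b a) \<le> K * m\<^sup>2"
    unfolding Rem_def first using order_trans[OF DFF_bound mult_left_mono[OF X(4)]] K_ge_1 by (simp add: Xi_def)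
  let ?D = "Xi X XX Y b v - Xi X XX Y b a - Xi X XX Y a v"
  have D: "norm ?D \<le> 10 * K\<^sup>2 * (m + m\<^sup>2) * \<omega>"
  proof -
    have "norm ?D \<le> K * (norm (Rem X Y b a) + (norm (incr X b a))\<^sup>2) * norm (incr X a v) + K * norm (XX a v) * norm (incr Y b a)"
      using rough_on_chen[OF rough J less_imp_le[OF a(2)] av] by (rule Xi_defect_bound)
    also have "\<dots> \<le> K * (K * m\<^sup>2 + m\<^sup>2) * \<omega> + K * \<omega>\<^sup>2 * (K * (m + m\<^sup>2))"
      using K_ge_1 m \<omega> by (intro add_mono mult_mono power_mono R1 Y1 X mult_nonneg_nonneg add_nonneg_nonneg order_refl) auto
    also have "\<dots> \<le> K * (K * m\<^sup>2 + K * m\<^sup>2) * \<omega> + K * \<omega> * (K * (m + m\<^sup>2))"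
      using K_ge_1 m \<omega> \<omega>2 mult_right_mono[OF K_ge_1, of "m\<^sup>2"] by (intro add_mono mult_right_mono mult_left_mono add_left_mono) auto
    also have "\<dots> = K\<^sup>2 * (m + 3 * m\<^sup>2) * \<omega>" by (simp add: power2_eq_square algebra_simps)
    also have "\<dots> \<le> K\<^sup>2 * (10 * (m + m\<^sup>2)) * \<omega>" using m \<omega> by (intro mult_right_mono mult_left_mono) auto
    also have "\<dots> = 10 * K\<^sup>2 * (m + m\<^sup>2) * \<omega>" by (simp only: mult_ac)
    finally show ?thesis .
  qed
  have "incr Y b v - Xi X XX Y b v = (incr Y a v - Xi X XX Y a v) - ?D"
    unfolding incr_split[of Y b v a] first by simp
  also have "norm \<dots> \<le> 10 * c * K ^ 3 * \<omega> ^ 3 + 10 * K\<^sup>2 * (m + m\<^sup>2) * \<omega>"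
    by (rule order_trans[OF norm_triangle_ineq4 add_mono[OF loc(3) D]])
  also have "\<dots> \<le> 10 * c * K ^ 3 * \<theta> + 10 * K\<^sup>2 * (m + m\<^sup>2) * \<theta>"
    using c K_ge_1 m \<omega> \<omega>2 by (intro add_mono mult_left_mono mult_nonneg_nonneg) auto
  finally show ?thesis by (simp add: jump_const_def m_def c_def \<theta>_def ring_distribs)
qed

end

section \<open>Limits of Euler schemes\<close>

lemma cluster_point_in_closed:
  assumes "inf (nhds x) \<F> \<noteq> bot" "eventually (\<lambda>y. y \<in> A) \<F>" "closed A"
  shows "x \<in> A"
proof (rule ccontr)
  assume "x \<notin> A"
  then have "eventually (\<lambda>y. y \<in> - A) (nhds x)" using assms(3) by (intro eventually_nhds_in_open) auto
  then have "eventually (\<lambda>_. False) (inf (nhds x) \<F>)" using assms(2) unfolding eventually_inf by blast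
  then show False using assms(1) by (simp add: trivial_limit_def)
qed

lemma compact_bounded_functions: "compact {f :: 'i \<Rightarrow> 'a::euclidean_space. \<forall>t. norm (f t) \<le> B}"
proof -
  have "compactin (product_topology (\<lambda>_ :: 'i. euclidean :: 'a topology) UNIV) (PiE UNIV (\<lambda>_. cball 0 B))"
    by (subst compactin_PiE) auto
  moreover have "PiE UNIV (\<lambda>_. cball 0 B) = {f :: 'i \<Rightarrow> 'a. \<forall>t. norm (f t) \<le> B}" by (auto simp: PiE_def)
  ultimately show ?thesis by (simp add: euclidean_product_topology)
qed

context rough_field
begin

lemma continuous_on_F [continuous_intros]: "continuous_on A f \<Longrightarrow> continuous_on A (\<lambda>x. F (f x))"
proof -
  have "K-lipschitz_on UNIV F"
    using F_lipschitz K_ge_1 by (intro lipschitz_onI) (auto simp: dist_norm)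
  then have "continuous_on UNIV F" by (rule lipschitz_on_continuous_on)
  then show "continuous_on A f \<Longrightarrow> continuous_on A (\<lambda>x. F (f x))" by (rule continuous_on_compose2) auto
qed

lemma continuous_on_DFF [continuous_intros]: "continuous_on A f \<Longrightarrow> continuous_on A (\<lambda>x. DFF F (f x) M)"
proof -
  have "(K * norm M)-lipschitz_on UNIV (\<lambda>y. DFF F y M)"
    using DFF_lipschitz[of _ M] K_ge_1 by (intro lipschitz_onI) (auto simp: dist_norm)
  then have "continuous_on UNIV (\<lambda>y. DFF F y M)" by (rule lipschitz_on_continuous_on)
  then show "continuous_on A f \<Longrightarrow> continuous_on A (\<lambda>x. DFF F (f x) M)" by (rule continuous_on_compose2) auto
qed

text \<open>Outside \<open>Q\<close> the schemes are set to zero, which keeps them in a product of balls; as \<open>Q\<close> grows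
  along the finite subsets of \<open>[0,T]\<close>, every time eventually belongs to it. For fixed times \<open>u\<close> and \<open>v\<close> the
  bound on the step error depends continuously on the values at \<open>u\<close> and \<open>v\<close>, hence is a closed condition.\<close>

lemma euler_limit_exists:
  assumes p: "0 < p" "p < 3" and T: "0 \<le> T" and rough: "rough_on {0..T} p g X XX"
  obtains Y B where "Y 0 = y0" "\<And>t. t \<in> {0..T} \<Longrightarrow> norm (Y t) \<le> B"
    "\<And>Q0 u v c. finite Q0 \<Longrightarrow> Q0 \<subseteq> {0..T} \<Longrightarrow> u \<in> Q0 \<Longrightarrow> v \<in> Q0 \<Longrightarrow>
      \<forall>Q Z. finite Q \<and> Q0 \<subseteq> Q \<and> Q \<subseteq> {0..T} \<and> euler_scheme Q X XX y0 Z \<longrightarrow>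
        norm (incr Z u v - Xi X XX Z u v) \<le> c \<Longrightarrow> norm (incr Y u v - Xi X XX Y u v) \<le> c"
proof -
  obtain N where N: "(g T - g 0) / (step_size p powr p / 2) < real N" using reals_Archimedean2 by blast
  have N': "g T - g 0 < real (Suc N) * (step_size p powr p / 2)"
  proof -
    have "g T - g 0 < real N * (step_size p powr p / 2)" using N step_size(1)[OF p] by (simp add: pos_divide_less_eq)
    also have "\<dots> \<le> real (Suc N) * (step_size p powr p / 2)" by (intro mult_right_mono) auto
    finally show ?thesis .
  qed
  define B where "B = (1 + 5 * K + K * (modulus p g 0 T + (modulus p g 0 T)\<^sup>2)) ^ (2 * N + 1) * (norm y0 + 1)"
  have B0: "0 \<le> B" using K_ge_1 by (auto simp: B_def)
  define E where "E Q = (SOME Y. euler_scheme Q X XX y0 Y)" for Q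
  have E: "euler_scheme Q X XX y0 (E Q)" if "finite Q" for Q
    unfolding E_def using euler_scheme_exists[OF that] by (rule someI_ex)
  define Z where "Z Q t = (if t \<in> Q then E Q t else 0)" for Q t
  have Z: "euler_scheme Q X XX y0 (Z Q)" if "finite Q" for Q
    using E[OF that] unfolding euler_scheme_def by (simp add: Z_def Xi_def)
  define \<F> where "\<F> = filtermap Z (finite_subsets_at_top {0..T})"
  have ev: "eventually R \<F>" if "finite Q0" "Q0 \<subseteq> {0..T}"
    "\<And>Q. finite Q \<Longrightarrow> Q0 \<subseteq> Q \<Longrightarrow> Q \<subseteq> {0..T} \<Longrightarrow> R (Z Q)" for R Q0
    unfolding \<F>_def eventually_filtermap eventually_finite_subsets_at_top using that by blast
  have "eventually (\<lambda>f. f \<in> {f. \<forall>t. norm (f t) \<le> B}) \<F>"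
  proof (rule ev[of "{0}"])
    fix Q assume Q: "finite Q" "{0} \<subseteq> Q" "Q \<subseteq> {0..T}"
    have "norm (Z Q t) \<le> B" if "t \<in> Q" for t
      using euler_scheme_bounded[OF p rough Q(1,3) _ Z[OF Q(1)] that N'] Q by (simp add: B_def)
    then show "Z Q \<in> {f. \<forall>t. norm (f t) \<le> B}" using B0 by (auto simp: Z_def)
  qed (use T in auto)
  moreover have "\<F> \<noteq> bot" by (simp add: \<F>_def filtermap_bot_iff)
  ultimately obtain Y where Y: "Y \<in> {f. \<forall>t. norm (f t) \<le> B}" "inf (nhds Y) \<F> \<noteq> bot"
    using compact_bounded_functions[of B, unfolded compact_filter] by blast
  have eval: "continuous_on UNIV (\<lambda>f :: real \<Rightarrow> real^'e. f t)" for t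
    by (rule continuous_on_product_coordinates)
  have "Y \<in> {f. f 0 = y0}"
  proof (rule cluster_point_in_closed[OF Y(2)])
    show "closed {f :: real \<Rightarrow> real^'e. f 0 = y0}" by (intro closed_Collect_eq eval continuous_on_const)
    show "eventually (\<lambda>f. f \<in> {f. f 0 = y0}) \<F>"
    proof (rule ev[of "{0}"])
      fix Q assume Q: "finite Q" "{0} \<subseteq> Q" "Q \<subseteq> {0..T}"
      then show "Z Q \<in> {f. f 0 = y0}" using Z[OF Q(1)] unfolding euler_scheme_def by fastforce
    qed (use T in auto)
  qed
  then have Y0: "Y 0 = y0" by simp
  have YB: "norm (Y t) \<le> B" if "t \<in> {0..T}" for t using Y(1) by simp
  have lim: "norm (incr Y u v - Xi X XX Y u v) \<le> c"
    if Q0: "finite Q0" "Q0 \<subseteq> {0..T}" "u \<in> Q0" "v \<in> Q0"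
      and bound: "\<forall>Q Z. finite Q \<and> Q0 \<subseteq> Q \<and> Q \<subseteq> {0..T} \<and> euler_scheme Q X XX y0 Z \<longrightarrow>
        norm (incr Z u v - Xi X XX Z u v) \<le> c" for Q0 u v c
  proof -
    have "Y \<in> {f. norm (incr f u v - Xi X XX f u v) \<le> c}"
    proof (rule cluster_point_in_closed[OF Y(2)])
      show "closed {f. norm (incr f u v - Xi X XX f u v) \<le> c}"
        unfolding incr_def[of _ u v] Xi_def by (intro closed_Collect_le continuous_intros eval)
      show "eventually (\<lambda>f. f \<in> {f. norm (incr f u v - Xi X XX f u v) \<le> c}) \<F>"
      proof (rule ev[OF Q0(1,2)])
        fix Q assume Q: "finite Q" "Q0 \<subseteq> Q" "Q \<subseteq> {0..T}"
        then show "Z Q \<in> {f. norm (incr f u v - Xi X XX f u v) \<le> c}"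
          using bound[rule_format, of Q "Z Q"] Z[OF Q(1)] by simp
      qed
    qed
    then show ?thesis by simp
  qed
  show thesis by (rule that[of Y B, OF Y0 YB lim])
qed

end

section \<open>Cadlag solutions\<close>

text \<open>An increasing function has one-sided limits, so it varies little on a small interval that ends
  just before \<open>b\<close>, even if it jumps at \<open>b\<close>.\<close>

lemma mono_left_oscillation:
  fixes g :: "real \<Rightarrow> real"
  assumes g: "mono_on {0..T} g" and b: "b \<le> T" and \<eta>: "0 < \<eta>"
  obtains d where "0 < d" "\<And>u v. 0 \<le> u \<Longrightarrow> b - d < u \<Longrightarrow> u \<le> v \<Longrightarrow> v < b \<Longrightarrow> g v - g u \<le> \<eta>"
proof (cases "0 < b")
  case False
  show thesis by (rule that[of 1]) (use False in auto)
next
  case True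
  let ?S = "g ` {0..<b}"
  have ne: "?S \<noteq> {}" using True by simp
  have bdd: "bdd_above ?S"
    using g b True by (intro bdd_aboveI[of _ "g T"]) (auto simp: mono_on_def)
  obtain u0 where u0: "0 \<le> u0" "u0 < b" "Sup ?S - \<eta> < g u0"
    using less_cSupD[OF ne, of "Sup ?S - \<eta>"] \<eta> by auto
  show thesis
  proof (rule that[of "b - u0"])
    fix u v assume uv: "0 \<le> u" "b - (b - u0) < u" "u \<le> v" "v < b"
    have "g u0 \<le> g u" using uv u0 b g by (auto simp: mono_on_def)
    moreover have "g v \<le> Sup ?S" using uv bdd by (intro cSup_upper) auto
    ultimately show "g v - g u \<le> \<eta>" using u0 by simp
  qed (use u0 in simp)
qed

lemma mono_right_oscillation:
  fixes g :: "real \<Rightarrow> real"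
  assumes g: "mono_on {0..T} g" and b: "0 \<le> b" and \<eta>: "0 < \<eta>"
  obtains d where "0 < d" "\<And>u v. b < u \<Longrightarrow> u \<le> v \<Longrightarrow> v < b + d \<Longrightarrow> v \<le> T \<Longrightarrow> g v - g u \<le> \<eta>"
proof (cases "b < T")
  case False
  show thesis by (rule that[of 1]) (use False in auto)
next
  case True
  let ?S = "g ` {b<..T}"
  have ne: "?S \<noteq> {}" using True by simp
  have bdd: "bdd_below ?S"
    using g b True by (intro bdd_belowI[of _ "g 0"]) (auto simp: mono_on_def)
  obtain v0 where v0: "b < v0" "v0 \<le> T" "g v0 < Inf ?S + \<eta>"
    using cInf_lessD[OF ne, of "Inf ?S + \<eta>"] \<eta> by auto
  show thesis
  proof (rule that[of "v0 - b"])
    fix u v assume uv: "b < u" "u \<le> v" "v < b + (v0 - b)" "v \<le> T"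
    have "g v \<le> g v0" using uv v0 b g by (auto simp: mono_on_def)
    moreover have "Inf ?S \<le> g u" using uv bdd by (intro cInf_lower) auto
    ultimately show "g v - g u \<le> \<eta>" using v0 by simp
  qed (use v0 in simp)
qed

lemma cadlag_rough_path_right_continuous:
  assumes X: "cadlag_rough_path p T X XX" and b: "0 \<le> b" and \<eta>: "0 < \<eta>"
  obtains d where "0 < d" "\<And>v. b < v \<Longrightarrow> v < b + d \<Longrightarrow> v \<le> T \<Longrightarrow> norm (incr X b v) \<le> \<eta> \<and> norm (XX b v) \<le> \<eta>"
proof (cases "b < T")
  case False
  show thesis by (rule that[of 1]) (use False in auto)
next
  case True
  have chen: "XX s t = XX s u + XX u t + tensor (incr X s u) (incr X u t)"
    if "0 \<le> s" "s \<le> u" "u \<le> t" "t \<le> T" for s u t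
    using X that unfolding cadlag_rough_path_def rough_path_def by blast
  have lim: "((\<lambda>t. (X t, XX 0 t)) \<longlongrightarrow> (X b, XX 0 b)) (at_right b)"
    using X b True by (simp add: cadlag_rough_path_def cadlag_on_def)
  have "((\<lambda>v. incr X b v) \<longlongrightarrow> X b - X b) (at_right b)"
    unfolding incr_def using tendsto_fst[OF lim] by (intro tendsto_intros) simp
  then have lim1: "((\<lambda>v. incr X b v) \<longlongrightarrow> 0) (at_right b)" by simp
  have "((\<lambda>v. tensor (incr X 0 b) (incr X b v)) \<longlongrightarrow> tensor (incr X 0 b) 0) (at_right b)"
    unfolding tensor_def by (intro tendsto_vec_lambda tendsto_intros lim1)
  moreover have "tensor (incr X 0 b) 0 = 0" by (simp add: tensor_def vec_eq_iff)
  ultimately have "((\<lambda>v. XX 0 v - XX 0 b - tensor (incr X 0 b) (incr X b v)) \<longlongrightarrow> XX 0 b - XX 0 b - 0) (at_right b)"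
    using tendsto_snd[OF lim] by (intro tendsto_intros) simp_all
  then have lim2: "((\<lambda>v. XX 0 v - XX 0 b - tensor (incr X 0 b) (incr X b v)) \<longlongrightarrow> 0) (at_right b)" by simp
  have "eventually (\<lambda>v. dist (incr X b v) 0 < \<eta> \<and> dist (XX 0 v - XX 0 b - tensor (incr X 0 b) (incr X b v)) 0 < \<eta>) (at_right b)"
    by (intro eventually_conj tendstoD[OF lim1 \<eta>] tendstoD[OF lim2 \<eta>])
  then obtain c where c: "c > b" "\<And>v. v > b \<Longrightarrow> v < c \<Longrightarrow> norm (incr X b v) < \<eta> \<and> norm (XX 0 v - XX 0 b - tensor (incr X 0 b) (incr X b v)) < \<eta>"
    unfolding eventually_at_right_field dist_norm by auto
  show thesis
  proof (rule that[of "c - b"])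
    fix v assume v: "b < v" "v < b + (c - b)" "v \<le> T"
    have "XX b v = XX 0 v - XX 0 b - tensor (incr X 0 b) (incr X b v)"
      using chen[of 0 b v] v b by (simp add: algebra_simps)
    then show "norm (incr X b v) \<le> \<eta> \<and> norm (XX b v) \<le> \<eta>" using c(2)[of v] v by auto
  qed (use c in simp)
qed

lemma uniform_of_local_smallness:
  fixes R :: "real \<Rightarrow> real \<Rightarrow> bool"
  assumes loc: "\<And>b. b \<in> {0..T} \<Longrightarrow> \<exists>d>0. \<forall>u v. 0 \<le> u \<and> u < v \<and> v \<le> T \<and> b - d < u \<and> v < b + d \<longrightarrow> R u v"
  obtains \<delta> where "0 < \<delta>" "\<And>u v. 0 \<le> u \<Longrightarrow> u < v \<Longrightarrow> v \<le> T \<Longrightarrow> v - u < \<delta> \<Longrightarrow> R u v"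
proof (cases "0 \<le> T")
  case False
  show thesis by (rule that[of 1]) (use False in auto)
next
  case True
  obtain d where d: "\<And>b. b \<in> {0..T} \<Longrightarrow> 0 < d b"
    "\<And>b u v. b \<in> {0..T} \<Longrightarrow> 0 \<le> u \<and> u < v \<and> v \<le> T \<and> b - d b < u \<and> v < b + d b \<Longrightarrow> R u v"
    using loc by metis
  define \<C> where "\<C> = (\<lambda>b. {b - d b<..<b + d b}) ` {0..T}"
  have "{0..T} \<subseteq> \<Union>\<C>" using d(1) by (force simp: \<C>_def)
  moreover have "\<C> \<noteq> {}" using True by (simp add: \<C>_def)
  moreover have "\<And>B. B \<in> \<C> \<Longrightarrow> open B" by (auto simp: \<C>_def)
  ultimately obtain \<delta> where \<delta>: "0 < \<delta>" "\<And>S. S \<subseteq> {0..T} \<Longrightarrow> diameter S < \<delta> \<Longrightarrow> \<exists>B\<in>\<C>. S \<subseteq> B"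
    using Lebesgue_number_lemma[OF compact_Icc, of \<C> 0 T] by metis
  show thesis
  proof (rule that[OF \<delta>(1)])
    fix u v assume uv: "0 \<le> u" "u < v" "v \<le> T" "v - u < \<delta>"
    have "diameter {u, v} \<le> v - u" using uv by (intro diameter_le) auto
    then obtain b where "b \<in> {0..T}" "{u, v} \<subseteq> {b - d b<..<b + d b}"
      using \<delta>(2)[of "{u, v}"] uv by (auto simp: \<C>_def)
    then show "R u v" using d(2)[of b u v] uv by auto
  qed
qed

lemma left_limit_of_cauchy:
  fixes f :: "real \<Rightarrow> 'a::complete_space"
  assumes "\<And>e. 0 < e \<Longrightarrow> \<exists>d>0. \<forall>u v. b - d < u \<and> u \<le> v \<and> v < b \<longrightarrow> dist (f u) (f v) < e"
  shows "\<exists>l. (f \<longlongrightarrow> l) (at_left b)"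
proof -
  have "cauchy_filter (filtermap f (at_left b))"
    unfolding cauchy_filter_metric_filtermap
  proof (intro allI impI)
    fix e :: real assume "0 < e"
    then obtain d where d: "0 < d" "\<And>u v. b - d < u \<Longrightarrow> u \<le> v \<Longrightarrow> v < b \<Longrightarrow> dist (f u) (f v) < e"
      using assms by metis
    have "dist (f u) (f v) < e" if "b - d < u" "u < b" "b - d < v" "v < b" for u v
      using d(2)[of u v] d(2)[of v u] that by (cases "u \<le> v") (auto simp: dist_commute)
    moreover have "eventually (\<lambda>u. b - d < u \<and> u < b) (at_left b)"
      using d(1) by (auto simp: eventually_at_left_field intro: exI[of _ "b - d"])
    ultimately show "\<exists>P. eventually P (at_left b) \<and> (\<forall>x y. P x \<and> P y \<longrightarrow> dist (f x) (f y) < e)" by blast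
  qed
  then obtain l where "filtermap f (at_left b) \<le> nhds l"
    using cauchy_filter_complete_converges[of "filtermap f (at_left b)" UNIV] complete_UNIV
    by (auto simp: filtermap_bot_iff)
  then show ?thesis by (auto simp: filterlim_def)
qed

context rough_field
begin

text \<open>In a Riemann sum the intervals with control at most \<open>\<eta>\<close> contribute errors of total size
  \<open>O(\<eta>\<^sup>3\<^sup>/\<^sup>p\<^sup>-\<^sup>1)\<close>. On the others, the error is at most \<open>\<eta>\<^sup>2\<close> for a fine partition, hence at most \<open>\<eta>\<close> times the
  control of the interval, and their contribution is \<open>O(\<eta>)\<close>. The finiteness of the variations
  uses the same distinction, with a bounded path on intervals of large control.\<close>

lemma rde_solution_of_errors:
  assumes p: "0 < p" "p < 3" and T: "0 < T" and X: "cadlag_rough_path p T X XX" and rough: "rough_on {0..T} p g X XX"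
    and Y0: "Y 0 = y0" and B: "\<And>t. t \<in> {0..T} \<Longrightarrow> norm (Y t) \<le> B"
    and \<kappa>: "0 < \<kappa>" "\<kappa> \<le> 1" and c: "0 \<le> c"
    and local: "\<And>u v. 0 \<le> u \<Longrightarrow> u < v \<Longrightarrow> v \<le> T \<Longrightarrow> g v - g u \<le> \<kappa> \<Longrightarrow> norm (incr Y u v - Xi X XX Y u v) \<le> c * modulus p g u v ^ 3"
    and small: "\<And>e. 0 < e \<Longrightarrow> \<exists>\<delta>>0. \<forall>u v. 0 \<le> u \<and> u < v \<and> v \<le> T \<and> v - u < \<delta> \<longrightarrow> norm (incr Y u v - Xi X XX Y u v) \<le> e"
  shows "cadlag_on T Y" "rde_solution p T F X XX y0 Y"
proof -
  let ?m = "modulus p g"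
  have mono: "mono_on {0..T} g" using rough by (simp add: rough_on_def)
  have gle: "g s \<le> g t" if "0 \<le> s" "s \<le> t" "t \<le> T" for s t using rough_on_le[OF rough] that by simp
  have X1: "norm (incr X s t) \<le> ?m s t" "norm (XX s t) \<le> (?m s t)\<^sup>2" if "0 \<le> s" "s \<le> t" "t \<le> T" for s t
    using rough_onD[OF rough] that by simp_all
  have B0: "0 \<le> B" using order_trans[OF norm_ge_zero B[of 0]] T by simp
  define \<mu> where "\<mu> = \<kappa> powr (1 / p)"
  have \<mu>: "0 < \<mu>" "\<mu> \<le> 1" using \<kappa> p by (auto simp: \<mu>_def intro: powr_le1)
  have cases_m: "?m s t \<le> 1 \<and> norm (incr Y s t - Xi X XX Y s t) \<le> c * (?m s t)\<^sup>2 \<or> 1 \<le> ?m s t / \<mu>"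
    if st: "0 \<le> s" "s < t" "t \<le> T" for s t
  proof (cases "g t - g s \<le> \<kappa>")
    case True
    then have "?m s t \<le> \<mu>" unfolding modulus_def \<mu>_def using p gle[of s t] st by (intro powr_mono2) auto
    then have m1: "?m s t \<le> 1" using \<mu> by simp
    have "?m s t ^ 3 \<le> (?m s t)\<^sup>2" using m1 by (intro power_decreasing) auto
    then show ?thesis using local[OF st True] m1 mult_left_mono[OF _ c] by (meson order_trans)
  next
    case False
    then have "\<mu> \<le> ?m s t" unfolding modulus_def \<mu>_def using p \<kappa> by (intro powr_mono2) auto
    then show ?thesis using \<mu> by simp
  qed
  have YB: "norm (incr Y s t) \<le> 2 * B" if "0 \<le> s" "s \<le> t" "t \<le> T" for s t
    unfolding incr_def using order_trans[OF norm_triangle_ineq4 add_mono[OF B[of t] B[of s]]] that by simp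
  define A where "A = 2 * K + c + 2 * B / \<mu>"
  have A0: "0 \<le> A" using K_ge_1 c B0 \<mu> by (simp add: A_def)
  have Yvar: "norm (incr Y s t) \<le> A * ?m s t" if st: "0 \<le> s" "s < t" "t \<le> T" for s t
    using cases_m[OF st]
  proof (elim disjE conjE)
    assume m: "?m s t \<le> 1" and S: "norm (incr Y s t - Xi X XX Y s t) \<le> c * (?m s t)\<^sup>2"
    have m2: "(?m s t)\<^sup>2 \<le> ?m s t" using m by (simp add: power2_eq_square mult_left_le_one_le)
    have Xb: "norm (Xi X XX Y s t) \<le> K * (?m s t + (?m s t)\<^sup>2)" using X1[of s t] st by (intro Xi_bound) auto
    from norm_triangle_mono[OF Xb S] have "norm (incr Y s t) \<le> K * (?m s t + (?m s t)\<^sup>2) + c * (?m s t)\<^sup>2" by simp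
    also have "\<dots> \<le> K * (?m s t + ?m s t) + c * ?m s t"
      using m2 K_ge_1 c by (intro add_mono mult_left_mono) auto
    also have "\<dots> = (2 * K + c) * ?m s t" by (simp add: algebra_simps)
    also have "\<dots> \<le> A * ?m s t" unfolding A_def using B0 \<mu> by (intro mult_right_mono) auto
    finally show ?thesis .
  next
    assume m: "1 \<le> ?m s t / \<mu>"
    have "norm (incr Y s t) \<le> 2 * B * 1" using YB[of s t] st by simp
    also have "\<dots> \<le> 2 * B * (?m s t / \<mu>)" using m B0 by (intro mult_left_mono) auto
    also have "\<dots> = (2 * B / \<mu>) * ?m s t" by simp
    also have "\<dots> \<le> A * ?m s t" unfolding A_def using K_ge_1 c by (intro mult_right_mono) auto
    finally show ?thesis .
  qed
  define A' where "A' = c + K + (2 * B + K) / \<mu>\<^sup>2"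
  have A'0: "0 \<le> A'" using K_ge_1 c B0 \<mu> by (simp add: A'_def)
  have Rvar: "norm (Rem X Y s t) \<le> A' * (?m s t)\<^sup>2" if st: "0 \<le> s" "s < t" "t \<le> T" for s t
    using cases_m[OF st]
  proof (elim disjE conjE)
    assume S: "norm (incr Y s t - Xi X XX Y s t) \<le> c * (?m s t)\<^sup>2"
    have "Rem X Y s t = (incr Y s t - Xi X XX Y s t) + DFF F (Y s) (XX s t)" by (simp add: Rem_def Xi_def)
    also have "norm \<dots> \<le> c * (?m s t)\<^sup>2 + K * (?m s t)\<^sup>2"
      using X1[of s t] st K_ge_1 by (intro norm_triangle_mono S order_trans[OF DFF_bound] mult_left_mono) auto
    also have "\<dots> = (c + K) * (?m s t)\<^sup>2" by (simp add: algebra_simps)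
    also have "\<dots> \<le> A' * (?m s t)\<^sup>2" unfolding A'_def using B0 K_ge_1 by (intro mult_right_mono) auto
    finally show ?thesis .
  next
    assume m: "1 \<le> ?m s t / \<mu>"
    have m2: "1 \<le> (?m s t / \<mu>)\<^sup>2" using m by (rule one_le_power)
    have m3: "?m s t \<le> (?m s t / \<mu>)\<^sup>2"
    proof -
      have "?m s t * \<mu> \<le> ?m s t * 1" using \<mu> by (intro mult_left_mono) auto
      then have "?m s t \<le> ?m s t / \<mu>" using \<mu> by (simp add: pos_le_divide_eq)
      also have "\<dots> = ?m s t / \<mu> * 1" by simp
      also have "\<dots> \<le> ?m s t / \<mu> * (?m s t / \<mu>)" using m by (intro mult_left_mono) auto
      finally show ?thesis by (simp only: power2_eq_square)
    qed
    have "norm (Rem X Y s t) \<le> 2 * B + K * ?m s t"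
      unfolding Rem_def using YB[of s t] X1[of s t] st K_ge_1
      by (intro order_trans[OF norm_triangle_ineq4 add_mono[OF _ order_trans[OF F_apply_bound mult_left_mono]]]) auto
    also have "\<dots> \<le> 2 * B * (?m s t / \<mu>)\<^sup>2 + K * (?m s t / \<mu>)\<^sup>2"
      using m3 mult_left_mono[OF m2, of "2 * B"] B0 K_ge_1 by (intro add_mono mult_left_mono) auto
    also have "\<dots> = (2 * B + K) / \<mu>\<^sup>2 * (?m s t)\<^sup>2" by (simp add: power_divide ring_distribs add_divide_distrib)
    also have "\<dots> \<le> A' * (?m s t)\<^sup>2" unfolding A'_def using K_ge_1 c by (intro mult_right_mono) auto
    finally show ?thesis .
  qed
  have Vp1: "finite_var p T (incr Y)"
    using Yvar A0 by (intro finite_var_of_modulus_bound(1)[OF T p(1) p(1) _ mono]) (auto simp: modulus_def)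
  have "norm (incr (\<lambda>t. F (Y t)) s t) \<le> (K * A) * ?m s t" if st: "0 \<le> s" "s < t" "t \<le> T" for s t
  proof -
    have "norm (incr (\<lambda>t. F (Y t)) s t) \<le> K * norm (incr Y s t)" unfolding incr_def by (rule F_lipschitz)
    also have "\<dots> \<le> K * (A * ?m s t)" using Yvar[OF st] K_ge_1 by (intro mult_left_mono) auto
    finally show ?thesis by (simp add: mult.assoc)
  qed
  then have Vp2: "finite_var p T (incr (\<lambda>t. F (Y t)))"
    using A0 K_ge_1 by (intro finite_var_of_modulus_bound(1)[where A = "K * A", OF T p(1) p(1) _ mono]) (auto simp: modulus_def)
  have Vp3: "finite_var (p / 2) T (Rem X Y)"
    using Rvar A'0 p by (intro finite_var_of_modulus_bound(1)[OF T p(1) _ _ mono]) (auto simp: modulus_power)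
  have mesh: "has_mesh_limit (Xi X XX Y) (incr Y 0 t) 0 t" if t: "0 \<le> t" "t \<le> T" for t
    unfolding has_mesh_limit_def
  proof (intro allI impI)
    fix e :: real assume e: "0 < e"
    define W where "W = g T - g 0"
    have W: "0 \<le> W" using gle[of 0 T] T by (simp add: W_def)
    have "((\<lambda>\<eta>. (c * \<eta> powr (3 / p - 1) + \<eta>) * W) \<longlongrightarrow> (c * 0 powr (3 / p - 1) + 0) * W) (at_right 0)"
      using p by (intro tendsto_intros tendsto_powr') (auto simp: eventually_at_filter field_simps)
    then have "((\<lambda>\<eta>. (c * \<eta> powr (3 / p - 1) + \<eta>) * W) \<longlongrightarrow> 0) (at_right 0)" by simp
    from tendstoD[OF this e] have "eventually (\<lambda>\<eta>. (c * \<eta> powr (3 / p - 1) + \<eta>) * W < e) (at_right 0)"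
      by (rule eventually_mono) (simp add: dist_real_def)
    moreover have "eventually (\<lambda>\<eta>. \<eta> \<in> {0<..<\<kappa>}) (at_right 0)" using \<kappa>(1) by (rule eventually_at_right_real)
    ultimately have "eventually (\<lambda>\<eta>. (c * \<eta> powr (3 / p - 1) + \<eta>) * W < e \<and> \<eta> \<in> {0<..<\<kappa>}) (at_right 0)"
      by (rule eventually_conj)
    from eventually_happens'[OF trivial_limit_at_right_real this]
    obtain \<eta> where \<eta>: "(c * \<eta> powr (3 / p - 1) + \<eta>) * W < e" "0 < \<eta>" "\<eta> < \<kappa>" by auto
    have "0 < \<eta>\<^sup>2" using \<eta> by simp
    from small[OF this] obtain \<delta> where \<delta>: "0 < \<delta>"
      "\<And>u v. 0 \<le> u \<and> u < v \<and> v \<le> T \<and> v - u < \<delta> \<Longrightarrow> norm (incr Y u v - Xi X XX Y u v) \<le> \<eta>\<^sup>2" by metis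
    define C where "C = c * \<eta> powr (3 / p - 1) + \<eta>"
    have C: "0 \<le> C" using c \<eta> by (simp add: C_def)
    have step: "norm (Xi X XX Y u v - incr Y u v) \<le> C * (g v - g u)" if uv: "0 \<le> u" "u < v" "v \<le> T" "v - u < \<delta>" for u v
    proof (cases "g v - g u \<le> \<eta>")
      case True
      define w where "w = g v - g u"
      have w: "0 \<le> w" "w \<le> \<eta>" using gle[of u v] uv True by (auto simp: w_def)
      have "norm (incr Y u v - Xi X XX Y u v) \<le> c * w powr (3 / p)"
        using local[of u v] uv True \<eta> p by (simp add: w_def modulus_power)
      also have "w powr (3 / p) = w powr (3 / p - 1) * w"
        using w by (cases "w = 0") (auto simp: powr_diff)
      also have "c * (w powr (3 / p - 1) * w) \<le> c * (\<eta> powr (3 / p - 1) * w)"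
        using w c p by (intro mult_left_mono mult_right_mono powr_mono2) auto
      also have "\<dots> \<le> C * w" using w \<eta> by (simp add: C_def algebra_simps)
      finally show ?thesis by (simp add: w_def norm_minus_commute)
    next
      case False
      have "norm (incr Y u v - Xi X XX Y u v) \<le> \<eta>\<^sup>2" using \<delta>(2) uv by blast
      also have "\<dots> \<le> \<eta> * (g v - g u)" using False \<eta> by (simp add: power2_eq_square)
      also have "\<dots> \<le> C * (g v - g u)" using False \<eta> c by (intro mult_right_mono) (auto simp: C_def)
      finally show ?thesis by (simp add: norm_minus_commute)
    qed
    show "\<exists>\<delta>>0. \<forall>n u. is_partition 0 t n u \<and> (\<forall>i<n. u (Suc i) - u i < \<delta>) \<longrightarrow>
        norm ((\<Sum>i<n. Xi X XX Y (u i) (u (Suc i))) - incr Y 0 t) < e"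
    proof (intro exI[of _ \<delta>] conjI allI impI \<delta>(1))
      fix n u assume u: "is_partition 0 t n u \<and> (\<forall>i<n. u (Suc i) - u i < \<delta>)"
      then have part: "is_partition 0 t n u" by simp
      have "(\<Sum>i<n. Xi X XX Y (u i) (u (Suc i))) - incr Y 0 t
          = (\<Sum>i<n. Xi X XX Y (u i) (u (Suc i)) - incr Y (u i) (u (Suc i)))"
        using telescope_partition[OF part, where g = Y] by (simp add: sum_subtractf incr_def)
      also have "norm \<dots> \<le> (\<Sum>i<n. C * (g (u (Suc i)) - g (u i)))"
      proof (rule sum_norm_le)
        fix i assume i: "i \<in> {..<n}"
        show "norm (Xi X XX Y (u i) (u (Suc i)) - incr Y (u i) (u (Suc i))) \<le> C * (g (u (Suc i)) - g (u i))"
          using u i is_partition_range[OF part, of i] is_partition_range[OF part, of "Suc i"] t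
          by (intro step) (auto simp: is_partition_def)
      qed
      also have "\<dots> = C * (g t - g 0)"
        using telescope_partition[OF part, where g = g] by (simp flip: sum_distrib_left)
      also have "\<dots> \<le> C * W" unfolding W_def using C gle[of t T] t by (intro mult_left_mono) auto
      finally show "norm ((\<Sum>i<n. Xi X XX Y (u i) (u (Suc i))) - incr Y 0 t) < e" using \<eta>(1) by (simp add: C_def)
    qed
  qed
  show "rde_solution p T F X XX y0 Y"
    unfolding rde_solution_def Vp_def mem_Collect_eq
  proof (intro conjI allI impI Vp1 Vp2)
    show "finite_var (p / 2) T (\<lambda>s t. incr Y s t - blinfun_apply (F (Y s)) (incr X s t))"
      using Vp3 by (simp add: Rem_def[abs_def])
    fix t assume "0 \<le> t \<and> t \<le> T"
    then have "has_mesh_limit (\<lambda>u v. blinfun_apply (F (Y u)) (incr X u v) + DFF F (Y u) (XX u v)) (incr Y 0 t) 0 t"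
      using mesh[of t] by (simp add: Xi_def[abs_def])
    then show "\<exists>I. has_mesh_limit (\<lambda>u v. blinfun_apply (F (Y u)) (incr X u v) + DFF F (Y u) (XX u v)) I 0 t \<and> Y t = y0 + I"
      using Y0 by (intro exI[of _ "incr Y 0 t"]) (simp add: incr_def)
  qed
  show "cadlag_on T Y"
    unfolding cadlag_on_def
  proof (intro conjI allI impI)
    fix b assume b: "0 \<le> b \<and> b < T"
    show "(Y \<longlongrightarrow> Y b) (at_right b)"
    proof (rule tendstoI)
      fix e :: real assume e: "0 < e"
      then have "0 < e / 4" by simp
      from small[OF this] obtain \<delta> where \<delta>: "0 < \<delta>"
        "\<And>u v. 0 \<le> u \<and> u < v \<and> v \<le> T \<and> v - u < \<delta> \<Longrightarrow> norm (incr Y u v - Xi X XX Y u v) \<le> e / 4" by metis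
      have "0 < e / (4 * K)" using e K_ge_1 by simp
      then obtain d where d: "0 < d" "\<And>v. b < v \<Longrightarrow> v < b + d \<Longrightarrow> v \<le> T \<Longrightarrow> norm (incr X b v) \<le> e / (4 * K) \<and> norm (XX b v) \<le> e / (4 * K)"
        using cadlag_rough_path_right_continuous[OF X] b by metis
      have "dist (Y v) (Y b) < e" if v: "b < v" "v < b + Min {\<delta>, d, T - b}" for v
      proof -
        have v': "v < b + \<delta>" "v < b + d" "v \<le> T" using v by auto
        have S: "norm (incr Y b v - Xi X XX Y b v) \<le> e / 4" using \<delta>(2)[of b v] v v' b by simp
        have "norm (Xi X XX Y b v) \<le> K * (e / (4 * K)) + K * (e / (4 * K))"
          unfolding Xi_def using d(2)[OF v(1) v'(2,3)] K_ge_1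
          by (intro norm_triangle_mono order_trans[OF F_apply_bound] order_trans[OF DFF_bound] mult_left_mono) auto
        also have "\<dots> = e / 2" using K_ge_1 by simp
        finally have Xb: "norm (Xi X XX Y b v) \<le> e / 2" .
        from norm_triangle_mono[OF Xb S] have "norm (incr Y b v) \<le> e / 2 + e / 4" by simp
        then show ?thesis using e by (simp add: incr_def dist_norm)
      qed
      then show "eventually (\<lambda>v. dist (Y v) (Y b) < e) (at_right b)"
        unfolding eventually_at_right_field using \<delta>(1) d(1) b
        by (intro exI[of _ "b + Min {\<delta>, d, T - b}"]) auto
    qed
  next
    fix b assume b: "0 < b \<and> b \<le> T"
    show "\<exists>l. (Y \<longlongrightarrow> l) (at_left b)"
    proof (rule left_limit_of_cauchy)
      fix e :: real assume e: "0 < e"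
      define \<eta> where "\<eta> = (e / (2 * (A + 1))) powr p"
      have q: "0 < e / (2 * (A + 1))" using e A0 by simp
      then have \<eta>: "0 < \<eta>" unfolding \<eta>_def by (metis powr_gt_zero less_irrefl)
      obtain d where d: "0 < d" "\<And>u v. 0 \<le> u \<Longrightarrow> b - d < u \<Longrightarrow> u \<le> v \<Longrightarrow> v < b \<Longrightarrow> g v - g u \<le> \<eta>"
        using mono_left_oscillation[OF mono _ \<eta>, of b] b by metis
      have "dist (Y u) (Y v) < e" if uv: "b - min d b < u" "u \<le> v" "v < b" for u v
      proof (cases "u = v")
        case False
        have uv': "0 \<le> u" "b - d < u" "v \<le> T" using uv b by auto
        have "?m u v \<le> \<eta> powr (1 / p)"
          unfolding modulus_def using d(2)[OF uv'(1,2) uv(2,3)] gle[of u v] uv uv' p by (intro powr_mono2) auto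
        also have "\<dots> = e / (2 * (A + 1))" 
        proof -
          have "(x powr p) powr (1 / p) = x" if "0 < x" for x :: real using p(1) that by (simp add: powr_powr)
          then show ?thesis unfolding \<eta>_def using q .
        qed
        finally have "A * ?m u v \<le> A * (e / (2 * (A + 1)))" using A0 by (intro mult_left_mono)
        also have "\<dots> < e" using A0 e add_nonneg_pos[OF mult_nonneg_nonneg[OF A0 less_imp_le[OF e]], of "e * 2"] by (simp add: field_simps)
        finally have "norm (incr Y u v) < e" using Yvar[of u v] uv uv' False by simp
        then show ?thesis by (simp add: incr_def dist_norm norm_minus_commute)
      qed (use e in simp)
      then show "\<exists>d>0. \<forall>u v. b - d < u \<and> u \<le> v \<and> v < b \<longrightarrow> dist (Y u) (Y v) < e"
        using d(1) b by (intro exI[of _ "min d b"]) auto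
    qed
  qed
qed


text \<open>It remains to see that the errors of the limit are small near every time \<open>b\<close>. Off \<open>b\<close> the control is small;
  for an interval ending or starting in \<open>b\<close> the bounds for jumps apply; an interval with
  \<open>b\<close> in its interior is cut at \<open>b\<close>, and the defect is small because \<open>X\<close> and the second level are
  right-continuous at \<open>b\<close>.\<close>

lemma rde_solution_exists:
  assumes p: "0 < p" "p < 3" and T: "0 < T" and X: "cadlag_rough_path p T X XX"
  shows "\<exists>Y. cadlag_on T Y \<and> rde_solution p T F X XX y0 Y"
proof -
  have "rough_path p T X XX" using X by (simp add: cadlag_rough_path_def)
  then obtain g where rough: "rough_on {0..T} p g X XX" using rough_path_control[OF p(1) T] by metis
  have mono: "mono_on {0..T} g" using rough by (simp add: rough_on_def)
  define \<epsilon> where "\<epsilon> = step_size p"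
  note eps = step_size[OF p, folded \<epsilon>_def]
  define \<kappa> where "\<kappa> = \<epsilon> powr p / 2"
  have \<kappa>: "0 < \<kappa>" "\<kappa> \<le> 1"
    using eps p powr_le1[of p \<epsilon>] by (auto simp: \<kappa>_def)
  define m where "m = modulus p g 0 T"
  define c where "c = 10 * sew_const p * K ^ 3"
  define C where "C = jump_const p m"
  have c: "0 \<le> c" using sew_const_props(1)[OF p] K_ge_1 by (simp add: c_def)
  have m: "0 \<le> m" by (simp add: m_def)
  have C: "0 \<le> C" using c m by (simp add: C_def jump_const_def c_def)
  obtain Y B where Y: "Y 0 = y0" "\<And>t. t \<in> {0..T} \<Longrightarrow> norm (Y t) \<le> B"
    and lim: "\<And>Q0 u v c. finite Q0 \<Longrightarrow> Q0 \<subseteq> {0..T} \<Longrightarrow> u \<in> Q0 \<Longrightarrow> v \<in> Q0 \<Longrightarrow>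
      \<forall>Q Z. finite Q \<and> Q0 \<subseteq> Q \<and> Q \<subseteq> {0..T} \<and> euler_scheme Q X XX y0 Z \<longrightarrow>
        norm (incr Z u v - Xi X XX Z u v) \<le> c \<Longrightarrow> norm (incr Y u v - Xi X XX Y u v) \<le> c"
    using euler_limit_exists[OF p less_imp_le[OF T] rough, of y0] by metis
  have local: "norm (incr Y u v - Xi X XX Y u v) \<le> c * modulus p g u v ^ 3"
    if uv: "0 \<le> u" "u < v" "v \<le> T" and sm: "g v - g u \<le> \<kappa>" for u v
  proof (rule lim[of "{u, v}"])
    show "\<forall>Q Z. finite Q \<and> {u, v} \<subseteq> Q \<and> Q \<subseteq> {0..T} \<and> euler_scheme Q X XX y0 Z \<longrightarrow>
        norm (incr Z u v - Xi X XX Z u v) \<le> c * modulus p g u v ^ 3"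
    proof (intro allI impI, elim conjE)
      fix Q Z assume Q: "finite Q" "{u, v} \<subseteq> Q" "Q \<subseteq> {0..T}" "euler_scheme Q X XX y0 Z"
      show "norm (incr Z u v - Xi X XX Z u v) \<le> c * modulus p g u v ^ 3"
        unfolding c_def
        by (rule euler_scheme_local(3)[OF p rough Q(1,3,4)]) (use Q uv sm in \<open>auto simp: \<kappa>_def \<epsilon>_def\<close>)
    qed
  qed (use uv in auto)
  have left: "norm (incr Y u b - Xi X XX Y u b) \<le> C * \<eta> powr (1 / p)"
    if ub: "0 \<le> u" "u < b" "b \<le> T" and \<eta>: "\<eta> \<le> \<kappa>" "\<And>v. v \<in> {u..<b} \<Longrightarrow> g v - g u \<le> \<eta>" for u b \<eta>
  proof (rule lim[of "{u, b}"])
    show "\<forall>Q Z. finite Q \<and> {u, b} \<subseteq> Q \<and> Q \<subseteq> {0..T} \<and> euler_scheme Q X XX y0 Z \<longrightarrow>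
        norm (incr Z u b - Xi X XX Z u b) \<le> C * \<eta> powr (1 / p)"
    proof (intro allI impI, elim conjE)
      fix Q Z assume Q: "finite Q" "{u, b} \<subseteq> Q" "Q \<subseteq> {0..T}" "euler_scheme Q X XX y0 Z"
      show "norm (incr Z u b - Xi X XX Z u b) \<le> C * \<eta> powr (1 / p)"
        unfolding C_def m_def
        by (rule euler_scheme_left_jump[OF p rough Q(1,3,4)]) (use Q ub \<eta> in \<open>auto simp: \<kappa>_def \<epsilon>_def\<close>)
    qed
  qed (use ub in auto)
  have right: "norm (incr Y b v - Xi X XX Y b v) \<le> C * \<eta> powr (1 / p)"
    if bv: "0 \<le> b" "b < v" "v \<le> T" and \<eta>: "\<eta> \<le> \<kappa>" "\<And>u. u \<in> {b<..v} \<Longrightarrow> g v - g u \<le> \<eta>" for b v \<eta>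
  proof (rule lim[of "{b, v}"])
    show "\<forall>Q Z. finite Q \<and> {b, v} \<subseteq> Q \<and> Q \<subseteq> {0..T} \<and> euler_scheme Q X XX y0 Z \<longrightarrow>
        norm (incr Z b v - Xi X XX Z b v) \<le> C * \<eta> powr (1 / p)"
    proof (intro allI impI, elim conjE)
      fix Q Z assume Q: "finite Q" "{b, v} \<subseteq> Q" "Q \<subseteq> {0..T}" "euler_scheme Q X XX y0 Z"
      show "norm (incr Z b v - Xi X XX Z b v) \<le> C * \<eta> powr (1 / p)"
        unfolding C_def m_def
        by (rule euler_scheme_right_jump[OF p rough Q(1,3,4)]) (use Q bv \<eta> in \<open>auto simp: \<kappa>_def \<epsilon>_def\<close>)
    qed
  qed (use bv in auto)
  have B0: "0 \<le> B" using order_trans[OF norm_ge_zero Y(2)[of 0]] T by simp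
  have YB: "norm (incr Y s t) \<le> 2 * B" if "0 \<le> s" "s \<le> t" "t \<le> T" for s t
    unfolding incr_def using order_trans[OF norm_triangle_ineq4 add_mono[OF Y(2)[of t] Y(2)[of s]]] that by simp
  have Xm: "norm (incr X s t) \<le> m" if "0 \<le> s" "s \<le> t" "t \<le> T" for s t
  proof -
    have "modulus p g s t \<le> m"
      unfolding m_def using rough_on_le[OF rough] that p by (intro modulus_mono) auto
    then show ?thesis using rough_on_first[OF rough, of s t] that by simp
  qed
  define D where "D = K * (2 * B + K * m + m\<^sup>2) + K * (2 * B)"
  have D: "0 \<le> D" using K_ge_1 B0 m by (simp add: D_def)
  have small: "\<exists>\<delta>>0. \<forall>u v. 0 \<le> u \<and> u < v \<and> v \<le> T \<and> v - u < \<delta> \<longrightarrow> norm (incr Y u v - Xi X XX Y u v) \<le> e"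
    if e: "0 < e" for e
  proof -
    define \<theta> where "\<theta> = min \<epsilon> (e / (2 * (c + 2 * C + 1)))"
    have \<theta>: "0 < \<theta>" "\<theta> \<le> \<epsilon>" "\<theta> \<le> 1" using e c C eps by (auto simp: \<theta>_def)
    have \<theta>e: "(c + 2 * C) * \<theta> \<le> e / 2"
    proof -
      have "(c + 2 * C) * \<theta> \<le> (c + 2 * C + 1) * (e / (2 * (c + 2 * C + 1)))"
        using c C \<theta> e by (intro mult_mono) (auto simp: \<theta>_def)
      also have "\<dots> = e / 2" using c C by (simp add: field_simps)
      finally show ?thesis .
    qed
    define \<eta> where "\<eta> = \<theta> powr p / 2"
    have \<eta>: "0 < \<eta>" "\<eta> \<le> \<kappa>" using \<theta> p by (auto simp: \<eta>_def \<kappa>_def powr_mono2)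
    have \<eta>\<theta>: "\<eta> powr (1 / p) \<le> \<theta>"
    proof -
      have "\<eta> powr (1 / p) \<le> (\<theta> powr p) powr (1 / p)" using \<theta> p by (intro powr_mono2) (auto simp: \<eta>_def)
      then show ?thesis using \<theta> p by (simp add: powr_powr)
    qed
    define \<zeta> where "\<zeta> = e / (2 * (D + 1))"
    have \<zeta>: "0 < \<zeta>" using e D by (simp add: \<zeta>_def)
    have D\<zeta>: "D * \<zeta> \<le> e / 2"
    proof -
      have "D * \<zeta> \<le> (D + 1) * \<zeta>" using \<zeta> by (intro mult_right_mono) auto
      also have "\<dots> = e / 2" using D by (simp add: \<zeta>_def field_simps)
      finally show ?thesis .
    qed
    have "\<exists>d>0. \<forall>u v. 0 \<le> u \<and> u < v \<and> v \<le> T \<and> b - d < u \<and> v < b + d \<longrightarrow> norm (incr Y u v - Xi X XX Y u v) \<le> e"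
      if b: "b \<in> {0..T}" for b
    proof -
      have b': "0 \<le> b" "b \<le> T" using b by auto
      obtain d1 where d1: "0 < d1" "\<And>u v. 0 \<le> u \<Longrightarrow> b - d1 < u \<Longrightarrow> u \<le> v \<Longrightarrow> v < b \<Longrightarrow> g v - g u \<le> \<eta>"
        using mono_left_oscillation[OF mono b'(2) \<eta>(1)] by metis
      obtain d2 where d2: "0 < d2" "\<And>u v. b < u \<Longrightarrow> u \<le> v \<Longrightarrow> v < b + d2 \<Longrightarrow> v \<le> T \<Longrightarrow> g v - g u \<le> \<eta>"
        using mono_right_oscillation[OF mono b'(1) \<eta>(1)] by metis
      obtain d3 where d3: "0 < d3" "\<And>v. b < v \<Longrightarrow> v < b + d3 \<Longrightarrow> v \<le> T \<Longrightarrow> norm (incr X b v) \<le> \<zeta> \<and> norm (XX b v) \<le> \<zeta>"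
        using cadlag_rough_path_right_continuous[OF X b'(1) \<zeta>] by metis
      have "norm (incr Y u v - Xi X XX Y u v) \<le> e"
        if uv: "0 \<le> u" "u < v" "v \<le> T" "b - min d1 (min d2 d3) < u" "v < b + min d1 (min d2 d3)" for u v
      proof -
        have near: "b - d1 < u" "v < b + d2" "v < b + d3" using uv by auto
        have in_piece: "norm (incr Y u v - Xi X XX Y u v) \<le> e" if sm: "g v - g u \<le> \<eta>"
        proof -
          have "g u \<le> g v" using rough_on_le[OF rough, of u v] uv by simp
          then have mod: "modulus p g u v \<le> \<theta>"
            unfolding modulus_def using sm p by (intro order_trans[OF powr_mono2 \<eta>\<theta>]) auto
          then have "modulus p g u v ^ 3 \<le> \<theta> ^ 3" by (intro power_mono) auto
          also have "\<dots> \<le> \<theta>" using \<theta> power_decreasing[of 1 3 \<theta>] by simp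
          finally have "c * modulus p g u v ^ 3 \<le> c * \<theta>" using c by (intro mult_left_mono)
          moreover have "0 \<le> 2 * C * \<theta>" using C \<theta> by simp
          moreover have "norm (incr Y u v - Xi X XX Y u v) \<le> c * modulus p g u v ^ 3"
            using local[OF uv(1-3)] sm \<eta>(2) by simp
          ultimately show ?thesis using \<theta>e e by (simp add: ring_distribs)
        qed
        have L: "norm (incr Y u b - Xi X XX Y u b) \<le> C * \<theta>" if ub: "u < b"
        proof -
          have "norm (incr Y u b - Xi X XX Y u b) \<le> C * \<eta> powr (1 / p)"
            using d1(2)[of u] near uv ub b' \<eta> by (intro left) auto
          also have "\<dots> \<le> C * \<theta>" using C \<eta>\<theta> by (intro mult_left_mono)
          finally show ?thesis .
        qed
        have R: "norm (incr Y b v - Xi X XX Y b v) \<le> C * \<theta>" if bv: "b < v"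
        proof -
          have "norm (incr Y b v - Xi X XX Y b v) \<le> C * \<eta> powr (1 / p)"
            using d2(2)[of _ v] near uv bv b' \<eta> by (intro right) auto
          also have "\<dots> \<le> C * \<theta>" using C \<eta>\<theta> by (intro mult_left_mono)
          finally show ?thesis .
        qed
        have C\<theta>: "C * \<theta> + C * \<theta> \<le> e / 2" "0 \<le> C * \<theta>"
        proof -
          have "0 \<le> c * \<theta>" using c \<theta> by simp
          moreover have "(c + 2 * C) * \<theta> = c * \<theta> + (C * \<theta> + C * \<theta>)" by (simp add: algebra_simps)
          ultimately show "C * \<theta> + C * \<theta> \<le> e / 2" using \<theta>e by linarith
        qed (use C \<theta> in simp)
        consider "v < b" | "b < u" | "v = b" | "u = b" | "u < b" "b < v" by linarith
        then show ?thesis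
        proof cases
          case 1
          then show ?thesis using d1(2)[of u v] near uv by (intro in_piece) auto
        next
          case 2
          then show ?thesis using d2(2)[of u v] near uv by (intro in_piece) auto
        next
          case 3
          then show ?thesis using L C\<theta> e uv by simp
        next
          case 4
          then show ?thesis using R C\<theta> e uv by simp
        next
          case 5
          let ?E = "Xi X XX Y u v - Xi X XX Y u b - Xi X XX Y b v"
          have J: "u \<in> {0..T}" "b \<in> {0..T}" "v \<in> {0..T}" "u \<le> b" "b \<le> v" using uv b 5 by auto
          have Rb: "norm (Rem X Y u b) \<le> 2 * B + K * m"
            unfolding Rem_def using YB[of u b] Xm[of u b] J K_ge_1
            by (intro order_trans[OF norm_triangle_ineq4 add_mono[OF _ order_trans[OF F_apply_bound mult_left_mono]]]) auto
          have x: "norm (incr X b v) \<le> \<zeta>" "norm (XX b v) \<le> \<zeta>" using d3(2)[of v] 5 near uv by auto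
          have "norm ?E \<le> K * (norm (Rem X Y u b) + (norm (incr X u b))\<^sup>2) * norm (incr X b v) + K * norm (XX b v) * norm (incr Y u b)"
            by (rule Xi_defect_bound[OF rough_on_chen[OF rough J]])
          also have "\<dots> \<le> K * (2 * B + K * m + m\<^sup>2) * \<zeta> + K * \<zeta> * (2 * B)"
            using K_ge_1 B0 m \<zeta> Xm[of u b] YB[of u b] J
            by (intro add_mono mult_mono power_mono Rb x mult_nonneg_nonneg add_nonneg_nonneg order_refl) auto
          also have "\<dots> = D * \<zeta>" by (simp add: D_def algebra_simps)
          finally have E: "norm ?E \<le> e / 2" using D\<zeta> by simp
          have eq: "incr Y u v - Xi X XX Y u v = ((incr Y u b - Xi X XX Y u b) + (incr Y b v - Xi X XX Y b v)) - ?E"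
            unfolding incr_split[of Y u v b] by simp
          have "norm (incr Y u v - Xi X XX Y u v) \<le> (C * \<theta> + C * \<theta>) + e / 2"
            unfolding eq by (rule order_trans[OF norm_triangle_ineq4 add_mono[OF norm_triangle_mono[OF L[OF 5(1)] R[OF 5(2)]] E]])
          then show ?thesis using C\<theta> by simp
        qed
      qed
      then show ?thesis using d1(1) d2(1) d3(1) by (intro exI[of _ "min d1 (min d2 d3)"]) auto
    qed
    from uniform_of_local_smallness[OF this]
    obtain \<delta> where "0 < \<delta>" "\<And>u v. 0 \<le> u \<Longrightarrow> u < v \<Longrightarrow> v \<le> T \<Longrightarrow> v - u < \<delta> \<Longrightarrow> norm (incr Y u v - Xi X XX Y u v) \<le> e"
      by metis
    then show ?thesis by blast
  qed
  show ?thesis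
    using rde_solution_of_errors[OF p T X rough Y \<kappa> c local small] by blast
qed

end

text \<open>Over \<open>[0,0]\<close> there is only the empty partition.\<close>

lemma rde_solution_initial:
  assumes "rde_solution p T F X XX y0 Y" "0 \<le> T"
  shows "Y 0 = y0"
proof -
  obtain I where I: "has_mesh_limit (\<lambda>u v. blinfun_apply (F (Y u)) (incr X u v) + DFF F (Y u) (XX u v)) I 0 0" "Y 0 = y0 + I"
    using assms unfolding rde_solution_def by blast
  have "norm I \<le> 0"
  proof (rule field_le_epsilon)
    fix e :: real assume "0 < e"
    from has_mesh_limitD[OF I(1) this] obtain \<delta> where
      "\<forall>n u. is_partition 0 0 n u \<and> (\<forall>i<n. u (Suc i) - u i < \<delta>) \<longrightarrow>
        norm ((\<Sum>i<n. blinfun_apply (F (Y (u i))) (incr X (u i) (u (Suc i))) + DFF F (Y (u i)) (XX (u i) (u (Suc i)))) - I) < e"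
      by (elim exE conjE)
    from this[rule_format, of 0 "\<lambda>_. 0"] show "norm I \<le> 0 + e" by (simp add: is_partition_def)
  qed
  then show ?thesis using I(2) by simp
qed

theorem theorem3p9:
  fixes p :: real and F :: "real^'e \<Rightarrow> (real^'d) \<Rightarrow>\<^sub>L (real^'e)"
  assumes "2 \<le> p" and "p < 3" and "Cb3 F"
  shows "(\<forall>(T::real) (X :: real \<Rightarrow> real^'d) (XX :: real \<Rightarrow> real \<Rightarrow> real^'d^'d) (y0 :: real^'e).
            0 < T \<and> cadlag_rough_path p T X XX \<longrightarrow>
            (\<exists>Y. Y \<in> Vp p T \<and> cadlag_on T Y \<and> rde_solution p T F X XX y0 Y \<and>
               (\<forall>Z. Z \<in> Vp p T \<and> cadlag_on T Z \<and> rde_solution p T F X XX y0 Z \<longrightarrow>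
                  (\<forall>t\<in>{0..T}. Z t = Y t)))) \<and>
         (\<exists>C>0. \<forall>L>0. \<exists>M::nat. real M \<le> C * L powr p + 1 \<and>
            (\<forall>(T::real) (X :: real \<Rightarrow> real^'d) (XX :: real \<Rightarrow> real \<Rightarrow> real^'d^'d)
               (X' :: real \<Rightarrow> real^'d) (XX' :: real \<Rightarrow> real \<Rightarrow> real^'d^'d)
               (Y :: real \<Rightarrow> real^'e) (Y' :: real \<Rightarrow> real^'e).
               0 < T \<and> cadlag_rough_path p T X XX \<and> cadlag_rough_path p T X' XX' \<and>
               rough_norm p T X XX < L \<and> rough_norm p T X' XX' < L \<and>
               rde_solution p T F X XX (Y 0) Y \<and> rde_solution p T F X' XX' (Y' 0) Y' \<longrightarrow>
               var_norm p T (incr (\<lambda>t. Y t - Y' t))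
                 \<le> (real M)\<^sup>2 * (C * max 1 L) ^ (M + 1) *
                   (rough_dist p T X XX X' XX' + norm (Y 0 - Y' 0))))"
proof -
  obtain P K where "rough_field F P K" using Cb3_imp_rough_field[OF assms(3)] .
  then interpret rough_field F P K .
  have p: "0 < p" "p < 3" "1 \<le> p" using assms(1,2) by auto
  show ?thesis
  proof (intro conjI allI impI)
    fix T :: real and X :: "real \<Rightarrow> real^'d" and XX :: "real \<Rightarrow> real \<Rightarrow> real^'d^'d" and y0 :: "real^'e"
    assume "0 < T \<and> cadlag_rough_path p T X XX"
    then have T: "0 < T" and X: "cadlag_rough_path p T X XX" and X': "rough_path p T X XX"
      by (simp_all add: cadlag_rough_path_def)
    obtain Y where Y: "cadlag_on T Y" "rde_solution p T F X XX y0 Y"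
      using rde_solution_exists[OF p(1,2) T X] by blast
    have "Z t = Y t" if Z: "rde_solution p T F X XX y0 Z" and t: "t \<in> {0..T}" for Z t
    proof (rule solves_unique[OF p T X' solves_of_rde_solution[OF Z] solves_of_rde_solution[OF Y(2)]])
      show "Z 0 = Y 0"
        using rde_solution_initial[OF Z] rde_solution_initial[OF Y(2)] T by simp
    qed (use t in auto)
    moreover have "Y \<in> Vp p T" using Y(2) by (simp add: rde_solution_def)
    ultimately show "\<exists>Y. Y \<in> Vp p T \<and> cadlag_on T Y \<and> rde_solution p T F X XX y0 Y \<and>
        (\<forall>Z. Z \<in> Vp p T \<and> cadlag_on T Z \<and> rde_solution p T F X XX y0 Z \<longrightarrow> (\<forall>t\<in>{0..T}. Z t = Y t))"
      using Y by blast
  next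
    show "\<exists>C>0. \<forall>L>0. \<exists>M::nat. real M \<le> C * L powr p + 1 \<and>
            (\<forall>(T::real) (X :: real \<Rightarrow> real^'d) (XX :: real \<Rightarrow> real \<Rightarrow> real^'d^'d)
               (X' :: real \<Rightarrow> real^'d) (XX' :: real \<Rightarrow> real \<Rightarrow> real^'d^'d)
               (Y :: real \<Rightarrow> real^'e) (Y' :: real \<Rightarrow> real^'e).
               0 < T \<and> cadlag_rough_path p T X XX \<and> cadlag_rough_path p T X' XX' \<and>
               rough_norm p T X XX < L \<and> rough_norm p T X' XX' < L \<and>
               rde_solution p T F X XX (Y 0) Y \<and> rde_solution p T F X' XX' (Y' 0) Y' \<longrightarrow>
               var_norm p T (incr (\<lambda>t. Y t - Y' t))
                 \<le> (real M)\<^sup>2 * (C * max 1 L) ^ (M + 1) *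
                   (rough_dist p T X XX X' XX' + norm (Y 0 - Y' 0)))"
      by (rule lipschitz_constants[OF assms(1,2)])
  qed
qed

end
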